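(* Let $\Omega=(0,1)^2$ with the uniform structured meshes described in the context. Assume that $a\in C^2(\overline\Omega)$ with $a(\mathbf{x})\ge a_0>0$, that $\vec\beta\in C^1(\overline\Omega)$ is a vector field with $\operatorname{div}\vec\beta\ge0$ pointwise in $\Omega$, and that $f\in L^2(\Omega)$. Let $\{\mathrm{Re}(A_n(a,\vec\beta))\}$ and $\{P_n(a)\}$ be the Hermitian positive definite matrix sequences defined in the context. Then the sequence $\{P_n^{-1}(a)\,\mathrm{Re}(A_n(a,\vec\beta))\}$ is properly clustered at $1$. Moreover, for any $n$ all the eigenvalues of $P_n^{-1}(a)\,\mathrm{Re}(A_n(a,\vec\beta))$ belong to an interval $[d,D]$ well separated from zero, i.e. there are constants $0<d\le D$ independent of $n$ such that all these eigenvalues lie in $[d,D]$ for every $n$.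
   Context: Mesh: for each integer $m\ge1$, $[0,1]^2$ is divided into $(m+1)^2$ equal squares of side $1/(m+1)$ and each square is divided into two triangles by a diagonal, all diagonals being parallel to one fixed direction. The mesh is denoted $\mathcal{T}_h$, with $h$ the maximum diameter of its triangles; $n=n(h)=m^2$ is the number of internal nodes, and the matrix sequences are indexed by these $n$ as $m\to\infty$. Let $\varphi_1,\dots,\varphi_n$ be the nodal basis of the continuous piecewise linear functions on $\mathcal{T}_h$ vanishing on $\partial\Omega$ ($\varphi_i$ equals $1$ at internal node $i$ and $0$ at every other node). Matrices (arising from the finite element approximation of $\operatorname{div}(-a\nabla u+\vec\beta u)=f$ in $\Omega$, $u=0$ on $\partial\Omega$): $A_n(a,\vec\beta)=\Theta_n(a)+\Psi_n(\vec\beta)\in\mathbb{R}^{n\times n}$ with $$(\Theta_n(a))_{i,j}=\int_\Omega a\,\nabla\varphi_i\cdot\nabla\varphi_j,\qquad(\Psi_n(\vec\beta))_{i,j}=-\int_\Omega(\nabla\varphi_i\cdot\vec\beta)\,\varphi_j.$$ Its Hermitian part is $\mathrm{Re}(A_n(a,\vec\beta))=\frac12(A_n(a,\vec\beta)+A_n(a,\vec\beta)^T)=\Theta_n(a)+\frac12(\Psi_n(\vec\beta)+\Psi_n^T(\vec\beta))$. The preconditioner is $$P_n(a)=D_n^{1/2}(a)\,A_n(1,0)\,D_n^{1/2}(a),\qquad D_n(a)=\mathrm{diag}(A_n(a,0))\,\mathrm{diag}^{-1}(A_n(1,0)),$$ where $\mathrm{diag}(X)$ is the diagonal matrix with the same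 main diagonal as $X$, so that $A_n(a,0)=\Theta_n(a)$ and $A_n(1,0)=\Theta_n(1)$. Clustering: a sequence $\{X_n\}$ of matrices of increasing dimension $n$ is properly (or strongly) clustered at $p$ if for any $\varepsilon>0$ the number of eigenvalues of $X_n$ not belonging to $(p-\varepsilon,p+\varepsilon)$ can be bounded by a constant possibly depending on $\varepsilon$ but not on $n$. *)

theory Defs
  imports
    "HOL-Analysis.Analysis"
    "Jordan_Normal_Form.Gauss_Jordan_Elimination"
    "Jordan_Normal_Form.Spectral_Radius"
begin

no_notation scalar_prod (infix "\<bullet>" 70)

section \<open>Differential operators and spaces of smooth functions\<close>

definition gradient :: "('a::euclidean_space \<Rightarrow> real) \<Rightarrow> 'a \<Rightarrow> 'a" where
  "gradient u x = (THE D. GDERIV u x :> D)"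

definition divergence :: "('a::euclidean_space \<Rightarrow> 'a) \<Rightarrow> 'a \<Rightarrow> real" where
  "divergence F x = (\<Sum>b\<in>Basis. gradient (\<lambda>y. F y \<bullet> b) x \<bullet> b)"

text \<open>
  \<open>C_closure k \<Omega> u\<close>, for open \<open>\<Omega>\<close>, says that \<open>u\<close> is of class $C^k$ on the closure of \<open>\<Omega>\<close>:
  all partial derivatives of \<open>u\<close> up to order \<open>k\<close> exist in \<open>\<Omega>\<close> and extend continuously
  to the closure. The witness \<open>G\<close> is the gradient in \<open>\<Omega>\<close>, and its values on the frontier are
  those of the continuous extension.
\<close>

primrec C_closure :: "nat \<Rightarrow> 'a::euclidean_space set \<Rightarrow> ('a \<Rightarrow> real) \<Rightarrow> bool" where
  "C_closure 0 \<Omega> u \<longleftrightarrow> continuous_on (closure \<Omega>) u"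
| "C_closure (Suc k) \<Omega> u \<longleftrightarrow> continuous_on (closure \<Omega>) u \<and>
     (\<exists>G. (\<forall>x\<in>\<Omega>. GDERIV u x :> G x) \<and> (\<forall>b\<in>Basis. C_closure k \<Omega> (\<lambda>x. G x \<bullet> b)))"


section \<open>Mesh and nodal basis\<close>

definition unit_square :: "(real \<times> real) set" where
  "unit_square = {0<..<1} \<times> {0<..<1}"

text \<open>
  The common direction of the diagonals that split the squares: \<open>Rising\<close> is the direction
  $(1,1)$ and \<open>Falling\<close> the direction $(1,-1)$.
\<close>

datatype diagonal = Rising | Falling

definition node :: "nat \<Rightarrow> nat \<Rightarrow> nat \<Rightarrow> real \<times> real" where
  "node m i j = (real i / real (m + 1), real j / real (m + 1))"

definition nodes :: "nat \<Rightarrow> (real \<times> real) set" where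
  "nodes m = {node m i j |i j. i \<le> m + 1 \<and> j \<le> m + 1}"

fun square_triangles :: "diagonal \<Rightarrow> nat \<Rightarrow> nat \<Rightarrow> nat \<Rightarrow> (real \<times> real) set set" where
  "square_triangles Rising m i j =
     {convex hull {node m i j, node m (i + 1) j, node m (i + 1) (j + 1)},
      convex hull {node m i j, node m i (j + 1), node m (i + 1) (j + 1)}}"
| "square_triangles Falling m i j =
     {convex hull {node m i j, node m (i + 1) j, node m i (j + 1)},
      convex hull {node m (i + 1) (j + 1), node m (i + 1) j, node m i (j + 1)}}"

definition mesh :: "diagonal \<Rightarrow> nat \<Rightarrow> (real \<times> real) set set" where
  "mesh dg m = (\<Union>i\<in>{..m}. \<Union>j\<in>{..m}. square_triangles dg m i j)"

text \<open>
  Elements of the finite element space are extended by zero outside the square, so that each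
  of them is determined by its restriction to the closed square.
\<close>

definition fe_space :: "diagonal \<Rightarrow> nat \<Rightarrow> (real \<times> real \<Rightarrow> real) set" where
  "fe_space dg m = {v. continuous_on (closure unit_square) v \<and>
     (\<forall>K\<in>mesh dg m. \<exists>c g. \<forall>x\<in>K. v x = c + g \<bullet> x) \<and>
     (\<forall>x. x \<notin> unit_square \<longrightarrow> v x = 0)}"

text \<open>
  The \<open>m^2\<close> internal nodes are numbered lexicographically from \<open>0\<close>.
\<close>

definition internal_node :: "nat \<Rightarrow> nat \<Rightarrow> real \<times> real" where
  "internal_node m k = node m (k mod m + 1) (k div m + 1)"

definition nodal_basis :: "diagonal \<Rightarrow> nat \<Rightarrow> nat \<Rightarrow> real \<times> real \<Rightarrow> real" where
  "nodal_basis dg m k = (THE v. v \<in> fe_space dg m \<and> v (internal_node m k) = 1 \<and>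
     (\<forall>q\<in>nodes m - {internal_node m k}. v q = 0))"


section \<open>The matrices\<close>

text \<open>
  The gradient of a nodal basis function is the classical one inside each triangle; its
  unspecified values on the edges do not affect the integrals, since \<open>lebesgue\<close> is complete.
  All matrices are indexed by \<open>m\<close> and have order \<open>m^2\<close>.
\<close>

definition Theta_mat :: "diagonal \<Rightarrow> nat \<Rightarrow> (real \<times> real \<Rightarrow> real) \<Rightarrow> real mat" where
  "Theta_mat dg m a = Matrix.mat (m^2) (m^2) (\<lambda>(i, j).
     LINT x:unit_square|lebesgue.
       a x * (gradient (nodal_basis dg m i) x \<bullet> gradient (nodal_basis dg m j) x))"

definition Psi_mat ::
  "diagonal \<Rightarrow> nat \<Rightarrow> (real \<times> real \<Rightarrow> real \<times> real) \<Rightarrow> real mat" where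
  "Psi_mat dg m \<beta> = Matrix.mat (m^2) (m^2) (\<lambda>(i, j).
     - (LINT x:unit_square|lebesgue.
          (gradient (nodal_basis dg m i) x \<bullet> \<beta> x) * nodal_basis dg m j x))"

definition A_mat ::
  "diagonal \<Rightarrow> nat \<Rightarrow> (real \<times> real \<Rightarrow> real) \<Rightarrow> (real \<times> real \<Rightarrow> real \<times> real) \<Rightarrow> real mat" where
  "A_mat dg m a \<beta> = Theta_mat dg m a + Psi_mat dg m \<beta>"

definition Re_mat :: "real mat \<Rightarrow> real mat" where
  "Re_mat X = (1/2) \<cdot>\<^sub>m (X + transpose_mat X)"

text \<open>\<open>inv_mat\<close> is unspecified on singular matrices.\<close>

definition inv_mat :: "real mat \<Rightarrow> real mat" where
  "inv_mat X = the (mat_inverse X)"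

definition diag_part :: "real mat \<Rightarrow> real mat" where
  "diag_part X = mat_diag (dim_row X) (\<lambda>i. X $$ (i, i))"

text \<open>Square root of a diagonal matrix with nonnegative entries.\<close>

definition diag_sqrt :: "real mat \<Rightarrow> real mat" where
  "diag_sqrt X = mat_diag (dim_row X) (\<lambda>i. sqrt (X $$ (i, i)))"

definition D_mat :: "diagonal \<Rightarrow> nat \<Rightarrow> (real \<times> real \<Rightarrow> real) \<Rightarrow> real mat" where
  "D_mat dg m a =
     diag_part (A_mat dg m a (\<lambda>x. 0)) * inv_mat (diag_part (A_mat dg m (\<lambda>x. 1) (\<lambda>x. 0)))"

definition P_mat :: "diagonal \<Rightarrow> nat \<Rightarrow> (real \<times> real \<Rightarrow> real) \<Rightarrow> real mat" where
  "P_mat dg m a =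
     diag_sqrt (D_mat dg m a) * A_mat dg m (\<lambda>x. 1) (\<lambda>x. 0) * diag_sqrt (D_mat dg m a)"


section \<open>Clustering\<close>

text \<open>
  Sequences are indexed by \<open>m \<ge> 1\<close>. Eigenvalues are complex and are counted with algebraic
  multiplicity; the interval is a set of real numbers.
\<close>

definition properly_clustered :: "(nat \<Rightarrow> complex mat) \<Rightarrow> real \<Rightarrow> bool" where
  "properly_clustered X p \<longleftrightarrow> (\<forall>\<epsilon>>0. \<exists>C. \<forall>m\<ge>1.
     size {#z \<in># proots (char_poly (X m)). z \<notin> complex_of_real ` {p - \<epsilon><..<p + \<epsilon>}#} \<le> C)"

end

theory Submission
  imports Defs
begin

text \<open>
  Write $h = 1/(m+1)$, $P = P_n(a)$, $R$ for the Hermitian part of $A_n(a,\beta)$ and $E = R - P$.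
  Everything rests on the fact that the entries of $E$ are $O(h^2)$ uniformly in $m$, while $E$ has at
  most nine entries in each row and column.

  On these meshes $\Theta_n(a)$ is a weighted graph Laplacian of the grid: the hypotenuses of the
  triangles carry no coupling, and a grid edge carries the mean of $a$ over the parallelogram formed by
  its two triangles (\<open>Theta_diag\<close>, \<open>Theta_neighbour\<close>). So $\Theta_n(1)$ is the five-point
  matrix, and $P$ has the entries $\sqrt{D_k}\,\Theta_n(1)_{kl}\sqrt{D_l}$, where $D_k$ is the mean of the
  four weights around node $k$. The parallelograms are symmetric about the midpoints of their edges,
  hence the means are second order accurate there, and by Taylor expansion about the midpoint the weight
  of an edge differs from $\sqrt{D_k D_l}$ by $O(h^2)$ (\<open>neighbour_error\<close>). Integration by parts turns
  $\Psi_n + \Psi_n^T$ into the mass matrix weighted by $\mathrm{div}\,\beta$ (\<open>Psi_symmetric_part\<close>): its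
  entries are $O(h^2)$, and it is positive semidefinite since $\mathrm{div}\,\beta \ge 0$.

  For the spectral bounds, the discrete Poincare inequality \<open>five_point_poincare\<close> bounds both forms
  $x^T P x$ and $x^T R x$ from below by a multiple of $h^2 |x|^2$. As $|x^T E x| = O(h^2)|x|^2$, each of the two
  forms is at most a constant times the other, and the eigenvalues, being quotients of the two forms, lie in a
  fixed interval.

  For the clustering, the sum of $(\lambda - 1)^2$ over the eigenvalues $\lambda$ of $P^{-1}R$, counted with
  multiplicity, is the trace of $(P^{-1}E)^2$ and therefore at most the squared Frobenius norm of $P^{-1}E$.
  This is $O(h^4)$ times the squared Frobenius norm of $P^{-1}$. In two dimensions the latter is $O(h^{-4})$:
  a discrete Sobolev inequality bounds the maximum of a grid function by $(m+1)/2$ times the Euclidean norm of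
  its five-point Laplacian (\<open>five_point_sup_bound\<close>), and by duality this bounds each row of $P^{-1}$
  (\<open>inverse_row_bound\<close>). The sum is thus bounded independently of $m$, and so is the number of
  eigenvalues at distance at least $\epsilon$ from $1$.
\<close>

no_notation Finite_Cartesian_Product.vec_nth (infixl "$" 90)

section \<open>Matrices preconditioned by a positive definite matrix\<close>

definition quad_form :: "real mat \<Rightarrow> (nat \<Rightarrow> real) \<Rightarrow> real" where
  "quad_form A x = (\<Sum>k<dim_row A. \<Sum>l<dim_col A. x k * A $$ (k, l) * x l)"

lemma mult_vec_index:
  assumes "A \<in> carrier_mat n n" "v \<in> carrier_vec n" "k < n"
  shows "(A *\<^sub>v v) $ k = (\<Sum>l<n. A $$ (k, l) * v $ l)"
  using assms by (simp add: scalar_prod_def atLeast0LessThan)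

lemma mult_mat_index:
  assumes "A \<in> carrier_mat n n" "B \<in> carrier_mat n n" "k < n" "l < n"
  shows "(A * B) $$ (k, l) = (\<Sum>j<n. A $$ (k, j) * B $$ (j, l))"
  using assms by (simp add: scalar_prod_def atLeast0LessThan)

lemma inv_mat_inverts:
  fixes A :: "real mat"
  assumes A: "A \<in> carrier_mat n n"
    and ker: "\<And>v. v \<in> carrier_vec n \<Longrightarrow> A *\<^sub>v v = 0\<^sub>v n \<Longrightarrow> v = 0\<^sub>v n"
  shows "inv_mat A \<in> carrier_mat n n" "A * inv_mat A = 1\<^sub>m n" "inv_mat A * A = 1\<^sub>m n"
proof -
  have "det A \<noteq> 0" using det_0_iff_vec_prod_zero_field[OF A] ker by blast
  then have "mat_inverse A \<noteq> None"
    using det_non_zero_imp_unit[OF A, where b = n] mat_inverse(1)[OF A, where b = n] by blast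
  then obtain B where B: "mat_inverse A = Some B" by blast
  from mat_inverse(2)[OF A B] show "inv_mat A \<in> carrier_mat n n" "A * inv_mat A = 1\<^sub>m n"
    "inv_mat A * A = 1\<^sub>m n" by (auto simp: inv_mat_def B)
qed

lemma pos_def_inv_mat:
  fixes A :: "real mat"
  assumes A: "A \<in> carrier_mat n n"
    and pos: "\<And>x. \<exists>k<n. x k \<noteq> 0 \<Longrightarrow> 0 < quad_form A x"
  shows "inv_mat A \<in> carrier_mat n n" "A * inv_mat A = 1\<^sub>m n" "inv_mat A * A = 1\<^sub>m n"
proof -
  have ker: "v = 0\<^sub>v n" if v: "v \<in> carrier_vec n" and 0: "A *\<^sub>v v = 0\<^sub>v n" for v
  proof (rule ccontr)
    assume "v \<noteq> 0\<^sub>v n"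
    then obtain k where k: "k < n" "v $ k \<noteq> 0" using v by (auto simp: Matrix.vec_eq_iff)
    have "quad_form A (\<lambda>k. v $ k) = (\<Sum>k<n. v $ k * (A *\<^sub>v v) $ k)"
      using A v by (auto simp: quad_form_def mult_vec_index sum_distrib_left mult.assoc simp del: index_mult_mat_vec intro!: sum.cong)
    also have "\<dots> = 0" unfolding 0 by simp
    finally show False using pos[of "\<lambda>k. v $ k"] k by auto
  qed
  show "inv_mat A \<in> carrier_mat n n" "A * inv_mat A = 1\<^sub>m n" "inv_mat A * A = 1\<^sub>m n"
    using inv_mat_inverts[OF A] ker by blast+
qed

text \<open>
  Symmetry cancels the products of a real part with an imaginary part. Through this identity a complex eigenvector
  can be tested against real quadratic forms.
\<close>

lemma symmetric_form_complex:
  fixes A :: "real mat" and z :: "nat \<Rightarrow> complex"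
  assumes A: "A \<in> carrier_mat n n" and sym: "\<And>k l. k < n \<Longrightarrow> l < n \<Longrightarrow> A $$ (k, l) = A $$ (l, k)"
  shows "(\<Sum>k<n. \<Sum>l<n. cnj (z k) * complex_of_real (A $$ (k, l)) * z l) =
    complex_of_real (quad_form A (\<lambda>k. Re (z k)) + quad_form A (\<lambda>k. Im (z k)))" (is "?S = _")
proof (rule complex_eqI)
  have "Re (cnj (z k) * complex_of_real (A $$ (k, l)) * z l) =
    Re (z k) * A $$ (k, l) * Re (z l) + Im (z k) * A $$ (k, l) * Im (z l)" for k l
    by (simp add: algebra_simps)
  then show "Re ?S = Re (complex_of_real (quad_form A (\<lambda>k. Re (z k)) + quad_form A (\<lambda>k. Im (z k))))"
    using A by (simp only: Re_sum Re_complex_of_real quad_form_def sum.distrib carrier_matD)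
  have Im: "Im (cnj (z k) * complex_of_real (A $$ (k, l)) * z l) =
    Re (z k) * A $$ (k, l) * Im (z l) - Im (z k) * A $$ (k, l) * Re (z l)" for k l
    by (simp add: algebra_simps)
  have "(\<Sum>k<n. \<Sum>l<n. Im (z k) * A $$ (k, l) * Re (z l)) = (\<Sum>k<n. \<Sum>l<n. Im (z l) * A $$ (l, k) * Re (z k))"
    by (rule sum.swap)
  also have "\<dots> = (\<Sum>k<n. \<Sum>l<n. Re (z k) * A $$ (k, l) * Im (z l))"
  proof (intro sum.cong refl)
    fix k l assume "k \<in> {..<n}" "l \<in> {..<n}"
    then have "A $$ (l, k) = A $$ (k, l)" using sym[of l k] by simp
    then show "Im (z l) * A $$ (l, k) * Re (z k) = Re (z k) * A $$ (k, l) * Im (z l)" by simp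
  qed
  finally have "(\<Sum>k<n. \<Sum>l<n. Re (z k) * A $$ (k, l) * Im (z l)) - (\<Sum>k<n. \<Sum>l<n. Im (z k) * A $$ (k, l) * Re (z l)) = 0"
    by simp
  then show "Im ?S = Im (complex_of_real (quad_form A (\<lambda>k. Re (z k)) + quad_form A (\<lambda>k. Im (z k))))"
    by (simp only: Im_sum Im_complex_of_real Im sum_subtractf)
qed

text \<open>
  The matrix $B^{-1}A$ need not be symmetric. But $B^{-1}Az = \lambda z$ means $Az = \lambda Bz$, so $\lambda$ is the
  quotient of the forms of $A$ and $B$ at $z$; this makes it real and transfers the bounds.
\<close>

lemma generalized_spectrum_bounds:
  fixes A B :: "real mat"
  assumes A: "A \<in> carrier_mat n n" and B: "B \<in> carrier_mat n n"
    and symA: "\<And>k l. k < n \<Longrightarrow> l < n \<Longrightarrow> A $$ (k, l) = A $$ (l, k)"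
    and symB: "\<And>k l. k < n \<Longrightarrow> l < n \<Longrightarrow> B $$ (k, l) = B $$ (l, k)"
    and pos: "\<And>x. \<exists>k<n. x k \<noteq> 0 \<Longrightarrow> 0 < quad_form B x"
    and lower: "\<And>x. d * quad_form B x \<le> quad_form A x"
    and upper: "\<And>x. quad_form A x \<le> D * quad_form B x"
  shows "spectrum (map_mat complex_of_real (inv_mat B * A)) \<subseteq> complex_of_real ` {d..D}"
proof
  let ?c = "map_mat complex_of_real"
  note inv = pos_def_inv_mat[OF B pos]
  fix lam assume "lam \<in> spectrum (?c (inv_mat B * A))"
  then obtain v where v: "v \<in> carrier_vec n" "v \<noteq> 0\<^sub>v n" and ev: "?c (inv_mat B * A) *\<^sub>v v = lam \<cdot>\<^sub>v v"
    using inv A by (auto simp: spectrum_def eigenvalue_def eigenvector_def)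
  obtain k0 where k0: "k0 < n" "v $ k0 \<noteq> 0" using v by (auto simp: Matrix.vec_eq_iff)
  have carr: "?c A \<in> carrier_mat n n" "?c B \<in> carrier_mat n n" "?c (inv_mat B * A) \<in> carrier_mat n n"
    using A B inv by auto
  have "?c B * ?c (inv_mat B * A) = ?c (B * (inv_mat B * A))"
    using A B inv by (subst of_real_hom.mat_hom_mult[of B n n]) auto
  also have "B * (inv_mat B * A) = (B * inv_mat B) * A"
    using A B inv by (subst assoc_mult_mat) auto
  also have "\<dots> = A" using inv A by simp
  finally have BA: "?c B * ?c (inv_mat B * A) = ?c A" .
  have "?c A *\<^sub>v v = (?c B * ?c (inv_mat B * A)) *\<^sub>v v" using BA by simp
  also have "\<dots> = ?c B *\<^sub>v (lam \<cdot>\<^sub>v v)" using assoc_mult_mat_vec[OF carr(2,3) v(1)] ev by simp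
  also have "\<dots> = lam \<cdot>\<^sub>v (?c B *\<^sub>v v)" using mult_mat_vec[OF carr(2) v(1)] by simp
  finally have eq: "?c A *\<^sub>v v = lam \<cdot>\<^sub>v (?c B *\<^sub>v v)" .
  have row: "(\<Sum>l<n. complex_of_real (A $$ (k, l)) * v $ l) = lam * (\<Sum>l<n. complex_of_real (B $$ (k, l)) * v $ l)"
    if "k < n" for k
    using arg_cong[OF eq, of "\<lambda>w. w $ k"] mult_vec_index[OF carr(1) v(1) that] mult_vec_index[OF carr(2) v(1) that] that A B v
    by (simp del: index_mult_mat_vec)
  define qA where "qA = quad_form A (\<lambda>k. Re (v $ k)) + quad_form A (\<lambda>k. Im (v $ k))"
  define qB where "qB = quad_form B (\<lambda>k. Re (v $ k)) + quad_form B (\<lambda>k. Im (v $ k))"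
  have "complex_of_real qA = (\<Sum>k<n. cnj (v $ k) * (\<Sum>l<n. complex_of_real (A $$ (k, l)) * v $ l))"
    using symmetric_form_complex[OF A symA, of "\<lambda>k. v $ k"] unfolding qA_def by (simp only: sum_distrib_left mult.assoc)
  also have "\<dots> = (\<Sum>k<n. cnj (v $ k) * (lam * (\<Sum>l<n. complex_of_real (B $$ (k, l)) * v $ l)))"
    using row by (intro sum.cong) auto
  also have "\<dots> = lam * (\<Sum>k<n. \<Sum>l<n. cnj (v $ k) * complex_of_real (B $$ (k, l)) * v $ l)"
    by (simp add: sum_distrib_left ac_simps)
  also have "\<dots> = lam * complex_of_real qB"
    unfolding qB_def using symmetric_form_complex[OF B symB, of "\<lambda>k. v $ k"] by simp
  finally have lam: "complex_of_real qA = lam * complex_of_real qB" .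
  have nonneg: "0 \<le> quad_form B x" for x
  proof (cases "\<exists>k<n. x k \<noteq> 0")
    case True then show ?thesis using pos less_imp_le by blast
  next
    case False then show ?thesis using B by (simp add: quad_form_def)
  qed
  have "Re (v $ k0) \<noteq> 0 \<or> Im (v $ k0) \<noteq> 0" using k0 by (auto simp: complex_eq_iff)
  then have "0 < quad_form B (\<lambda>k. Re (v $ k)) \<or> 0 < quad_form B (\<lambda>k. Im (v $ k))"
    using pos[of "\<lambda>k. Re (v $ k)"] pos[of "\<lambda>k. Im (v $ k)"] k0(1) by meson
  then have qB: "0 < qB" unfolding qB_def
    using nonneg[of "\<lambda>k. Re (v $ k)"] nonneg[of "\<lambda>k. Im (v $ k)"] by linarith
  have "lam = complex_of_real (qA / qB)" using lam qB by (simp add: field_simps)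
  moreover have "d * qB \<le> qA" "qA \<le> D * qB"
    unfolding qA_def qB_def using lower[of "\<lambda>k. Re (v $ k)"] lower[of "\<lambda>k. Im (v $ k)"]
      upper[of "\<lambda>k. Re (v $ k)"] upper[of "\<lambda>k. Im (v $ k)"] by (auto simp: algebra_simps)
  then have "qA / qB \<in> {d..D}" using qB by (simp add: field_simps)
  ultimately show "lam \<in> complex_of_real ` {d..D}" by blast
qed

lemma trace_comm:
  fixes A B :: "'a::comm_ring_1 mat"
  assumes "A \<in> carrier_mat n n" "B \<in> carrier_mat n n"
  shows "(\<Sum>i<n. (A * B) $$ (i, i)) = (\<Sum>i<n. (B * A) $$ (i, i))"
proof -
  have "(\<Sum>i<n. (A * B) $$ (i, i)) = (\<Sum>i<n. \<Sum>j<n. A $$ (i, j) * B $$ (j, i))"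
    using mult_mat_index[OF assms] by simp
  also have "\<dots> = (\<Sum>i<n. \<Sum>j<n. A $$ (j, i) * B $$ (i, j))" by (rule sum.swap)
  also have "\<dots> = (\<Sum>i<n. (B * A) $$ (i, i))"
    using mult_mat_index[OF assms(2,1)] by (simp add: mult.commute)
  finally show ?thesis .
qed

text \<open>
  Both sides are the trace of $(X-1)^2$: the left one is read off from a triangular matrix similar to $X$, the right
  one from the entries.
\<close>

lemma sum_eigenvalue_deviations:
  fixes X :: "complex mat"
  assumes X: "X \<in> carrier_mat n n"
  shows "(\<Sum>z\<in>#proots (char_poly X). (z - 1)^2) =
    (\<Sum>k<n. \<Sum>l<n. (X - 1\<^sub>m n) $$ (k, l) * (X - 1\<^sub>m n) $$ (l, k))"
proof -
  obtain es where es: "char_poly X = (\<Prod>a\<leftarrow>es. [:- a, 1:])" "length es = n"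
    using char_poly_factorized[OF X] by blast
  obtain B P Q where "schur_decomposition X es = (B, P, Q)" by (cases "schur_decomposition X es")
  from schur_decomposition[OF X es(1) this] have wit: "similar_mat_wit X B P Q"
    and ut: "upper_triangular B" and dg: "diag_mat B = es" by auto
  from similar_mat_witD2[OF X wit] have PQ: "P * Q = 1\<^sub>m n" "Q * P = 1\<^sub>m n" "X = P * B * Q"
    and c: "B \<in> carrier_mat n n" "P \<in> carrier_mat n n" "Q \<in> carrier_mat n n" by auto
  let ?Y = "X - 1\<^sub>m n" and ?C = "B - 1\<^sub>m n"
  have Y: "?Y = P * ?C * Q"
  proof -
    have "P * ?C * Q = (P * B - P) * Q" using c by (simp add: mult_minus_distrib_mat)
    also have "\<dots> = P * B * Q - P * Q" using c by (subst minus_mult_distrib_mat[of _ n n]) auto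
    finally show ?thesis using PQ by simp
  qed
  have C: "?C \<in> carrier_mat n n" and Yc: "?Y \<in> carrier_mat n n" using c X by auto
  have "?Y * ?Y = (P * ?C * Q) * (P * (?C * Q))"
    unfolding Y using c C by (simp add: assoc_mult_mat[of _ n n _ n _ n])
  also have "\<dots> = (P * ?C) * ((Q * P) * (?C * Q))"
    using c C by (simp add: assoc_mult_mat[of _ n n _ n _ n])
  also have "\<dots> = (P * (?C * ?C)) * Q"
    using c C PQ by (simp add: assoc_mult_mat[of _ n n _ n _ n])
  finally have YY: "?Y * ?Y = (P * (?C * ?C)) * Q" .
  have "(\<Sum>k<n. \<Sum>l<n. ?Y $$ (k, l) * ?Y $$ (l, k)) = (\<Sum>k<n. (?Y * ?Y) $$ (k, k))"
    using mult_mat_index[OF Yc Yc] by (simp del: index_mult_mat)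
  also have "\<dots> = (\<Sum>k<n. (Q * (P * (?C * ?C))) $$ (k, k))"
    unfolding YY using c C by (intro trace_comm) auto
  also have "Q * (P * (?C * ?C)) = (Q * P) * (?C * ?C)"
    using c C by (subst assoc_mult_mat[of _ n n _ n _ n]) auto
  also have "\<dots> = ?C * ?C" using PQ C by auto
  also have "(\<Sum>k<n. (?C * ?C) $$ (k, k)) = (\<Sum>k<n. (B $$ (k, k) - 1)^2)"
  proof (rule sum.cong)
    fix k assume k: "k \<in> {..<n}"
    have "(?C * ?C) $$ (k, k) = (\<Sum>l<n. ?C $$ (k, l) * ?C $$ (l, k))"
      using mult_mat_index[OF C C] k by simp
    \<comment> \<open>Off the diagonal one of the two factors lies below the diagonal and vanishes.\<close>
    also have "\<dots> = (\<Sum>l<n. if l = k then (B $$ (k, k) - 1)^2 else 0)"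
    proof (rule sum.cong)
      fix l assume l: "l \<in> {..<n}"
      have "B $$ (k, l) = 0" if "l < k" using ut that k c by auto
      moreover have "B $$ (l, k) = 0" if "k < l" using ut that l c by auto
      ultimately show "?C $$ (k, l) * ?C $$ (l, k) = (if l = k then (B $$ (k, k) - 1)^2 else 0)"
        using k l c by (cases l k rule: linorder_cases) (auto simp: power2_eq_square)
    qed simp
    finally show "(?C * ?C) $$ (k, k) = (B $$ (k, k) - 1)^2" using k by simp
  qed simp
  also have "\<dots> = (\<Sum>z\<leftarrow>es. (z - 1)^2)"
    using c by (auto simp: dg[symmetric] diag_mat_def o_def interv_sum_list_conv_sum_set_nat atLeast0LessThan)
  also have "\<dots> = (\<Sum>z\<in>#mset es. (z - 1)^2)" by (simp flip: sum_mset_sum_list)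
  also have "mset es = proots (char_poly X)"
  proof -
    have "proots (\<Prod>a\<leftarrow>es. [:- a, 1:]) = (\<Sum>a\<leftarrow>es. {#a#})"
      by (subst proots_prod_list[of "map (\<lambda>a. [:- a, 1:]) es", simplified map_map o_def map_ident]) (auto simp: o_def)
    also have "\<dots> = mset es" by (induction es) auto
    finally show ?thesis using es by simp
  qed
  finally show ?thesis by simp
qed

text \<open>
  A Chebyshev estimate: the eigenvalues are real, each of them outside the interval contributes at least $\epsilon^2$ to the trace of
  $(M-1)^2$, and that trace is at most the squared Frobenius norm of $M-1$.
\<close>

lemma deviation_count:
  fixes M :: "real mat"
  assumes M: "M \<in> carrier_mat n n" and eps: "0 < \<epsilon>"
    and real: "spectrum (map_mat complex_of_real M) \<subseteq> complex_of_real ` UNIV"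
  shows "\<epsilon>^2 * real (size {#z \<in># proots (char_poly (map_mat complex_of_real M)).
      z \<notin> complex_of_real ` {1 - \<epsilon><..<1 + \<epsilon>}#}) \<le> (\<Sum>k<n. \<Sum>l<n. ((M - 1\<^sub>m n) $$ (k, l))^2)"
proof -
  let ?X = "map_mat complex_of_real M" and ?Y = "M - 1\<^sub>m n"
  have X: "?X \<in> carrier_mat n n" using M by auto
  define Z where "Z = proots (char_poly ?X)"
  define bad where "bad z \<longleftrightarrow> z \<notin> complex_of_real ` {1 - \<epsilon><..<1 + \<epsilon>}" for z
  have zreal: "Im z = 0" if "z \<in># Z" for z
  proof -
    have "char_poly ?X \<noteq> 0" using degree_monic_char_poly[OF X] by auto
    then have "poly (char_poly ?X) z = 0" using that unfolding Z_def by simp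
    then have "z \<in> spectrum ?X"
      using eigenvalue_root_char_poly[OF X] by (simp add: spectrum_def)
    then show ?thesis using real by auto
  qed
  have "\<epsilon>^2 * real (size (filter_mset bad Z)) = (\<Sum>z\<in>#filter_mset bad Z. \<epsilon>^2)"
    by (simp add: sum_mset_constant)
  also have "\<dots> \<le> (\<Sum>z\<in>#filter_mset bad Z. (Re z - 1)^2)"
  proof (rule sum_mset_mono)
    fix z assume z: "z \<in># filter_mset bad Z"
    then have im: "Im z = 0" and "bad z" using zreal by auto
    have "z = complex_of_real (Re z)" using im by (simp add: complex_eq_iff)
    then have "Re z \<notin> {1 - \<epsilon><..<1 + \<epsilon>}" using \<open>bad z\<close> unfolding bad_def by (metis image_eqI)
    then have "\<epsilon> \<le> \<bar>Re z - 1\<bar>" by auto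
    then show "\<epsilon>^2 \<le> (Re z - 1)^2" using eps by (metis abs_le_square_iff abs_of_pos)
  qed
  also have "\<dots> \<le> (\<Sum>z\<in>#Z. (Re z - 1)^2)"
  proof -
    have "(\<Sum>z\<in>#Z. (Re z - 1)^2) = (\<Sum>z\<in>#filter_mset bad Z. (Re z - 1)^2) + (\<Sum>z\<in>#filter_mset (\<lambda>z. \<not> bad z) Z. (Re z - 1)^2)"
      by (metis (no_types) image_mset_union multiset_partition sum_mset.union)
    moreover have "0 \<le> (\<Sum>z\<in>#filter_mset (\<lambda>z. \<not> bad z) Z. (Re z - 1)^2)"
      by (induction Z) auto
    ultimately show ?thesis by linarith
  qed
  also have "\<dots> = Re (\<Sum>z\<in>#Z. (z - 1)^2)"
  proof -
    have "(\<Sum>z\<in>#Z. (z - 1)^2) = (\<Sum>z\<in>#Z. complex_of_real ((Re z - 1)^2))"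
      using zreal by (intro arg_cong[where f = sum_mset] image_mset_cong)
        (auto simp: complex_eq_iff power2_eq_square)
    also have "\<dots> = complex_of_real (\<Sum>z\<in>#Z. (Re z - 1)^2)"
      by (induction Z) auto
    finally show ?thesis by (simp only: Re_complex_of_real)
  qed
  also have "(\<Sum>z\<in>#Z. (z - 1)^2) = complex_of_real (\<Sum>k<n. \<Sum>l<n. ?Y $$ (k, l) * ?Y $$ (l, k))"
    unfolding Z_def sum_eigenvalue_deviations[OF X] of_real_sum
    using M by (intro sum.cong) auto
  also have "Re \<dots> \<le> (\<Sum>k<n. \<Sum>l<n. (?Y $$ (k, l))^2)"
  proof -
    have "(\<Sum>k<n. \<Sum>l<n. ?Y $$ (k, l) * ?Y $$ (l, k))
        \<le> (\<Sum>k<n. \<Sum>l<n. ((?Y $$ (k, l))^2 + (?Y $$ (l, k))^2) / 2)"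
    proof (intro sum_mono)
      fix k l show "?Y $$ (k, l) * ?Y $$ (l, k) \<le> ((?Y $$ (k, l))^2 + (?Y $$ (l, k))^2) / 2"
        using sum_squares_bound[of "?Y $$ (k, l)" "?Y $$ (l, k)"] by simp
    qed
    also have "\<dots> = ((\<Sum>k<n. \<Sum>l<n. (?Y $$ (k, l))^2) + (\<Sum>k<n. \<Sum>l<n. (?Y $$ (l, k))^2)) / 2"
      by (simp add: sum.distrib sum_divide_distrib add_divide_distrib)
    also have "(\<Sum>k<n. \<Sum>l<n. (?Y $$ (l, k))^2) = (\<Sum>k<n. \<Sum>l<n. (?Y $$ (k, l))^2)"
      by (rule sum.swap)
    finally show ?thesis by (simp only: Re_complex_of_real) simp
  qed
  finally show ?thesis unfolding Z_def bad_def .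
qed

text \<open>
  The constant $9$ here and below is the number of grid nodes in a block of three by three.
\<close>

lemma sparse_sum_le:
  fixes f :: "nat \<Rightarrow> real"
  assumes "finite N" "card N \<le> 9" and zero: "\<And>l. l < n \<Longrightarrow> l \<notin> N \<Longrightarrow> f l = 0"
    and bd: "\<And>l. l < n \<Longrightarrow> f l \<le> e" and "0 \<le> e"
  shows "(\<Sum>l<n. f l) \<le> 9 * e"
proof -
  have "(\<Sum>l<n. f l) = (\<Sum>l\<in>{..<n} \<inter> N. f l)"
    using zero by (intro sum.mono_neutral_right) auto
  also have "\<dots> \<le> real (card ({..<n} \<inter> N)) * e"
    using bd by (intro sum_bounded_above) auto
  also have "\<dots> \<le> 9 * e"
  proof (rule mult_right_mono)
    have "card ({..<n} \<inter> N) \<le> card N" using assms(1) by (intro card_mono) auto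
    then show "real (card ({..<n} \<inter> N)) \<le> 9" using assms(2) by simp
  qed fact
  finally show ?thesis .
qed

text \<open>
  The Schur test: $2|x_k x_l| \le x_k^2 + x_l^2$, and each square is met by at most nine entries of size $e$.
\<close>

lemma sparse_quad_form_bound:
  fixes E :: "nat \<Rightarrow> nat \<Rightarrow> real"
  assumes fin: "\<And>k. finite (N k)" and card: "\<And>k. k < n \<Longrightarrow> card (N k) \<le> 9"
    and N_sym: "\<And>k l. l \<in> N k \<longleftrightarrow> k \<in> N l"
    and zero: "\<And>k l. k < n \<Longrightarrow> l < n \<Longrightarrow> l \<notin> N k \<Longrightarrow> E k l = 0"
    and bd: "\<And>k l. k < n \<Longrightarrow> l < n \<Longrightarrow> \<bar>E k l\<bar> \<le> e" and e: "0 \<le> e"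
  shows "\<bar>\<Sum>k<n. \<Sum>l<n. x k * E k l * x l\<bar> \<le> 9 * e * (\<Sum>k<n. (x k)^2)"
proof -
  define F where "F k l = (if l \<in> N k then e else 0)" for k l
  have F: "F k l = F l k" for k l using N_sym by (simp add: F_def)
  have row: "(\<Sum>l<n. F k l * (x k)^2) \<le> 9 * (e * (x k)^2)" if "k < n" for k
    using e card[OF that] fin by (intro sparse_sum_le[of "N k"]) (auto simp: F_def)
  have "\<bar>\<Sum>k<n. \<Sum>l<n. x k * E k l * x l\<bar> \<le> (\<Sum>k<n. \<Sum>l<n. \<bar>x k * E k l * x l\<bar>)"
    by (intro order.trans[OF sum_abs] sum_mono sum_abs)
  also have "\<dots> \<le> (\<Sum>k<n. \<Sum>l<n. F k l * (x k)^2 / 2 + F l k * (x l)^2 / 2)"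
  proof (intro sum_mono)
    fix k l assume kl: "k \<in> {..<n}" "l \<in> {..<n}"
    have "\<bar>E k l\<bar> \<le> F k l" using zero[of k l] bd[of k l] kl e by (auto simp: F_def)
    moreover have "\<bar>x k * x l\<bar> \<le> ((x k)^2 + (x l)^2) / 2"
      using sum_squares_bound[of "\<bar>x k\<bar>" "\<bar>x l\<bar>"] by (simp add: abs_mult)
    ultimately have "\<bar>E k l\<bar> * \<bar>x k * x l\<bar> \<le> F k l * (((x k)^2 + (x l)^2) / 2)"
      by (intro mult_mono) auto
    then show "\<bar>x k * E k l * x l\<bar> \<le> F k l * (x k)^2 / 2 + F l k * (x l)^2 / 2"
      by (simp add: F[of l k] abs_mult algebra_simps add_divide_distrib)
  qed
  also have "\<dots> = (\<Sum>k<n. \<Sum>l<n. F k l * (x k)^2) / 2 + (\<Sum>k<n. \<Sum>l<n. F l k * (x l)^2) / 2"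
    by (simp add: sum.distrib sum_divide_distrib)
  also have "(\<Sum>k<n. \<Sum>l<n. F l k * (x l)^2) = (\<Sum>k<n. \<Sum>l<n. F k l * (x k)^2)"
    by (rule sum.swap)
  also have "(\<Sum>k<n. \<Sum>l<n. F k l * (x k)^2) / 2 + (\<Sum>k<n. \<Sum>l<n. F k l * (x k)^2) / 2 \<le> (\<Sum>k<n. 9 * (e * (x k)^2))"
    using sum_mono[of "{..<n}" "\<lambda>k. \<Sum>l<n. F k l * (x k)^2" "\<lambda>k. 9 * (e * (x k)^2)"] row by simp
  finally show ?thesis by (simp add: sum_distrib_left mult.assoc)
qed

text \<open>
  A bound of the maximum of $u$ by the Euclidean norm of $Pu$ is, by duality, a bound of the rows of $P^{-1}$. For the
  proof take $u = Q r$ with $r$ the $k$-th row of $Q$: then $Pu = r$, while $u_k = |r|^2$.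
\<close>

lemma inverse_row_bound:
  fixes P Q :: "real mat"
  assumes P: "P \<in> carrier_mat n n" and Q: "Q \<in> carrier_mat n n" and PQ: "P * Q = 1\<^sub>m n"
    and sup: "\<And>u k. k < n \<Longrightarrow> (u k)^2 \<le> K * (\<Sum>j<n. (\<Sum>l<n. P $$ (j, l) * u l)^2)"
    and k: "k < n" and K: "0 \<le> K"
  shows "(\<Sum>j<n. (Q $$ (k, j))^2) \<le> K"
proof -
  let ?s = "\<Sum>j<n. (Q $$ (k, j))^2"
  define u where "u l = (\<Sum>j<n. Q $$ (l, j) * Q $$ (k, j))" for l
  have "(\<Sum>l<n. P $$ (i, l) * u l) = Q $$ (k, i)" if i: "i < n" for i
  proof -
    have "(\<Sum>l<n. P $$ (i, l) * u l) = (\<Sum>l<n. \<Sum>j<n. P $$ (i, l) * Q $$ (l, j) * Q $$ (k, j))"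
      by (simp add: u_def sum_distrib_left mult.assoc)
    also have "\<dots> = (\<Sum>j<n. \<Sum>l<n. P $$ (i, l) * Q $$ (l, j) * Q $$ (k, j))" by (rule sum.swap)
    also have "\<dots> = (\<Sum>j<n. (P * Q) $$ (i, j) * Q $$ (k, j))"
      using mult_mat_index[OF P Q i] by (simp add: sum_distrib_right del: index_mult_mat)
    also have "\<dots> = (\<Sum>j<n. if j = i then Q $$ (k, i) else 0)"
      unfolding PQ using i by (intro sum.cong) auto
    finally show ?thesis using i by simp
  qed
  then have "(u k)^2 \<le> K * ?s" using sup[OF k, of u] by simp
  moreover have "u k = ?s" by (simp add: u_def power2_eq_square)
  ultimately have "?s * ?s \<le> K * ?s" by (simp add: power2_eq_square)
  moreover have "0 \<le> ?s" by (intro sum_nonneg) simp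
  ultimately show ?thesis using K by (cases "?s = 0") (auto simp: mult_le_cancel_right)
qed

text \<open>
  By the Cauchy-Schwarz inequality over the at most nine nonzero entries of a column, multiplication by a sparse matrix
  with entries of size $e$ costs a factor $9e$ in the norm of a row.
\<close>

lemma sparse_product_bound:
  fixes Q E :: "real mat"
  assumes Q: "Q \<in> carrier_mat n n" and E: "E \<in> carrier_mat n n"
    and fin: "\<And>k. finite (N k)" and card: "\<And>k. k < n \<Longrightarrow> card (N k) \<le> 9"
    and N_sym: "\<And>k l. l \<in> N k \<longleftrightarrow> k \<in> N l"
    and zero: "\<And>k l. k < n \<Longrightarrow> l < n \<Longrightarrow> l \<notin> N k \<Longrightarrow> E $$ (k, l) = 0"
    and bd: "\<And>k l. k < n \<Longrightarrow> l < n \<Longrightarrow> \<bar>E $$ (k, l)\<bar> \<le> e"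
    and k: "k < n"
  shows "(\<Sum>l<n. ((Q * E) $$ (k, l))^2) \<le> 81 * e^2 * (\<Sum>j<n. (Q $$ (k, j))^2)"
proof -
  have e: "0 \<le> e" using bd[OF k k] by linarith
  have sq: "(E $$ (j, l))^2 \<le> e^2" if "j < n" "l < n" for j l
    using bd[OF that] e by (metis abs_ge_zero power2_abs power_mono)
  have "((Q * E) $$ (k, l))^2 \<le> 9 * (\<Sum>j<n. (Q $$ (k, j))^2 * (E $$ (j, l))^2)" if l: "l < n" for l
  proof -
    have "(Q * E) $$ (k, l) = (\<Sum>j\<in>{..<n} \<inter> N l. Q $$ (k, j) * E $$ (j, l))"
      unfolding mult_mat_index[OF Q E k l] using zero[OF _ l] N_sym
      by (intro sum.mono_neutral_right) auto
    then have "((Q * E) $$ (k, l))^2 \<le> real (Finite_Set.card ({..<n} \<inter> N l)) * (\<Sum>j\<in>{..<n} \<inter> N l. (Q $$ (k, j) * E $$ (j, l))^2)"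
      using sum_squared_le_sum_of_squares[of "\<lambda>j. Q $$ (k, j) * E $$ (j, l)" "{..<n} \<inter> N l"] by (simp add: mult.commute)
    also have "\<dots> \<le> 9 * (\<Sum>j<n. (Q $$ (k, j) * E $$ (j, l))^2)"
    proof (rule mult_mono)
      have "Finite_Set.card ({..<n} \<inter> N l) \<le> Finite_Set.card (N l)" using fin by (intro card_mono) auto
      then show "real (Finite_Set.card ({..<n} \<inter> N l)) \<le> 9" using card[OF l] by simp
    qed (auto intro: sum_mono2 sum_nonneg)
    finally show ?thesis by (simp add: power_mult_distrib)
  qed
  then have "(\<Sum>l<n. ((Q * E) $$ (k, l))^2) \<le> (\<Sum>l<n. 9 * (\<Sum>j<n. (Q $$ (k, j))^2 * (E $$ (j, l))^2))"
    by (intro sum_mono) auto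
  also have "\<dots> = 9 * (\<Sum>j<n. \<Sum>l<n. (Q $$ (k, j))^2 * (E $$ (j, l))^2)"
    by (subst sum.swap) (simp add: sum_distrib_left)
  also have "\<dots> \<le> 9 * (\<Sum>j<n. 9 * ((Q $$ (k, j))^2 * e^2))"
  proof (intro mult_left_mono sum_mono)
    fix j assume "j \<in> {..<n}"
    then have j: "j < n" by simp
    show "(\<Sum>l<n. (Q $$ (k, j))^2 * (E $$ (j, l))^2) \<le> 9 * ((Q $$ (k, j))^2 * e^2)"
      using fin card[OF j] zero[OF j] sq[OF j] e
      by (intro sparse_sum_le[of "N j"]) (auto intro: mult_left_mono)
  qed simp
  finally show ?thesis by (simp add: sum_distrib_left mult_ac)
qed

text \<open>
  The linear algebra of the theorem for a single mesh. In the application $c$ and $e$ are of order $h^2$ and $K$ of order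
  $h^{-2}$ with $n \le h^{-2}$, so that both $e/c$ and $e^2 n K$ stay bounded.
\<close>

lemma preconditioned_eigenvalues:
  fixes P R :: "real mat"
  assumes P: "P \<in> carrier_mat n n" and R: "R \<in> carrier_mat n n"
    and symP: "\<And>k l. k < n \<Longrightarrow> l < n \<Longrightarrow> P $$ (k, l) = P $$ (l, k)"
    and symR: "\<And>k l. k < n \<Longrightarrow> l < n \<Longrightarrow> R $$ (k, l) = R $$ (l, k)"
    and c: "0 < c" and posP: "\<And>x. c * (\<Sum>k<n. (x k)^2) \<le> quad_form P x"
    and posR: "\<And>x. c * (\<Sum>k<n. (x k)^2) \<le> quad_form R x"
    and fin: "\<And>k. finite (N k)" and card: "\<And>k. k < n \<Longrightarrow> card (N k) \<le> 9"
    and N_sym: "\<And>k l. l \<in> N k \<longleftrightarrow> k \<in> N l"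
    and zero: "\<And>k l. k < n \<Longrightarrow> l < n \<Longrightarrow> l \<notin> N k \<Longrightarrow> R $$ (k, l) = P $$ (k, l)"
    and bd: "\<And>k l. k < n \<Longrightarrow> l < n \<Longrightarrow> \<bar>R $$ (k, l) - P $$ (k, l)\<bar> \<le> e" and e: "0 \<le> e"
    and sup: "\<And>u k. k < n \<Longrightarrow> (u k)^2 \<le> K * (\<Sum>j<n. (\<Sum>l<n. P $$ (j, l) * u l)^2)" and K: "0 \<le> K"
  shows "spectrum (map_mat complex_of_real (inv_mat P * R)) \<subseteq> complex_of_real ` {1 / (1 + 9 * e / c)..1 + 9 * e / c}"
      (is ?thesis1)
    and "0 < \<epsilon> \<Longrightarrow> \<epsilon>^2 * real (size {#z \<in># proots (char_poly (map_mat complex_of_real (inv_mat P * R))).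
      z \<notin> complex_of_real ` {1 - \<epsilon><..<1 + \<epsilon>}#}) \<le> 81 * e^2 * (real n * K)" (is "_ \<Longrightarrow> ?thesis2")
proof -
  let ?t = "9 * e / c"
  have t: "0 \<le> ?t" using e c by simp
  have pos: "0 < quad_form P x" if x: "\<exists>k<n. x k \<noteq> 0" for x
  proof -
    from x obtain k where "k < n" "x k \<noteq> 0" by blast
    then have "0 < (\<Sum>k<n. (x k)^2)" by (intro sum_pos2[of _ k]) auto
    then show ?thesis using posP[of x] c by (smt (verit) mult_pos_pos)
  qed
  note inv = pos_def_inv_mat[OF P pos]
  have diff: "\<bar>quad_form R x - quad_form P x\<bar> \<le> 9 * e * (\<Sum>k<n. (x k)^2)" for x
  proof -
    have "quad_form R x - quad_form P x = (\<Sum>k<n. \<Sum>l<n. x k * (R $$ (k, l) - P $$ (k, l)) * x l)"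
      using P R by (simp add: quad_form_def algebra_simps sum_subtractf)
    then show ?thesis using sparse_quad_form_bound[of N n "\<lambda>k l. R $$ (k, l) - P $$ (k, l)" e x, OF fin card N_sym _ bd e]
        zero by simp
  qed
  have small: "9 * e * (\<Sum>k<n. (x k)^2) \<le> ?t * q" if "c * (\<Sum>k<n. (x k)^2) \<le> q" for x q
    using mult_left_mono[OF that t] c by (simp add: field_simps)
  show spec: ?thesis1
  proof (rule generalized_spectrum_bounds[OF R P symR symP pos])
    fix x
    have "quad_form P x \<le> (1 + ?t) * quad_form R x"
      using diff[of x] small[OF posR[of x]] by (simp add: algebra_simps)
    then show "1 / (1 + ?t) * quad_form P x \<le> quad_form R x"
      using t by (simp add: divide_le_eq mult.commute)
    show "quad_form R x \<le> (1 + ?t) * quad_form P x"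
      using diff[of x] small[OF posP[of x]] by (simp add: algebra_simps)
  qed
  let ?Q = "inv_mat P" and ?E = "R - P"
  have "?Q * R - 1\<^sub>m n = ?Q * ?E"
    using inv P R by (simp add: mult_minus_distrib_mat)
  have E: "?E \<in> carrier_mat n n" using P R by auto
  assume eps: "0 < \<epsilon>"
  have M: "?Q * R \<in> carrier_mat n n" using inv R by auto
  have "spectrum (map_mat complex_of_real (?Q * R)) \<subseteq> complex_of_real ` UNIV" using spec by blast
  note deviation_count[OF M eps this]
  also have "(\<Sum>k<n. \<Sum>l<n. ((?Q * R - 1\<^sub>m n) $$ (k, l))^2) \<le> (\<Sum>k<n. 81 * e^2 * K)"
  proof (rule sum_mono)
    fix k assume "k \<in> {..<n}"
    then have k: "k < n" by simp
    have "(\<Sum>l<n. ((?Q * ?E) $$ (k, l))^2) \<le> 81 * e^2 * (\<Sum>j<n. (?Q $$ (k, j))^2)"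
      using P R zero bd by (intro sparse_product_bound[OF inv(1) E fin card N_sym _ _ k]) auto
    also have "\<dots> \<le> 81 * e^2 * K"
      using inverse_row_bound[OF P inv(1,2) sup k K] by (intro mult_left_mono) auto
    finally show "(\<Sum>l<n. ((?Q * R - 1\<^sub>m n) $$ (k, l))^2) \<le> 81 * e^2 * K"
      using \<open>?Q * R - 1\<^sub>m n = ?Q * ?E\<close> by simp
  qed
  finally show ?thesis2 by (simp add: mult_ac)
qed

section \<open>The five-point Laplacian\<close>

text \<open>
  The position of the unknown with index \<open>k\<close> in the grid; the internal nodes have coordinates from \<open>1\<close> to \<open>m\<close>.
\<close>

abbreviation (input) ix :: "nat \<Rightarrow> nat \<Rightarrow> nat" where "ix m k \<equiv> Suc (k mod m)"
abbreviation (input) iy :: "nat \<Rightarrow> nat \<Rightarrow> nat" where "iy m k \<equiv> Suc (k div m)"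

lemma sum_grid:
  fixes F :: "nat \<Rightarrow> nat \<Rightarrow> real"
  shows "(\<Sum>k<m^2. F (k mod m) (k div m)) = (\<Sum>j<m. \<Sum>i<m. F i j)"
proof -
  have "(\<Sum>i<m. F i j) = (\<Sum>k = j * m..<j * m + m. F (k mod m) (k div m))" for j
  proof (rule sum.reindex_bij_witness[of _ "\<lambda>k. k - j * m" "\<lambda>i. j * m + i"])
    fix k assume "k \<in> {j * m..<j * m + m}"
    then show "k - j * m \<in> {..<m}" by auto
  qed auto
  then show ?thesis by (simp add: sum.nat_group power2_eq_square)
qed

text \<open>
  The grid function with nodal values \<open>x\<close>, continued by zero. As a sum it vanishes by itself on the boundary lines.
\<close>

definition extension :: "nat \<Rightarrow> (nat \<Rightarrow> real) \<Rightarrow> nat \<Rightarrow> nat \<Rightarrow> real" where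
  "extension m x i j = (\<Sum>l<m^2. if ix m l = i \<and> iy m l = j then x l else 0)"

lemma grid_index_eq: "k < m^2 \<Longrightarrow> l < m^2 \<Longrightarrow> k mod m = l mod m \<Longrightarrow> k div m = l div m \<Longrightarrow> k = l" for k l m :: nat
  by (metis div_mult_mod_eq)

lemma grid_index_less: "k < m^2 \<Longrightarrow> k mod m < m" "k < m^2 \<Longrightarrow> k div m < m" for k m :: nat
  by (cases "m = 0"; simp add: power2_eq_square less_mult_imp_div_less)+

lemma extension_node:
  assumes "k < m^2"
  shows "extension m x (ix m k) (iy m k) = x k"
proof -
  have "extension m x (ix m k) (iy m k) = (\<Sum>l<m^2. if l = k then x k else 0)"
    unfolding extension_def using grid_index_eq[OF _ assms] by (intro sum.cong) auto
  then show ?thesis using assms by simp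
qed

lemma extension_boundary:
  "extension m x 0 j = 0" "extension m x (Suc m) j = 0" "extension m x i 0 = 0" "extension m x i (Suc m) = 0"
proof -
  have "k mod m \<noteq> m" "k div m \<noteq> m" if "k < m^2" for k
    using grid_index_less[OF that] by (metis less_irrefl)+
  then show "extension m x 0 j = 0" "extension m x (Suc m) j = 0" "extension m x i 0 = 0" "extension m x i (Suc m) = 0"
    by (auto simp: extension_def intro!: sum.neutral)
qed

definition five_point :: "nat \<Rightarrow> nat \<Rightarrow> nat \<Rightarrow> real" where
  "five_point m k l = (if k = l then 4
    else if iy m k = iy m l \<and> (ix m l = Suc (ix m k) \<or> ix m k = Suc (ix m l)) \<or>
      ix m k = ix m l \<and> (iy m l = Suc (iy m k) \<or> iy m k = Suc (iy m l)) then -1 else 0)"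

abbreviation (input) second_x :: "(nat \<Rightarrow> nat \<Rightarrow> real) \<Rightarrow> nat \<Rightarrow> nat \<Rightarrow> real" where
  "second_x v i j \<equiv> 2 * v (Suc i) (Suc j) - v i (Suc j) - v (Suc (Suc i)) (Suc j)"

abbreviation (input) second_y :: "(nat \<Rightarrow> nat \<Rightarrow> real) \<Rightarrow> nat \<Rightarrow> nat \<Rightarrow> real" where
  "second_y v i j \<equiv> 2 * v (Suc i) (Suc j) - v (Suc i) j - v (Suc i) (Suc (Suc j))"

lemma five_point_apply:
  fixes x :: "nat \<Rightarrow> real"
  assumes k: "k < m^2"
  defines "v \<equiv> extension m x" and "i \<equiv> k mod m" and "j \<equiv> k div m"
  shows "(\<Sum>l<m^2. five_point m k l * x l) =
    (second_x v i j) +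
    (second_y v i j)"
proof -
  have "five_point m k l * x l =
      4 * (if ix m l = Suc i \<and> iy m l = Suc j then x l else 0)
      - (if ix m l = i \<and> iy m l = Suc j then x l else 0)
      - (if ix m l = Suc (Suc i) \<and> iy m l = Suc j then x l else 0)
      - (if ix m l = Suc i \<and> iy m l = j then x l else 0)
      - (if ix m l = Suc i \<and> iy m l = Suc (Suc j) then x l else 0)" if "l < m^2" for l
    using grid_index_eq[OF k that] unfolding five_point_def i_def j_def by auto
  then have "(\<Sum>l<m^2. five_point m k l * x l) = 4 * v (Suc i) (Suc j) - v i (Suc j)
      - v (Suc (Suc i)) (Suc j) - v (Suc i) j - v (Suc i) (Suc (Suc j))"
    unfolding v_def extension_def by (simp add: sum_subtractf sum_distrib_left)
  then show ?thesis by simp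
qed

text \<open>
  The boundary terms are kept so that the identity holds for arbitrary \<open>w\<close> and follows by plain induction; all
  applications have \<open>w\<close> zero at both ends.
\<close>

lemma summation_by_parts:
  fixes u w :: "nat \<Rightarrow> real"
  shows "(\<Sum>i<m. (2 * u (Suc i) - u i - u (Suc (Suc i))) * w (Suc i)) =
    (\<Sum>i<Suc m. (u (Suc i) - u i) * (w (Suc i) - w i))
      - (u (Suc m) - u m) * w (Suc m) + (u (Suc 0) - u 0) * w 0"
  by (induction m) (simp_all add: algebra_simps)

text \<open>
  Write $u_i$ as the sum of its increments and apply the Cauchy-Schwarz inequality.
\<close>

lemma discrete_sobolev:
  fixes u :: "nat \<Rightarrow> real"
  assumes "u 0 = 0" "i \<le> Suc m"
  shows "(u i)^2 \<le> real (Suc m) * (\<Sum>k<Suc m. (u (Suc k) - u k)^2)"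
proof -
  have "u i = (\<Sum>k<i. u (Suc k) - u k)" using assms by (simp add: sum_lessThan_telescope)
  then have "(u i)^2 \<le> real i * (\<Sum>k<i. (u (Suc k) - u k)^2)"
    using sum_squared_le_sum_of_squares[of "\<lambda>k. u (Suc k) - u k" "{..<i}"] by (simp add: mult.commute)
  also have "\<dots> \<le> real (Suc m) * (\<Sum>k<Suc m. (u (Suc k) - u k)^2)"
    using assms by (intro mult_mono sum_mono2 sum_nonneg) auto
  finally show ?thesis .
qed

context
  fixes v :: "nat \<Rightarrow> nat \<Rightarrow> real" and m :: nat
  assumes v0: "\<And>j. v 0 j = 0" "\<And>j. v (Suc m) j = 0" "\<And>i. v i 0 = 0" "\<And>i. v i (Suc m) = 0"
begin

text \<open>
  The one-dimensional inequality along the grid lines in one direction suffices; the energy of the differences in the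
  other direction is nonnegative.
\<close>

lemma grid_energy:
  "(\<Sum>j<m. \<Sum>i<m. (v (Suc i) (Suc j))^2) \<le> (real (Suc m))^2 *
    (\<Sum>j<m. \<Sum>i<m. v (Suc i) (Suc j) * (second_x v i j) +
      v (Suc i) (Suc j) * (second_y v i j))"
proof -
  have x: "(\<Sum>i<m. v (Suc i) (Suc j) * (second_x v i j))
      = (\<Sum>i<Suc m. (v (Suc i) (Suc j) - v i (Suc j))^2)" for j
    using summation_by_parts[of "\<lambda>i. v i (Suc j)" "\<lambda>i. v i (Suc j)" m] v0
    by (simp add: power2_eq_square mult.commute)
  have y: "(\<Sum>j<m. v (Suc i) (Suc j) * (second_y v i j))
      = (\<Sum>j<Suc m. (v (Suc i) (Suc j) - v (Suc i) j)^2)" for i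
    using summation_by_parts[of "\<lambda>j. v (Suc i) j" "\<lambda>j. v (Suc i) j" m] v0
    by (simp add: power2_eq_square mult.commute)
  let ?X = "\<Sum>j<m. \<Sum>i<Suc m. (v (Suc i) (Suc j) - v i (Suc j))^2"
  let ?Y = "\<Sum>i<m. \<Sum>j<Suc m. (v (Suc i) (Suc j) - v (Suc i) j)^2"
  have "(\<Sum>j<m. \<Sum>i<m. v (Suc i) (Suc j) * (second_y v i j)) = ?Y"
    by (subst sum.swap) (simp only: y)
  then have energy: "(\<Sum>j<m. \<Sum>i<m. v (Suc i) (Suc j) * (second_x v i j) +
      v (Suc i) (Suc j) * (second_y v i j)) = ?X + ?Y"
    by (simp only: sum.distrib x)
  have "(\<Sum>j<m. \<Sum>i<m. (v (Suc i) (Suc j))^2) \<le>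
      (\<Sum>j<m. \<Sum>i<m. real (Suc m) * (\<Sum>i<Suc m. (v (Suc i) (Suc j) - v i (Suc j))^2))"
    using v0 by (intro sum_mono discrete_sobolev[where u = "\<lambda>i. v i _"]) auto
  also have "\<dots> = real m * real (Suc m) * ?X" by (simp only: sum_constant card_lessThan sum_distrib_left mult.assoc)
  also have "\<dots> \<le> (real (Suc m))^2 * (?X + ?Y)"
  proof -
    have "0 \<le> ?X" "0 \<le> ?Y" by (intro sum_nonneg zero_le_power2)+
    then show ?thesis unfolding power2_eq_square[of "real (Suc m)"] by (intro mult_mono) auto
  qed
  finally show ?thesis unfolding energy .
qed

text \<open>
  Summation by parts once in each direction. It shows that the product of the two second differences has a nonnegative
  sum, namely the energy of the mixed difference.
\<close>

lemma mixed_difference_identity: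
  "(\<Sum>j<m. \<Sum>i<m. (second_x v i j) *
      (second_y v i j)) =
    (\<Sum>i<Suc m. \<Sum>j<Suc m. ((v (Suc i) (Suc j) - v i (Suc j)) - (v (Suc i) j - v i j))^2)" (is "?L = ?R")
proof -
  define d where "d i j = v (Suc i) j - v i j" for i j
  have "?L = (\<Sum>j<m. \<Sum>i<Suc m. d i (Suc j) * (2 * d i (Suc j) - d i j - d i (Suc (Suc j))))"
  proof (rule sum.cong)
    fix j
    have "(\<Sum>i<m. (second_x v i j) *
        (second_y v i j)) =
      (\<Sum>i<Suc m. (v (Suc i) (Suc j) - v i (Suc j)) * ((second_y v i j)
        - (2 * v i (Suc j) - v i j - v i (Suc (Suc j)))))"
      using summation_by_parts[of "\<lambda>i. v i (Suc j)" "\<lambda>i. 2 * v i (Suc j) - v i j - v i (Suc (Suc j))" m]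
      by (simp only: v0 mult_zero_right diff_zero add_0_right)
    also have "\<dots> = (\<Sum>i<Suc m. d i (Suc j) * (2 * d i (Suc j) - d i j - d i (Suc (Suc j))))"
      by (intro sum.cong refl) (simp add: d_def algebra_simps)
    finally show "(\<Sum>i<m. (second_x v i j) *
        (second_y v i j)) =
      (\<Sum>i<Suc m. d i (Suc j) * (2 * d i (Suc j) - d i j - d i (Suc (Suc j))))" .
  qed simp
  also have "\<dots> = (\<Sum>i<Suc m. \<Sum>j<m. d i (Suc j) * (2 * d i (Suc j) - d i j - d i (Suc (Suc j))))"
    by (rule sum.swap)
  also have "\<dots> = (\<Sum>i<Suc m. \<Sum>j<Suc m. (d i (Suc j) - d i j)^2)"
  proof (rule sum.cong)
    fix i
    have "d i 0 = 0" "d i (Suc m) = 0" using v0 by (auto simp: d_def)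
    then show "(\<Sum>j<m. d i (Suc j) * (2 * d i (Suc j) - d i j - d i (Suc (Suc j)))) = (\<Sum>j<Suc m. (d i (Suc j) - d i j)^2)"
      using summation_by_parts[of "d i" "d i" m] by (simp add: power2_eq_square mult.commute)
  qed simp
  finally show ?thesis unfolding d_def .
qed

text \<open>
  The mixed difference controls the maximum, by applying the one-dimensional inequality in both directions. It is in turn
  controlled by the five-point Laplacian because $4ab \le (a+b)^2$ for the second differences $a$ and $b$.
\<close>

lemma grid_sup_bound:
  assumes "i \<le> Suc m" "j \<le> Suc m"
  shows "(v i j)^2 \<le> (real (Suc m))^2 / 4 *
    (\<Sum>j<m. \<Sum>i<m. ((second_x v i j) +
      (second_y v i j))^2)"
proof -
  let ?S = "\<Sum>i<Suc m. \<Sum>j<Suc m. ((v (Suc i) (Suc j) - v i (Suc j)) - (v (Suc i) j - v i j))^2"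
  have "(v i j)^2 \<le> real (Suc m) * (\<Sum>k<Suc m. (v (Suc k) j - v k j)^2)"
    using discrete_sobolev[of "\<lambda>i. v i j" i m] v0 assms by simp
  also have "\<dots> \<le> real (Suc m) * (\<Sum>k<Suc m. real (Suc m) *
      (\<Sum>l<Suc m. ((v (Suc k) (Suc l) - v k (Suc l)) - (v (Suc k) l - v k l))^2))"
  proof (intro mult_left_mono sum_mono)
    fix k show "(v (Suc k) j - v k j)^2 \<le> real (Suc m) *
        (\<Sum>l<Suc m. ((v (Suc k) (Suc l) - v k (Suc l)) - (v (Suc k) l - v k l))^2)"
      using discrete_sobolev[of "\<lambda>j. v (Suc k) j - v k j" j m] v0 assms by simp
  qed simp
  also have "\<dots> = (real (Suc m))^2 * ?S" by (simp only: sum_distrib_left power2_eq_square mult.assoc)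
  also have "4 * ?S \<le> (\<Sum>j<m. \<Sum>i<m. ((second_x v i j) +
      (second_y v i j))^2)"
    unfolding mixed_difference_identity[symmetric] sum_distrib_left
  proof (intro sum_mono)
    fix i j
    show "4 * ((second_x v i j) *
      (second_y v i j)) \<le>
      ((second_x v i j) +
      (second_y v i j))^2" (is "4 * (?a * ?b) \<le> _")
      using zero_le_power2[of "?a - ?b"] by (simp add: power2_eq_square algebra_simps)
  qed
  then have "(real (Suc m))^2 * ?S \<le> (real (Suc m))^2 * ((\<Sum>j<m. \<Sum>i<m. ((second_x v i j) +
      (second_y v i j))^2) / 4)"
    by (intro mult_left_mono) auto
  finally show ?thesis by simp
qed

end

lemma five_point_poincare:
  "(\<Sum>k<m^2. (x k)^2) \<le> (real (Suc m))^2 * (\<Sum>k<m^2. \<Sum>l<m^2. x k * five_point m k l * x l)"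
proof -
  let ?v = "extension m x"
  have "(\<Sum>k<m^2. (x k)^2) = (\<Sum>j<m. \<Sum>i<m. (?v (Suc i) (Suc j))^2)"
    using sum_grid[of "\<lambda>i j. (?v (Suc i) (Suc j))^2" m] by (simp add: extension_node)
  also have "\<dots> \<le> (real (Suc m))^2 *
    (\<Sum>j<m. \<Sum>i<m. ?v (Suc i) (Suc j) * (second_x ?v i j) +
      ?v (Suc i) (Suc j) * (second_y ?v i j))"
    by (rule grid_energy) (rule extension_boundary)+
  also have "(\<Sum>j<m. \<Sum>i<m. ?v (Suc i) (Suc j) * (second_x ?v i j) +
      ?v (Suc i) (Suc j) * (second_y ?v i j))
     = (\<Sum>k<m^2. x k * (\<Sum>l<m^2. five_point m k l * x l))"
    unfolding sum_grid[symmetric]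
    by (intro sum.cong refl) (simp add: five_point_apply extension_node distrib_left[symmetric] del: distrib_left_numeral)
  finally show ?thesis by (simp add: sum_distrib_left mult.assoc)
qed

lemma five_point_sup_bound:
  assumes k: "k < m^2"
  shows "(x k)^2 \<le> (real (Suc m))^2 / 4 * (\<Sum>j<m^2. (\<Sum>l<m^2. five_point m j l * x l)^2)"
proof -
  let ?v = "extension m x"
  have "(x k)^2 = (?v (ix m k) (iy m k))^2" using k by (simp add: extension_node)
  also have "\<dots> \<le> (real (Suc m))^2 / 4 *
    (\<Sum>j<m. \<Sum>i<m. ((second_x ?v i j) +
      (second_y ?v i j))^2)"
    using grid_index_less[OF k] by (intro grid_sup_bound extension_boundary) auto
  also have "(\<Sum>j<m. \<Sum>i<m. ((second_x ?v i j) +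
      (second_y ?v i j))^2)
     = (\<Sum>k<m^2. (\<Sum>l<m^2. five_point m k l * x l)^2)"
    unfolding sum_grid[symmetric] by (intro sum.cong refl) (simp only: five_point_apply lessThan_iff)
  finally show ?thesis .
qed

section \<open>The nodal basis\<close>

text \<open>
  The sign that turns one direction of the diagonals into the other by $t \mapsto \sigma t$; both meshes are treated
  together in this way.
\<close>

fun orient :: "diagonal \<Rightarrow> real" where
  "orient Rising = 1" | "orient Falling = -1"

lemma orient_cases: "orient dg = 1 \<or> orient dg = -1" by (cases dg) auto

text \<open>
  The nodal function of the origin on the mesh with unit squares. It is $1 - \max(|s|, |t|, |s - \sigma t|)$ on its
  hexagonal support. The three numbers are the distances between $0$, $s$ and $\sigma t$, so the largest is the sum of the
  two others and the maximum is half of the total; in this form the function is easy to differentiate.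
\<close>

definition hat :: "real \<Rightarrow> real \<Rightarrow> real \<Rightarrow> real" where
  "hat \<sigma> s t = max 0 (1 - (\<bar>s\<bar> + \<bar>t\<bar> + \<bar>s - \<sigma> * t\<bar>) / 2)"

text \<open>
  The largest of the three moduli is at least $1$, and it is half of their sum.
\<close>

lemma hat_far:
  assumes "\<sigma> = 1 \<or> \<sigma> = -1" "1 \<le> \<bar>s\<bar> \<or> 1 \<le> \<bar>t\<bar>"
  shows "hat \<sigma> s t = 0"
  using assms unfolding hat_def by auto

lemma hat_nonneg: "0 \<le> hat \<sigma> s t" and hat_le_1: "hat \<sigma> s t \<le> 1"
  by (auto simp: hat_def)

text \<open>
  Which of the two triangles of a unit square contains the point with coordinates \<open>s\<close> and \<open>t\<close>.
\<close>

fun in_half :: "diagonal \<Rightarrow> bool \<Rightarrow> real \<Rightarrow> real \<Rightarrow> bool" where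
  "in_half Rising b s t = (if b then t \<le> s else s \<le> t)"
| "in_half Falling b s t = (if b then s + t \<le> 1 else 1 \<le> s + t)"

text \<open>
  On a cell at least one unit away from the origin the function is zero. For the four cells touching the origin the
  coefficients are listed, separately for the two triangles.
\<close>

lemma hat_affine_on_cell:
  fixes I J :: int
  shows "\<exists>\<alpha> \<beta> \<gamma>. \<forall>s t. 0 \<le> s \<and> s \<le> 1 \<and> 0 \<le> t \<and> t \<le> 1 \<and> in_half dg b s t \<longrightarrow>
    hat (orient dg) (of_int I + s) (of_int J + t) = \<alpha> + \<beta> * s + \<gamma> * t"
proof (cases "I \<in> {-1, 0} \<and> J \<in> {-1, 0}")
  case False
  then have "I \<le> -2 \<or> 1 \<le> I \<or> J \<le> -2 \<or> 1 \<le> J" by auto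
  then have r: "real_of_int I \<le> -2 \<or> 1 \<le> real_of_int I \<or> real_of_int J \<le> -2 \<or> 1 \<le> real_of_int J"
    by linarith
  have "hat (orient dg) (of_int I + s) (of_int J + t) = 0 + 0 * s + 0 * t"
    if "0 \<le> s" "s \<le> 1" "0 \<le> t" "t \<le> 1" for s t
  proof -
    have "1 \<le> \<bar>of_int I + s\<bar> \<or> 1 \<le> \<bar>of_int J + t\<bar>" using r that by linarith
    then show ?thesis using hat_far[OF orient_cases] by simp
  qed
  then show ?thesis by blast
next
  case True
  then consider "I = 0" "J = 0" | "I = 0" "J = -1" | "I = -1" "J = 0" | "I = -1" "J = -1" by auto
  then show ?thesis
  proof cases
    case 1
    show ?thesis
    proof (cases dg)
      case Rising
      show ?thesis unfolding 1 Rising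
        by (rule exI[of _ 1], rule exI[of _ "if b then -1 else 0"], rule exI[of _ "if b then 0 else -1"])
          (auto simp: hat_def field_simps)
    next
      case Falling
      show ?thesis unfolding 1 Falling
        by (rule exI[of _ "if b then 1 else 0"], rule exI[of _ "if b then -1 else 0"], rule exI[of _ "if b then -1 else 0"])
          (auto simp: hat_def field_simps)
    qed
  next
    case 2
    show ?thesis
    proof (cases dg)
      case Rising
      show ?thesis unfolding 2 Rising
        by (rule exI[of _ 0], rule exI[of _ "if b then 0 else -1"], rule exI[of _ "if b then 0 else 1"])
          (auto simp: hat_def field_simps)
    next
      case Falling
      show ?thesis unfolding 2 Falling
        by (rule exI[of _ "if b then 0 else 1"], rule exI[of _ "if b then 0 else -1"], rule exI[of _ "if b then 1 else 0"])
          (auto simp: hat_def field_simps)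
    qed
  next
    case 3
    show ?thesis
    proof (cases dg)
      case Rising
      show ?thesis unfolding 3 Rising
        by (rule exI[of _ 0], rule exI[of _ "if b then 1 else 0"], rule exI[of _ "if b then -1 else 0"])
          (auto simp: hat_def field_simps)
    next
      case Falling
      show ?thesis unfolding 3 Falling
        by (rule exI[of _ "if b then 0 else 1"], rule exI[of _ "if b then 1 else 0"], rule exI[of _ "if b then 0 else -1"])
          (auto simp: hat_def field_simps)
    qed
  next
    case 4
    show ?thesis
    proof (cases dg)
      case Rising
      show ?thesis unfolding 4 Rising
        by (rule exI[of _ 0], rule exI[of _ "if b then 0 else 1"], rule exI[of _ "if b then 1 else 0"])
          (auto simp: hat_def field_simps)
    next
      case Falling
      show ?thesis unfolding 4 Falling
        by (rule exI[of _ "if b then 0 else -1"], rule exI[of _ "if b then 0 else 1"], rule exI[of _ "if b then 0 else 1"])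
          (auto simp: hat_def field_simps)
    qed
  qed
qed

lemma square_triangle_coordinates:
  assumes "K \<in> square_triangles dg m i j"
  shows "\<exists>b. \<forall>p\<in>K. \<exists>s t. 0 \<le> s \<and> s \<le> 1 \<and> 0 \<le> t \<and> t \<le> 1 \<and> in_half dg b s t \<and>
    p = ((real i + s) / real (m + 1), (real j + t) / real (m + 1))"
proof -
  let ?q = "\<lambda>s t. ((real i + s) / real (m + 1), (real j + t) / real (m + 1))"
  have coords: ?thesis if K: "K = convex hull {A, B, C}"
    and e: "\<And>u v. A + u *\<^sub>R (B - A) + v *\<^sub>R (C - A) = ?q (S u v) (T u v)"
    and st: "\<And>u v. 0 \<le> u \<Longrightarrow> 0 \<le> v \<Longrightarrow> u + v \<le> 1 \<Longrightarrow>
      0 \<le> S u v \<and> S u v \<le> 1 \<and> 0 \<le> T u v \<and> T u v \<le> 1 \<and> in_half dg b (S u v) (T u v)"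
    for A B C S T b
  proof (intro exI[of _ b] ballI)
    fix p assume "p \<in> K"
    then obtain u v where uv: "0 \<le> u" "0 \<le> v" "u + v \<le> 1" and p: "p = ?q (S u v) (T u v)"
      unfolding K convex_hull_3_alt e by blast
    show "\<exists>s t. 0 \<le> s \<and> s \<le> 1 \<and> 0 \<le> t \<and> t \<le> 1 \<and> in_half dg b s t \<and> p = ?q s t"
      by (intro exI[of _ "S u v"] exI[of _ "T u v"]) (use st[OF uv] p in simp)
  qed
  note simps = node_def add_divide_distrib diff_divide_distrib algebra_simps
  show ?thesis
  proof (cases dg)
    case Rising
    then consider "K = convex hull {node m i j, node m (i + 1) j, node m (i + 1) (j + 1)}"
      | "K = convex hull {node m i j, node m i (j + 1), node m (i + 1) (j + 1)}" using assms by auto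
    then show ?thesis
    proof cases
      case 1
      show ?thesis
        by (rule coords[OF 1, of "\<lambda>u v. u + v" "\<lambda>u v. v" True]) (simp_all add: simps Rising)
    next
      case 2
      show ?thesis
        by (rule coords[OF 2, of "\<lambda>u v. v" "\<lambda>u v. u + v" False]) (simp_all add: simps Rising)
    qed
  next
    case Falling
    then consider "K = convex hull {node m i j, node m (i + 1) j, node m i (j + 1)}"
      | "K = convex hull {node m (i + 1) (j + 1), node m (i + 1) j, node m i (j + 1)}" using assms by auto
    then show ?thesis
    proof cases
      case 1
      show ?thesis
        by (rule coords[OF 1, of "\<lambda>u v. u" "\<lambda>u v. v" True]) (simp_all add: simps Falling)
    next
      case 2
      show ?thesis
        by (rule coords[OF 2, of "\<lambda>u v. 1 - v" "\<lambda>u v. 1 - u" False]) (simp_all add: simps Falling)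
    qed
  qed
qed

lemma hull_triangleI:
  fixes A B C :: "'a::real_vector"
  assumes "0 \<le> u" "0 \<le> v" "u + v \<le> 1" "p = A + u *\<^sub>R (B - A) + v *\<^sub>R (C - A)"
  shows "p \<in> convex hull {A, B, C}"
  using assms unfolding convex_hull_3_alt by auto

lemma unit_square_covered:
  assumes "p \<in> unit_square"
  obtains K where "K \<in> mesh dg m" "p \<in> K"
proof -
  let ?H = "real (m + 1)"
  define x y where "x = ?H * fst p" and "y = ?H * snd p"
  have xy: "0 \<le> x" "x < ?H" "0 \<le> y" "y < ?H"
    using assms by (auto simp: unit_square_def x_def y_def mult_less_cancel_left1 simp del: of_nat_add of_nat_Suc)
  define i j where "i = nat \<lfloor>x\<rfloor>" and "j = nat \<lfloor>y\<rfloor>"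
  have ij: "real i \<le> x" "x < real i + 1" "real j \<le> y" "y < real j + 1"
    using xy by (auto simp: i_def j_def)
  have "real i < ?H" "real j < ?H" using ij xy by linarith+
  then have "i \<le> m" "j \<le> m" by auto
  have p: "p = ((real i + (x - real i)) / ?H, (real j + (y - real j)) / ?H)"
    by (simp add: x_def y_def prod_eq_iff)
  let ?s = "x - real i" and ?t = "y - real j"
  have st: "0 \<le> ?s" "?s \<le> 1" "0 \<le> ?t" "?t \<le> 1" using ij by auto
  have "\<exists>K\<in>square_triangles dg m i j. p \<in> K"
  proof (cases dg)
    case Rising
    show ?thesis
    proof (cases "?t \<le> ?s")
      case True
      have "p = node m i j + (?s - ?t) *\<^sub>R (node m (i + 1) j - node m i j) + ?t *\<^sub>R (node m (i + 1) (j + 1) - node m i j)"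
        by (subst p) (simp add: node_def add_divide_distrib diff_divide_distrib algebra_simps)
      then have "p \<in> convex hull {node m i j, node m (i + 1) j, node m (i + 1) (j + 1)}"
        using True st by (intro hull_triangleI[of "?s - ?t" ?t]) auto
      then show ?thesis unfolding Rising by auto
    next
      case False
      have "p = node m i j + (?t - ?s) *\<^sub>R (node m i (j + 1) - node m i j) + ?s *\<^sub>R (node m (i + 1) (j + 1) - node m i j)"
        by (subst p) (simp add: node_def add_divide_distrib diff_divide_distrib algebra_simps)
      then have "p \<in> convex hull {node m i j, node m i (j + 1), node m (i + 1) (j + 1)}"
        using False st by (intro hull_triangleI[of "?t - ?s" ?s]) auto
      then show ?thesis unfolding Rising by auto
    qed
  next
    case Falling
    show ?thesis
    proof (cases "?s + ?t \<le> 1")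
      case True
      have "p = node m i j + ?s *\<^sub>R (node m (i + 1) j - node m i j) + ?t *\<^sub>R (node m i (j + 1) - node m i j)"
        by (subst p) (simp add: node_def add_divide_distrib diff_divide_distrib algebra_simps)
      then have "p \<in> convex hull {node m i j, node m (i + 1) j, node m i (j + 1)}"
        using True st by (intro hull_triangleI[of ?s ?t]) auto
      then show ?thesis unfolding Falling by auto
    next
      case False
      have "p = node m (i + 1) (j + 1) + (1 - ?t) *\<^sub>R (node m (i + 1) j - node m (i + 1) (j + 1)) + (1 - ?s) *\<^sub>R (node m i (j + 1) - node m (i + 1) (j + 1))"
        by (subst p) (simp add: node_def add_divide_distrib diff_divide_distrib algebra_simps)
      then have "p \<in> convex hull {node m (i + 1) (j + 1), node m (i + 1) j, node m i (j + 1)}"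
        using False st by (intro hull_triangleI[of "1 - ?t" "1 - ?s"]) auto
      then show ?thesis unfolding Falling by auto
    qed
  qed
  then show thesis using that \<open>i \<le> m\<close> \<open>j \<le> m\<close> unfolding mesh_def by blast
qed

text \<open>
  On a triangle the difference of two elements is affine, and the zero set of an affine function is convex; so it contains
  the triangle once it contains the vertices.
\<close>

lemma fe_space_eqI:
  assumes u: "u \<in> fe_space dg m" and v: "v \<in> fe_space dg m"
    and nodes: "\<And>q. q \<in> nodes m \<Longrightarrow> u q = v q"
  shows "u = v"
proof
  fix p
  show "u p = v p"
  proof (cases "p \<in> unit_square")
    case False
    then have "u p = 0" "v p = 0" using u v unfolding fe_space_def by blast+
    then show ?thesis by simp
  next
    case True
    obtain K where K: "K \<in> mesh dg m" "p \<in> K" using unit_square_covered[OF True] .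
    obtain c g where cg: "\<And>x. x \<in> K \<Longrightarrow> u x = c + g \<bullet> x" using u K unfolding fe_space_def by blast
    obtain c' g' where cg': "\<And>x. x \<in> K \<Longrightarrow> v x = c' + g' \<bullet> x" using v K unfolding fe_space_def by blast
    obtain i j where ij: "i \<le> m" "j \<le> m" and Kij: "K \<in> square_triangles dg m i j"
      using K unfolding mesh_def by auto
    obtain T where T: "K = convex hull T" "T \<subseteq> {node m i j, node m (i + 1) j, node m i (j + 1), node m (i + 1) (j + 1)}"
    proof (cases dg)
      case Rising
      then show thesis using Kij that by auto
    next
      case Falling
      then show thesis using Kij that by auto
    qed
    have "T \<subseteq> nodes m" using T(2) ij unfolding nodes_def by fastforce
    moreover have "T \<subseteq> K" unfolding T(1) by (rule hull_subset)
    ultimately have "T \<subseteq> {x. (g - g') \<bullet> x = c' - c}"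
      using cg cg' nodes by (auto simp: inner_diff_left algebra_simps) (smt (verit) subsetD)
    then have "K \<subseteq> {x. (g - g') \<bullet> x = c' - c}"
      unfolding T(1) by (intro hull_minimal convex_hyperplane)
    then have "(g - g') \<bullet> p = c' - c" using K(2) by blast
    then show ?thesis using cg[OF K(2)] cg'[OF K(2)] by (simp add: inner_diff_left)
  qed
qed

text \<open>
  The nodal function of the internal node with index \<open>k\<close>, obtained from \<open>hat\<close> by scaling and translation.
\<close>

definition hat_fn :: "diagonal \<Rightarrow> nat \<Rightarrow> nat \<Rightarrow> real \<times> real \<Rightarrow> real" where
  "hat_fn dg m k p = hat (orient dg) (real (m + 1) * fst p - real (ix m k)) (real (m + 1) * snd p - real (iy m k))"

text \<open>
  Its description as the unique element of the space with the given nodal values identifies the nodal basis with explicit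
  functions; from here on only these are used.
\<close>

lemma nodal_basis_eq:
  assumes k: "k < m^2"
  shows "nodal_basis dg m k = hat_fn dg m k"
proof -
  let ?H = "real (m + 1)" and ?\<phi> = "hat_fn dg m k"
  have idx: "k mod m < m" "k div m < m" using grid_index_less[OF k] .
  then have idxr: "1 \<le> real (ix m k)" "real (ix m k) + 1 \<le> ?H" "1 \<le> real (iy m k)" "real (iy m k) + 1 \<le> ?H"
    by linarith+
  have fe: "?\<phi> \<in> fe_space dg m"
  proof -
    have cont: "continuous_on (closure unit_square) ?\<phi>"
      unfolding hat_fn_def[abs_def] hat_def by (intro continuous_intros) auto
    have affine: "\<exists>c g. \<forall>x\<in>K. ?\<phi> x = c + g \<bullet> x" if K: "K \<in> mesh dg m" for K
    proof -
      obtain i j where "K \<in> square_triangles dg m i j" using K by (auto simp: mesh_def)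
      from square_triangle_coordinates[OF this] obtain b where b: "\<forall>p\<in>K.
          (\<exists>s t. 0 \<le> s \<and> s \<le> 1 \<and> 0 \<le> t \<and> t \<le> 1 \<and> in_half dg b s t \<and> p = ((real i + s) / ?H, (real j + t) / ?H))"
        by blast
      define I J where "I = int i - int (ix m k)" and "J = int j - int (iy m k)"
      obtain \<alpha> \<beta> \<gamma> where aff: "\<And>s t. 0 \<le> s \<Longrightarrow> s \<le> 1 \<Longrightarrow> 0 \<le> t \<Longrightarrow> t \<le> 1 \<Longrightarrow> in_half dg b s t \<Longrightarrow>
          hat (orient dg) (of_int I + s) (of_int J + t) = \<alpha> + \<beta> * s + \<gamma> * t"
        using hat_affine_on_cell[of dg b I J] by blast
      have "?\<phi> p = (\<alpha> - \<beta> * real i - \<gamma> * real j) + (\<beta> * ?H, \<gamma> * ?H) \<bullet> p" if "p \<in> K" for p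
      proof -
        from that b obtain s t where st: "0 \<le> s" "s \<le> 1" "0 \<le> t" "t \<le> 1" "in_half dg b s t"
          and p: "p = ((real i + s) / ?H, (real j + t) / ?H)" by blast
        have "?H * fst p - real (ix m k) = of_int I + s" "?H * snd p - real (iy m k) = of_int J + t"
          by (simp_all add: p I_def J_def)
        then have "?\<phi> p = \<alpha> + \<beta> * s + \<gamma> * t" using aff[OF st] unfolding hat_fn_def by simp
        moreover have "(\<beta> * ?H, \<gamma> * ?H) \<bullet> p = \<beta> * (real i + s) + \<gamma> * (real j + t)"
          by (simp add: p inner_prod_def)
        ultimately show ?thesis by (simp add: algebra_simps)
      qed
      then show ?thesis by blast
    qed
    have "?\<phi> x = 0" if "x \<notin> unit_square" for x
    proof -
      have "fst x \<le> 0 \<or> 1 \<le> fst x \<or> snd x \<le> 0 \<or> 1 \<le> snd x" using that by (auto simp: unit_square_def mem_Times_iff)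
      then have "?H * fst x \<le> 0 \<or> ?H \<le> ?H * fst x \<or> ?H * snd x \<le> 0 \<or> ?H \<le> ?H * snd x"
        by (auto simp: mult_le_0_iff mult_le_cancel_left1)
      then have "1 \<le> \<bar>?H * fst x - real (ix m k)\<bar> \<or> 1 \<le> \<bar>?H * snd x - real (iy m k)\<bar>"
        using idxr by linarith
      then show ?thesis unfolding hat_fn_def by (rule hat_far[OF orient_cases])
    qed
    then show ?thesis using cont affine unfolding fe_space_def by blast
  qed
  have one: "?\<phi> (internal_node m k) = 1"
    by (simp add: hat_fn_def internal_node_def node_def hat_def)
  have zero: "?\<phi> q = 0" if qn: "q \<in> nodes m - {internal_node m k}" for q
  proof -
    obtain i j where q1: "q = node m i j" using qn unfolding nodes_def by blast
    have q: "q = node m i j" "i \<noteq> ix m k \<or> j \<noteq> iy m k"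
      using qn q1 by (auto simp: internal_node_def)
    have "?H * fst q = real i" "?H * snd q = real j" by (simp_all add: q node_def)
    moreover have "1 \<le> \<bar>real i - real (ix m k)\<bar> \<or> 1 \<le> \<bar>real j - real (iy m k)\<bar>"
      using q(2) by auto
    ultimately show ?thesis unfolding hat_fn_def using hat_far[OF orient_cases] by simp
  qed
  show ?thesis unfolding nodal_basis_def
  proof (rule the_equality)
    show "?\<phi> \<in> fe_space dg m \<and> ?\<phi> (internal_node m k) = 1 \<and> (\<forall>q\<in>nodes m - {internal_node m k}. ?\<phi> q = 0)"
      using fe one zero by blast
  next
    fix v assume v: "v \<in> fe_space dg m \<and> v (internal_node m k) = 1 \<and> (\<forall>q\<in>nodes m - {internal_node m k}. v q = 0)"
    show "v = ?\<phi>"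
    proof (rule fe_space_eqI)
      fix q assume "q \<in> nodes m"
      then show "v q = ?\<phi> q" using v one zero by (cases "q = internal_node m k") auto
    qed (use v fe in auto)
  qed
qed

text \<open>
  The indicator of the open parallelogram consisting of the two triangles of the unit mesh that share the edge from the origin
  to $(1,0)$.
\<close>

definition edge_step :: "real \<Rightarrow> real \<Rightarrow> real \<Rightarrow> real" where
  "edge_step \<sigma> s t = (if 0 < s \<and> s < 1 \<and> s - 1 < \<sigma> * t \<and> \<sigma> * t < s then 1 else 0)"

text \<open>
  The partial derivative of \<open>hat\<close> in its first argument: $1$ on the two triangles sharing the horizontal edge to the left
  of the centre and $-1$ on those sharing the edge to its right. By symmetry the other partial derivative is obtained by swapping the arguments.
\<close>

definition hat_slope :: "real \<Rightarrow> real \<Rightarrow> real \<Rightarrow> real" where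
  "hat_slope \<sigma> s t = edge_step \<sigma> (s + 1) t - edge_step \<sigma> s t"

lemma hat_slope_outside:
  assumes "2 < \<bar>s\<bar> + \<bar>\<sigma> * t\<bar> + \<bar>s - \<sigma> * t\<bar>"
  shows "hat_slope \<sigma> s t = 0"
proof -
  define T where "T = \<sigma> * t"
  have "\<not> (0 < s + 1 \<and> s + 1 < 1 \<and> s + 1 - 1 < T \<and> T < s + 1)"
    using assms unfolding T_def[symmetric] by linarith
  moreover have "\<not> (0 < s \<and> s < 1 \<and> s - 1 < T \<and> T < s)"
    using assms unfolding T_def[symmetric] by linarith
  ultimately show ?thesis unfolding hat_slope_def edge_step_def T_def by auto
qed

lemma hat_slope_inside:
  assumes "\<bar>s\<bar> + \<bar>\<sigma> * t\<bar> + \<bar>s - \<sigma> * t\<bar> < 2" and "s \<noteq> 0" "\<sigma> * t \<noteq> 0" "s - \<sigma> * t \<noteq> 0"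
  shows "hat_slope \<sigma> s t = - (sgn s + sgn (s - \<sigma> * t)) / 2"
proof -
  define T where "T = \<sigma> * t"
  have "hat_slope \<sigma> s t = (if 0 < s + 1 \<and> s < 0 \<and> s < T \<and> T < s + 1 then 1 else 0)
      - (if 0 < s \<and> s < 1 \<and> s - 1 < T \<and> T < s then 1 else 0)"
    unfolding hat_slope_def edge_step_def T_def by simp
  also have "\<dots> = - (sgn s + sgn (s - T)) / 2"
    using assms unfolding T_def[symmetric]
    by (cases "0 < s"; cases "0 < T"; cases "s < T"; simp)
  finally show ?thesis unfolding T_def .
qed

lemma has_derivative_abs_comp:
  fixes f :: "'a::real_normed_vector \<Rightarrow> real"
  assumes f: "(f has_derivative f') (at x)" and "f x \<noteq> 0"
  shows "((\<lambda>x. \<bar>f x\<bar>) has_derivative (\<lambda>h. f' h * sgn (f x))) (at x)"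
proof -
  have "(abs has_real_derivative sgn (f x)) (at (f x))"
  proof (cases "0 < f x")
    case True
    have "((\<lambda>x. x) has_real_derivative 1) (at (f x))" by (rule DERIV_ident)
    then have "(abs has_real_derivative 1) (at (f x))"
      by (rule has_field_derivative_transform_within_open[where S = "{0<..}"]) (use True in auto)
    then show ?thesis using True by simp
  next
    case False
    then have "f x < 0" using assms by simp
    have "((\<lambda>x. - x) has_real_derivative -1) (at (f x))" by (auto intro!: derivative_eq_intros)
    then have "(abs has_real_derivative -1) (at (f x))"
      by (rule has_field_derivative_transform_within_open[where S = "{..<0}"]) (use \<open>f x < 0\<close> in auto)
    then show ?thesis using \<open>f x < 0\<close> by simp
  qed
  then show ?thesis using DERIV_compose_FDERIV[of abs _ f x f' UNIV, OF _ f] by simp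
qed

text \<open>
  The excluded lines contain all edges of the triangles that form the support of \<open>hat\<close>; off them the function is locally affine.
\<close>

definition off_edges :: "real \<Rightarrow> real \<Rightarrow> real \<Rightarrow> bool" where
  "off_edges \<sigma> s t \<longleftrightarrow> s \<notin> {-1, 0, 1} \<and> t \<notin> {-1, 0, 1} \<and> s - \<sigma> * t \<notin> {-1, 0, 1}"

text \<open>
  Differentiate the closed form of \<open>hat\<close>. Off the lines none of the moduli vanishes, nor does the argument of the maximum,
  because it equals $1$ minus the largest modulus.
\<close>

lemma hat_has_derivative:
  assumes \<sigma>: "\<sigma> = 1 \<or> \<sigma> = -1" and off: "off_edges \<sigma> (fst q) (snd q)"
  shows "((\<lambda>q. hat \<sigma> (fst q) (snd q)) has_derivative
    (\<lambda>h. fst h * hat_slope \<sigma> (fst q) (snd q) + snd h * hat_slope \<sigma> (snd q) (fst q))) (at q)"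
proof -
  obtain s t where q: "q = (s, t)" by (cases q)
  define u where "u q = 1 - (\<bar>fst q\<bar> + \<bar>snd q\<bar> + \<bar>fst q - \<sigma> * snd q\<bar>) / 2" for q :: "real \<times> real"
  have nz: "s \<noteq> 0" "t \<noteq> 0" "s - \<sigma> * t \<noteq> 0" using off by (auto simp: off_edges_def q)
  have abs_eq: "\<bar>\<sigma> * t\<bar> = \<bar>t\<bar>" "\<bar>\<sigma> * s\<bar> = \<bar>s\<bar>" "\<bar>t - \<sigma> * s\<bar> = \<bar>s - \<sigma> * t\<bar>"
    using \<sigma> by auto
  have max: "\<bar>a\<bar> + \<bar>b\<bar> + \<bar>a - b\<bar> \<noteq> 2" if "a \<notin> {-1, 0, 1}" "b \<notin> {-1, 0, 1}" "a - b \<notin> {-1, 0, 1}" for a b :: real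
  proof -
    have "\<bar>a\<bar> + \<bar>b\<bar> + \<bar>a - b\<bar> = 2 * \<bar>a\<bar> \<or> \<bar>a\<bar> + \<bar>b\<bar> + \<bar>a - b\<bar> = 2 * \<bar>b\<bar>
        \<or> \<bar>a\<bar> + \<bar>b\<bar> + \<bar>a - b\<bar> = 2 * \<bar>a - b\<bar>"
      by (cases "0 \<le> a"; cases "0 \<le> b"; cases "a \<le> b") (simp_all add: abs_of_nonneg abs_of_neg)
    moreover have "\<bar>a\<bar> \<noteq> 1" "\<bar>b\<bar> \<noteq> 1" "\<bar>a - b\<bar> \<noteq> 1"
      using that by (simp_all add: abs_if)
    ultimately show ?thesis by auto
  qed
  have off': "s \<notin> {-1, 0, 1}" "t \<notin> {-1, 0, 1}" "s - \<sigma> * t \<notin> {-1, 0, 1}"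
    using off unfolding off_edges_def q by simp_all
  have "\<sigma> * t \<notin> {-1, 0, 1}" using \<sigma> off'(2) by (elim disjE) simp_all
  from max[OF off'(1) this off'(3)] have "u q \<noteq> 0" unfolding u_def q abs_eq by simp
  have "(fst has_derivative fst) (at q)" "(snd has_derivative snd) (at q)"
    "((\<lambda>q. fst q - \<sigma> * snd q) has_derivative (\<lambda>h. fst h - \<sigma> * snd h)) (at q)"
    by (auto intro!: derivative_eq_intros)
  note d = this
  have nz': "fst q \<noteq> 0" "snd q \<noteq> 0" "fst q - \<sigma> * snd q \<noteq> 0" using nz by (simp_all add: q)
  note abs_derivs = has_derivative_abs_comp[OF d(1) nz'(1)] has_derivative_abs_comp[OF d(2) nz'(2)]
    has_derivative_abs_comp[OF d(3) nz'(3)]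
  have "((\<lambda>q. 1 - 1 / 2 * (\<bar>fst q\<bar> + \<bar>snd q\<bar> + \<bar>fst q - \<sigma> * snd q\<bar>)) has_derivative
      (\<lambda>h. 0 - 1 / 2 * (fst h * sgn (fst q) + snd h * sgn (snd q) + (fst h - \<sigma> * snd h) * sgn (fst q - \<sigma> * snd q)))) (at q)"
    by (rule has_derivative_diff[OF has_derivative_const has_derivative_mult_right[OF has_derivative_add[OF
      has_derivative_add[OF abs_derivs(1,2)] abs_derivs(3)]]])
  then have du: "(u has_derivative (\<lambda>h. - ((fst h * sgn s + snd h * sgn t + (fst h - \<sigma> * snd h) * sgn (s - \<sigma> * t)) / 2))) (at q)"
    unfolding u_def[abs_def] by (simp add: q)
  show ?thesis
  proof (cases "0 < u q")
    case False
    then have "u q < 0" using \<open>u q \<noteq> 0\<close> by simp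
    have op: "open {q. u q < 0}" unfolding u_def by (intro open_Collect_less continuous_intros) auto
    have "2 < \<bar>s\<bar> + \<bar>\<sigma> * t\<bar> + \<bar>s - \<sigma> * t\<bar>" "2 < \<bar>t\<bar> + \<bar>\<sigma> * s\<bar> + \<bar>t - \<sigma> * s\<bar>"
      using \<open>u q < 0\<close> abs_eq unfolding u_def q by auto
    then have "hat_slope \<sigma> s t = 0" "hat_slope \<sigma> t s = 0"
      by (auto intro: hat_slope_outside)
    moreover have "((\<lambda>q. hat \<sigma> (fst q) (snd q)) has_derivative (\<lambda>h. 0)) (at q)"
      by (rule has_derivative_transform_within_open[OF has_derivative_const op, of _ 0])
        (use \<open>u q < 0\<close> in \<open>auto simp: u_def hat_def\<close>)
    ultimately show ?thesis by (simp add: q)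
  next
    case True
    have op: "open {q. 0 < u q}" unfolding u_def by (intro open_Collect_less continuous_intros) auto
    have d: "((\<lambda>q. hat \<sigma> (fst q) (snd q)) has_derivative (\<lambda>h. - ((fst h * sgn s + snd h * sgn t + (fst h - \<sigma> * snd h) * sgn (s - \<sigma> * t)) / 2))) (at q)"
      by (rule has_derivative_transform_within_open[OF du op])
        (use True in \<open>auto simp: u_def hat_def\<close>)
    have i: "\<bar>s\<bar> + \<bar>\<sigma> * t\<bar> + \<bar>s - \<sigma> * t\<bar> < 2" "\<bar>t\<bar> + \<bar>\<sigma> * s\<bar> + \<bar>t - \<sigma> * s\<bar> < 2"
      using True unfolding u_def q abs_eq by auto
    have n: "\<sigma> * t \<noteq> 0" "\<sigma> * s \<noteq> 0" "t - \<sigma> * s \<noteq> 0" using nz abs_eq by force+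
    have e1: "hat_slope \<sigma> s t = - (sgn s + sgn (s - \<sigma> * t)) / 2"
      by (rule hat_slope_inside[OF i(1) nz(1) n(1) nz(3)])
    have "sgn (t - \<sigma> * s) = - \<sigma> * sgn (s - \<sigma> * t)"
      using \<sigma> by (auto simp: sgn_if)
    then have e2: "hat_slope \<sigma> t s = - (sgn t - \<sigma> * sgn (s - \<sigma> * t)) / 2"
      using hat_slope_inside[OF i(2) nz(2) n(2,3)] by simp
    show ?thesis
      by (rule has_derivative_eq_rhs[OF d]) (simp add: q e1 e2 fun_eq_iff field_simps)
  qed
qed

section \<open>Gradients of the nodal basis\<close>

text \<open>
  The indicator of the two triangles sharing the edge between the nodes $(i,j)$ and $(i+1,j)$.
\<close>

definition edge_h :: "diagonal \<Rightarrow> nat \<Rightarrow> nat \<Rightarrow> nat \<Rightarrow> real \<times> real \<Rightarrow> real" where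
  "edge_h dg m i j p = edge_step (orient dg) (real (m + 1) * fst p - real i) (real (m + 1) * snd p - real j)"

text \<open>
  The indicator of the two triangles sharing the edge between the nodes $(i,j)$ and $(i,j+1)$.
\<close>

definition edge_v :: "diagonal \<Rightarrow> nat \<Rightarrow> nat \<Rightarrow> nat \<Rightarrow> real \<times> real \<Rightarrow> real" where
  "edge_v dg m i j p = edge_step (orient dg) (real (m + 1) * snd p - real j) (real (m + 1) * fst p - real i)"

definition grad_x :: "diagonal \<Rightarrow> nat \<Rightarrow> nat \<Rightarrow> real \<times> real \<Rightarrow> real" where
  "grad_x dg m k p = real (m + 1) * (edge_h dg m (k mod m) (iy m k) p - edge_h dg m (ix m k) (iy m k) p)"

definition grad_y :: "diagonal \<Rightarrow> nat \<Rightarrow> nat \<Rightarrow> real \<times> real \<Rightarrow> real" where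
  "grad_y dg m k p = real (m + 1) * (edge_v dg m (ix m k) (k div m) p - edge_v dg m (ix m k) (iy m k) p)"

definition off_mesh :: "diagonal \<Rightarrow> nat \<Rightarrow> real \<times> real \<Rightarrow> bool" where
  "off_mesh dg m p \<longleftrightarrow> real (m + 1) * fst p \<notin> \<int> \<and> real (m + 1) * snd p \<notin> \<int> \<and>
    real (m + 1) * fst p - orient dg * (real (m + 1) * snd p) \<notin> \<int>"

lemma orient_Ints: "orient dg \<in> \<int>" by (cases dg) auto

lemma gradient_eqI:
  assumes "GDERIV u x :> D"
  shows "gradient u x = D"
  unfolding gradient_def
proof (rule the_equality)
  show "GDERIV u x :> D" by fact
next
  fix D' assume "GDERIV u x :> D'"
  then have "(\<lambda>h. h \<bullet> D') = (\<lambda>h. h \<bullet> D)" using assms unfolding gderiv_def by (rule has_derivative_unique)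
  then have "(D' - D) \<bullet> (D' - D) = 0" by (metis inner_diff_right right_minus_eq)
  then show "D' = D" by simp
qed

text \<open>
  Each partial derivative of a nodal function is a difference of two edge indicators. This is what makes the stiffness matrix
  a graph Laplacian.
\<close>

lemma hat_fn_GDERIV:
  assumes off: "off_mesh dg m p"
  shows "GDERIV (hat_fn dg m k) p :> (grad_x dg m k p, grad_y dg m k p)"
proof -
  let ?H = "real (m + 1)" and ?\<sigma> = "orient dg"
  define T where "T p = (?H * fst p - real (ix m k), ?H * snd p - real (iy m k))" for p
  have int: "x \<in> \<int>" if "x - of_nat n \<in> {-1, 0, 1}" for x :: real and n
  proof -
    from that have "x = of_nat n - 1 \<or> x = of_nat n \<or> x = of_nat n + 1" by auto
    then show ?thesis by (elim disjE) (auto intro: Ints_add Ints_diff)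
  qed
  have offq: "off_edges ?\<sigma> (fst (T p)) (snd (T p))"
  proof -
    have "fst (T p) - ?\<sigma> * snd (T p) \<notin> {-1, 0, 1}"
    proof
      assume "fst (T p) - ?\<sigma> * snd (T p) \<in> {-1, 0, 1}"
      then have "fst (T p) - ?\<sigma> * snd (T p) \<in> \<int>" by auto
      moreover have "real (ix m k) - ?\<sigma> * real (iy m k) \<in> \<int>"
        using orient_Ints by (intro Ints_diff Ints_mult Ints_of_nat)
      ultimately have "(fst (T p) - ?\<sigma> * snd (T p)) + (real (ix m k) - ?\<sigma> * real (iy m k)) \<in> \<int>" by (rule Ints_add)
      then have "?H * fst p - ?\<sigma> * (?H * snd p) \<in> \<int>" by (simp add: T_def algebra_simps)
      then show False using off unfolding off_mesh_def by blast
    qed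
    then show ?thesis using off int unfolding off_edges_def off_mesh_def T_def fst_conv snd_conv by blast
  qed
  have dT: "(T has_derivative (\<lambda>h. (?H * fst h, ?H * snd h))) (at p)"
    unfolding T_def[abs_def] by (auto intro!: derivative_eq_intros)
  have "((\<lambda>p. hat ?\<sigma> (fst (T p)) (snd (T p))) has_derivative
      (\<lambda>h. fst (?H * fst h, ?H * snd h) * hat_slope ?\<sigma> (fst (T p)) (snd (T p)) +
         snd (?H * fst h, ?H * snd h) * hat_slope ?\<sigma> (snd (T p)) (fst (T p)))) (at p)"
    by (rule has_derivative_compose[OF dT hat_has_derivative[OF orient_cases offq]])
  moreover have "(\<lambda>p. hat ?\<sigma> (fst (T p)) (snd (T p))) = hat_fn dg m k"
    by (simp add: fun_eq_iff hat_fn_def T_def)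
  moreover have "(\<lambda>h. fst (?H * fst h, ?H * snd h) * hat_slope ?\<sigma> (fst (T p)) (snd (T p)) +
         snd (?H * fst h, ?H * snd h) * hat_slope ?\<sigma> (snd (T p)) (fst (T p))) =
      (\<lambda>h. h \<bullet> (grad_x dg m k p, grad_y dg m k p))"
    by (simp add: fun_eq_iff inner_prod_def grad_x_def grad_y_def edge_h_def edge_v_def hat_slope_def T_def algebra_simps)
  ultimately show ?thesis unfolding gderiv_def by simp
qed

lemma AE_off_mesh: "AE p in lebesgue. off_mesh dg m p"
proof -
  have null: "{p. v \<bullet> p \<in> \<int>} \<in> null_sets lebesgue" if "v \<noteq> 0" for v :: "real \<times> real"
  proof -
    have "{p. v \<bullet> p \<in> \<int>} = (\<Union>z::int. {p. v \<bullet> p = of_int z})" by (auto elim: Ints_cases)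
    moreover have "{p. v \<bullet> p = of_int z} \<in> null_sets lebesgue" for z :: int
      using negligible_hyperplane[of v "of_int z"] that by (simp add: negligible_iff_null_sets)
    ultimately show ?thesis by auto
  qed
  let ?H = "real (m + 1)"
  have ae: "AE p in lebesgue. v \<bullet> p \<notin> \<int>" if "v \<noteq> 0" for v :: "real \<times> real"
    using AE_not_in[OF null[OF that]] by simp
  have "AE p in lebesgue. (?H, 0 :: real) \<bullet> p \<notin> \<int>" "AE p in lebesgue. (0 :: real, ?H) \<bullet> p \<notin> \<int>"
    "AE p in lebesgue. (?H, - orient dg * ?H) \<bullet> p \<notin> \<int>"
    using ae[of "(?H, 0)"] ae[of "(0, ?H)"] ae[of "(?H, - orient dg * ?H)"] by (simp_all add: zero_prod_def)
  then show ?thesis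
    by eventually_elim (auto simp: off_mesh_def inner_prod_def mult.assoc)
qed

lemma edge_step_borel:
  fixes f g :: "real \<times> real \<Rightarrow> real"
  assumes "continuous_on UNIV f" "continuous_on UNIV g"
  shows "(\<lambda>p. edge_step \<sigma> (f p) (g p)) \<in> borel_measurable borel"
proof -
  let ?A = "{p. 0 < f p \<and> f p < 1 \<and> f p - 1 < \<sigma> * g p \<and> \<sigma> * g p < f p}"
  have "open ?A" using assms by (intro open_Collect_conj open_Collect_less continuous_intros)
  then have "indicator ?A \<in> borel_measurable (borel :: (real \<times> real) measure)"
    by (intro borel_measurable_indicator) simp
  moreover have "(\<lambda>p. edge_step \<sigma> (f p) (g p)) = indicator ?A"
    by (auto simp: fun_eq_iff edge_step_def indicator_def)
  ultimately show ?thesis by simp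
qed

lemma edge_h_borel [measurable]: "edge_h dg m i j \<in> borel_measurable borel"
  and edge_v_borel [measurable]: "edge_v dg m i j \<in> borel_measurable borel"
  unfolding edge_h_def[abs_def] edge_v_def[abs_def]
  by (intro edge_step_borel continuous_intros)+

text \<open>
  The parallelograms of different edges are disjoint: the coordinate along the edge fixes $i$, and then the other one
  is confined to an open interval of length $1$ and fixes $j$.
\<close>

lemma edge_step_unique:
  assumes "\<sigma> = 1 \<or> \<sigma> = -1"
    and "edge_step \<sigma> (x - real i) (y - real j) \<noteq> 0" "edge_step \<sigma> (x - real i') (y - real j') \<noteq> 0"
  shows "i = i'" "j = j'"
proof -
  have a: "0 < x - real i" "x - real i < 1" "x - real i - 1 < \<sigma> * (y - real j)" "\<sigma> * (y - real j) < x - real i"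
    using assms(2) by (auto simp: edge_step_def split: if_splits)
  have b: "0 < x - real i'" "x - real i' < 1" "x - real i' - 1 < \<sigma> * (y - real j')" "\<sigma> * (y - real j') < x - real i'"
    using assms(3) by (auto simp: edge_step_def split: if_splits)
  show ii: "i = i'" using a(1,2) b(1,2) by linarith
  show "j = j'" using assms(1)
  proof
    assume "\<sigma> = 1" then show ?thesis using a b unfolding ii by simp
  next
    assume "\<sigma> = -1" then show ?thesis using a b unfolding ii by simp
  qed
qed

lemma edge_step_values: "edge_step \<sigma> s t = 0 \<or> edge_step \<sigma> s t = 1"
  by (simp add: edge_step_def)

lemma edge_h_mult: "edge_h dg m i j p * edge_h dg m i' j' p = (if i = i' \<and> j = j' then edge_h dg m i j p else 0)"
  unfolding edge_h_def
  using edge_step_unique[OF orient_cases] edge_step_values by (smt (verit) mult_cancel_left1 mult_eq_0_iff)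

lemma edge_v_mult: "edge_v dg m i j p * edge_v dg m i' j' p = (if i = i' \<and> j = j' then edge_v dg m i j p else 0)"
  unfolding edge_v_def
  using edge_step_unique[OF orient_cases] edge_step_values by (smt (verit) mult_cancel_left1 mult_eq_0_iff)

section \<open>Integration over the square\<close>

abbreviation (input) sq_integral :: "(real \<times> real \<Rightarrow> real) \<Rightarrow> real" where
  "sq_integral f \<equiv> (LINT p:unit_square|lebesgue. f p)"

text \<open>
  A class of integrands that is closed under the algebraic operations and whose members are integrable over the square.
\<close>

definition sq_bounded :: "(real \<times> real \<Rightarrow> real) \<Rightarrow> bool" where
  "sq_bounded f \<longleftrightarrow> (\<lambda>p. indicator unit_square p * f p) \<in> borel_measurable borel \<and> (\<exists>B. \<forall>p\<in>unit_square. \<bar>f p\<bar> \<le> B)"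

lemma unit_square_open: "open unit_square" unfolding unit_square_def by (intro open_Times) auto

lemma unit_square_borel [measurable]: "unit_square \<in> sets borel" using unit_square_open by simp

lemma closure_unit_square: "closure unit_square = {0..1} \<times> {0..1}"
  unfolding unit_square_def by (simp add: closure_Times)

lemma unit_square_finite_measure: "emeasure lborel unit_square < \<infinity>"
proof -
  have "bounded unit_square" by (rule bounded_subset[of "closure unit_square"])
    (auto simp: closure_unit_square closure_subset[THEN subsetD] unit_square_def intro!: bounded_Times)
  then show ?thesis by (rule emeasure_bounded_finite)
qed

lemma sq_boundedI:
  assumes "(\<lambda>p. indicator unit_square p * f p) \<in> borel_measurable borel" "\<And>p. p \<in> unit_square \<Longrightarrow> \<bar>f p\<bar> \<le> B"
  shows "sq_bounded f"
  using assms unfolding sq_bounded_def by blast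

lemma sq_bounded_mult: "sq_bounded f \<Longrightarrow> sq_bounded g \<Longrightarrow> sq_bounded (\<lambda>p. f p * g p)"
proof -
  assume f: "sq_bounded f" and g: "sq_bounded g"
  obtain B C where BC: "\<And>p. p \<in> unit_square \<Longrightarrow> \<bar>f p\<bar> \<le> B" "\<And>p. p \<in> unit_square \<Longrightarrow> \<bar>g p\<bar> \<le> C"
    using f g unfolding sq_bounded_def by blast
  have "\<bar>f p * g p\<bar> \<le> \<bar>B\<bar> * \<bar>C\<bar>" if "p \<in> unit_square" for p
  proof -
    have "\<bar>f p\<bar> \<le> \<bar>B\<bar>" "\<bar>g p\<bar> \<le> \<bar>C\<bar>" using BC[OF that] by linarith+
    then show ?thesis unfolding abs_mult by (intro mult_mono) auto
  qed
  moreover have "(\<lambda>p. indicator unit_square p * (f p * g p)) =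
      (\<lambda>p. (indicator unit_square p * f p) * (indicator unit_square p * g p))"
    by (auto simp: indicator_def)
  then have "(\<lambda>p. indicator unit_square p * (f p * g p)) \<in> borel_measurable borel"
    using f g unfolding sq_bounded_def by auto
  ultimately show ?thesis by (intro sq_boundedI)
qed

lemma sq_bounded_add: "sq_bounded f \<Longrightarrow> sq_bounded g \<Longrightarrow> sq_bounded (\<lambda>p. f p + g p)"
proof -
  assume f: "sq_bounded f" and g: "sq_bounded g"
  obtain B C where "\<And>p. p \<in> unit_square \<Longrightarrow> \<bar>f p\<bar> \<le> B" "\<And>p. p \<in> unit_square \<Longrightarrow> \<bar>g p\<bar> \<le> C"
    using f g unfolding sq_bounded_def by blast
  then have "\<bar>f p + g p\<bar> \<le> B + C" if "p \<in> unit_square" for p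
    using that by (intro order.trans[OF abs_triangle_ineq] add_mono) auto
  moreover have "(\<lambda>p. indicator unit_square p * (f p + g p)) \<in> borel_measurable borel"
    using f g unfolding sq_bounded_def by (auto simp: distrib_left)
  ultimately show ?thesis by (intro sq_boundedI)
qed

lemma sq_bounded_continuous:
  assumes "continuous_on (closure unit_square) f"
  shows "sq_bounded f"
proof -
  have "continuous_on unit_square f" using assms continuous_on_subset closure_subset by blast
  then have "(\<lambda>p. indicator unit_square p *\<^sub>R f p) \<in> borel_measurable borel"
    by (intro borel_measurable_continuous_on_indicator) measurable
  moreover have "compact (closure unit_square)"
    unfolding closure_unit_square by (intro compact_Times compact_Icc)
  then have "bounded (f ` closure unit_square)" using assms compact_continuous_image compact_imp_bounded by blast
  then obtain B where "\<And>p. p \<in> closure unit_square \<Longrightarrow> \<bar>f p\<bar> \<le> B" unfolding bounded_real by auto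
  then have "\<forall>p\<in>unit_square. \<bar>f p\<bar> \<le> B" using closure_subset by blast
  ultimately show ?thesis unfolding sq_bounded_def by auto
qed

lemma sq_bounded_const: "sq_bounded (\<lambda>p. c)"
  by (rule sq_bounded_continuous) simp

lemma sq_bounded_cmult: "sq_bounded f \<Longrightarrow> sq_bounded (\<lambda>p. c * f p)"
  by (rule sq_bounded_mult[OF sq_bounded_const])

lemma sq_bounded_diff: "sq_bounded f \<Longrightarrow> sq_bounded g \<Longrightarrow> sq_bounded (\<lambda>p. f p - g p)"
  using sq_bounded_add[of f "\<lambda>p. -1 * g p"] sq_bounded_cmult[of g "-1"] by simp

lemma sq_bounded_sum: "finite I \<Longrightarrow> (\<And>i. i \<in> I \<Longrightarrow> sq_bounded (f i)) \<Longrightarrow> sq_bounded (\<lambda>p. \<Sum>i\<in>I. f i p)"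
  by (induction I rule: finite_induct) (auto intro: sq_bounded_const sq_bounded_add)

lemma sq_bounded_borel:
  assumes [measurable]: "f \<in> borel_measurable borel" and "\<And>p. \<bar>f p\<bar> \<le> B"
  shows "sq_bounded f"
  by (rule sq_boundedI[where B = B]) (use assms(2) in auto)

lemma sq_bounded_integrable:
  assumes "sq_bounded f"
  shows "set_integrable lborel unit_square f" "set_integrable lebesgue unit_square f"
proof -
  obtain B where B: "\<And>p. p \<in> unit_square \<Longrightarrow> \<bar>f p\<bar> \<le> B" using assms unfolding sq_bounded_def by blast
  have m: "(\<lambda>p. indicator unit_square p *\<^sub>R f p) \<in> borel_measurable lborel"
    using assms unfolding sq_bounded_def by auto
  show i: "set_integrable lborel unit_square f"
    unfolding set_integrable_def
  proof (rule integrableI_bounded_set[where A = unit_square and B = B, OF _ m unit_square_finite_measure])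
    show "AE x in lborel. x \<in> unit_square \<longrightarrow> norm (indicator unit_square x *\<^sub>R f x) \<le> B" using B by auto
  qed auto
  show "set_integrable lebesgue unit_square f"
    using i m unfolding set_integrable_def by (subst integrable_completion) auto
qed

lemma sq_integral_lborel:
  assumes "sq_bounded f"
  shows "sq_integral f = (\<integral>p. indicator unit_square p * f p \<partial>lborel)"
  using assms unfolding set_lebesgue_integral_def sq_bounded_def by (subst integral_completion) auto

lemma sq_integral_add: "sq_bounded f \<Longrightarrow> sq_bounded g \<Longrightarrow> sq_integral (\<lambda>p. f p + g p) = sq_integral f + sq_integral g"
  by (rule set_integral_add(2)) (auto intro: sq_bounded_integrable)

lemma sq_integral_diff: "sq_bounded f \<Longrightarrow> sq_bounded g \<Longrightarrow> sq_integral (\<lambda>p. f p - g p) = sq_integral f - sq_integral g"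
  by (rule set_integral_diff(2)) (auto intro: sq_bounded_integrable)

lemma sq_integral_cmult: "sq_integral (\<lambda>p. c * f p) = c * sq_integral f"
  unfolding set_lebesgue_integral_def by (simp add: mult.left_commute)

lemma sq_integral_sum:
  "finite I \<Longrightarrow> (\<And>i. i \<in> I \<Longrightarrow> sq_bounded (f i)) \<Longrightarrow> sq_integral (\<lambda>p. \<Sum>i\<in>I. f i p) = (\<Sum>i\<in>I. sq_integral (f i))"
proof (induction I rule: finite_induct)
  case empty then show ?case by (simp add: set_lebesgue_integral_def)
next
  case (insert i I)
  then show ?case using sq_integral_add[of "f i" "\<lambda>p. \<Sum>i\<in>I. f i p"] sq_bounded_sum[of I f] by auto
qed

lemma sq_integral_mono:
  assumes "sq_bounded f" "sq_bounded g" "\<And>p. p \<in> unit_square \<Longrightarrow> f p \<le> g p"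
  shows "sq_integral f \<le> sq_integral g"
  by (rule set_integral_mono) (use assms sq_bounded_integrable in auto)

lemma sq_integral_abs_bound:
  assumes "sq_bounded f" "sq_bounded g" "\<And>p. p \<in> unit_square \<Longrightarrow> \<bar>f p\<bar> \<le> g p"
  shows "\<bar>sq_integral f\<bar> \<le> sq_integral g"
proof -
  have "sq_integral f \<le> sq_integral g" using assms by (intro sq_integral_mono) (auto simp: abs_le_iff)
  moreover have "sq_integral (\<lambda>p. -1 * f p) \<le> sq_integral g"
    using assms by (intro sq_integral_mono sq_bounded_cmult) (auto simp: abs_le_iff)
  ultimately show ?thesis unfolding sq_integral_cmult by linarith
qed

text \<open>
  Nothing is known about the values of a nodal gradient on the edges of the mesh. Since \<open>lebesgue\<close> is complete, agreement
  almost everywhere with a member of the class makes the function on the left measurable as well.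
\<close>

lemma sq_integral_cong_AE:
  assumes g: "sq_bounded g" and ae: "AE p in lebesgue. p \<in> unit_square \<longrightarrow> f p = g p"
  shows "sq_integral f = sq_integral g"
proof -
  have m: "(\<lambda>p. indicator unit_square p *\<^sub>R g p) \<in> borel_measurable lebesgue"
    using g unfolding sq_bounded_def by (auto intro: measurable_completion)
  have ae': "AE p in lebesgue. indicator unit_square p *\<^sub>R g p = indicator unit_square p *\<^sub>R f p"
    using ae by eventually_elim (auto simp: indicator_def)
  show ?thesis unfolding set_lebesgue_integral_def
    using ae' by (intro integral_cong_AE borel_measurable_AE[OF m ae'] m) auto
qed

lemma lborel_reflect:
  fixes f :: "real \<times> real \<Rightarrow> real" and z :: "real \<times> real"
  assumes [measurable]: "f \<in> borel_measurable borel"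
  shows "(\<integral>p. f (z - p) \<partial>lborel) = (\<integral>p. f p \<partial>lborel)"
proof -
  have "(lborel :: (real \<times> real) measure) = distr lborel borel (\<lambda>p. z - p)"
    using lborel_affine[of "-1" z] by (simp add: density_1)
  then have "(\<integral>p. f p \<partial>lborel) = (\<integral>p. f p \<partial>(distr lborel borel (\<lambda>p. z - p)))" by simp
  also have "\<dots> = (\<integral>p. f (z - p) \<partial>lborel)" by (rule integral_distr) measurable
  finally show ?thesis by simp
qed

lemma edge_step_reflect: "edge_step \<sigma> (1 - s) (- t) = edge_step \<sigma> s t"
  unfolding edge_step_def by auto

text \<open>
  The section of the parallelogram transversal to its edge is an interval of length $1$ in scaled coordinates.
\<close>

lemma edge_step_section:
  assumes "\<sigma> = 1 \<or> \<sigma> = -1" "0 < H"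
  shows "emeasure lborel {y. edge_step \<sigma> s (H * y - c) = 1} = (if 0 < s \<and> s < 1 then ennreal (1 / H) else 0)"
proof (cases "0 < s \<and> s < 1")
  case False
  then have "{y. edge_step \<sigma> s (H * y - c) = 1} = {}" by (auto simp: edge_step_def)
  then show ?thesis by (simp only: if_not_P[OF False] emeasure_empty)
next
  case True
  show ?thesis using assms(1)
  proof
    assume "\<sigma> = 1"
    then have "{y. edge_step \<sigma> s (H * y - c) = 1} = {(c + s - 1) / H<..<(c + s) / H}"
      using True assms(2) by (auto simp: edge_step_def field_simps)
    then show ?thesis using True assms(2) by (simp add: field_simps diff_divide_distrib[symmetric])
  next
    assume "\<sigma> = -1"
    then have "{y. edge_step \<sigma> s (H * y - c) = 1} = {(c - s) / H<..<(c - s + 1) / H}"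
      using True assms(2) by (auto simp: edge_step_def field_simps)
    then show ?thesis using True assms(2) by (simp add: field_simps diff_divide_distrib[symmetric])
  qed
qed

lemma strip_integral:
  assumes "0 < H"
  shows "(\<integral>\<^sup>+x. (if 0 < H * x - c \<and> H * x - c < 1 then ennreal (1 / H) else 0) \<partial>lborel) = ennreal (1 / H^2)"
proof -
  have "(\<integral>\<^sup>+x. (if 0 < H * x - c \<and> H * x - c < 1 then ennreal (1 / H) else 0) \<partial>lborel) =
      (\<integral>\<^sup>+x. ennreal (1 / H) * indicator {c / H<..<(c + 1) / H} x \<partial>lborel)"
    using assms by (intro nn_integral_cong) (auto simp: field_simps split: split_indicator)
  also have "\<dots> = ennreal (1 / H) * ennreal (1 / H)"
    using assms by (simp add: nn_integral_cmult_indicator divide_right_mono diff_divide_distrib[symmetric])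
  finally show ?thesis using assms by (simp add: ennreal_mult[symmetric] power2_eq_square)
qed

lemma edge_h_nonneg: "0 \<le> edge_h dg m i j p"
  by (simp add: edge_h_def edge_step_def)

lemma edge_h_mass: "(\<integral>p. edge_h dg m i j p \<partial>lborel) = 1 / (real (m + 1))^2"
proof -
  let ?H = "real (m + 1)"
  have "(\<integral>\<^sup>+p. ennreal (edge_h dg m i j p) \<partial>lborel) = (\<integral>\<^sup>+p. indicator {p. edge_h dg m i j p = 1} p \<partial>lborel)"
    by (intro nn_integral_cong) (auto simp: edge_h_def edge_step_def indicator_def)
  also have "\<dots> = emeasure (lborel \<Otimes>\<^sub>M lborel) {p. edge_h dg m i j p = 1}"
    unfolding lborel_prod by (intro nn_integral_indicator) measurable
  also have "\<dots> = (\<integral>\<^sup>+x. emeasure lborel (Pair x -` {p. edge_h dg m i j p = 1}) \<partial>lborel)"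
    by (rule lborel.emeasure_pair_measure_alt) (simp only: lborel_prod sets_lborel, measurable)
  also have "\<dots> = (\<integral>\<^sup>+x. (if 0 < ?H * x - real i \<and> ?H * x - real i < 1 then ennreal (1 / ?H) else 0) \<partial>lborel)"
    by (intro nn_integral_cong) (simp only: vimage_def edge_h_def mem_Collect_eq fst_conv snd_conv
      edge_step_section[OF orient_cases of_nat_0_less_iff[THEN iffD2, OF zero_less_Suc]] Suc_eq_plus1[symmetric])
  also have "\<dots> = ennreal (1 / ?H^2)" by (rule strip_integral) simp
  finally have "(\<integral>\<^sup>+p. ennreal (edge_h dg m i j p) \<partial>lborel) = ennreal (1 / ?H^2)" .
  then show ?thesis
    using edge_h_borel[of dg m i j] by (subst integral_eq_nn_integral) (simp_all add: edge_h_nonneg)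
qed

lemma edge_v_mass: "(\<integral>p. edge_v dg m i j p \<partial>lborel) = 1 / (real (m + 1))^2"
proof -
  have "edge_v dg m i j p = (case p of (x, y) \<Rightarrow> edge_h dg m j i (y, x))" for p
    by (simp add: edge_v_def edge_h_def split: prod.split)
  then have "(\<integral>p. edge_v dg m i j p \<partial>lborel) = (\<integral>(x, y). edge_h dg m j i (y, x) \<partial>(lborel \<Otimes>\<^sub>M lborel))"
    unfolding lborel_prod by simp
  also have "\<dots> = (\<integral>p. edge_h dg m j i p \<partial>(lborel \<Otimes>\<^sub>M lborel))"
    by (rule lborel_pair.integral_product_swap) (simp add: lborel_prod)
  finally show ?thesis using edge_h_mass unfolding lborel_prod by simp
qed

section \<open>Taylor expansion of the diffusion coefficient\<close>

lemma norm_le_of_components: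
  fixes v :: "'a::euclidean_space"
  assumes "\<And>b. b \<in> Basis \<Longrightarrow> \<bar>v \<bullet> b\<bar> \<le> B b"
  shows "norm v \<le> (\<Sum>b\<in>Basis. B b)"
  using norm_le_l1[of v] sum_mono[of Basis "\<lambda>b. \<bar>v \<bullet> b\<bar>" B] assms by force

lemma C_closure_mono_continuous: "C_closure k \<Omega> u \<Longrightarrow> continuous_on (closure \<Omega>) u"
  by (cases k) auto

lemma lipschitz_of_gradient_bound:
  fixes u :: "'a::euclidean_space \<Rightarrow> real"
  assumes "convex \<Omega>" and d: "\<And>x. x \<in> \<Omega> \<Longrightarrow> GDERIV u x :> G x"
    and B: "\<And>x. x \<in> \<Omega> \<Longrightarrow> norm (G x) \<le> B" and xy: "x \<in> \<Omega>" "y \<in> \<Omega>"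
  shows "\<bar>u x - u y\<bar> \<le> B * norm (x - y)"
proof -
  have "norm (u x - u y) \<le> B * norm (x - y)"
  proof (rule differentiable_bound[OF assms(1) _ _ xy])
    fix z assume z: "z \<in> \<Omega>"
    show "(u has_derivative (\<lambda>h. h \<bullet> G z)) (at z within \<Omega>)"
      using d[OF z] unfolding gderiv_def by (rule has_derivative_at_withinI)
    show "onorm (\<lambda>h. h \<bullet> G z) \<le> B"
    proof (rule onorm_bound)
      show "0 \<le> B" using B[OF z] norm_ge_zero order_trans by blast
      fix h show "norm (h \<bullet> G z) \<le> B * norm h"
        using Cauchy_Schwarz_ineq2[of h "G z"] mult_right_mono[OF B[OF z] norm_ge_zero[of h]]
        by (simp add: mult.commute)
    qed
  qed
  then show ?thesis by simp
qed

lemma C_closure_bounded: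
  fixes u :: "'a::euclidean_space \<Rightarrow> real"
  assumes "bounded \<Omega>" "C_closure k \<Omega> u"
  shows "\<exists>B. \<forall>x\<in>closure \<Omega>. \<bar>u x\<bar> \<le> B"
proof -
  have "compact (closure \<Omega>)" using assms(1) by simp
  then have "bounded (u ` closure \<Omega>)"
    using C_closure_mono_continuous[OF assms(2)] compact_continuous_image compact_imp_bounded by blast
  then show ?thesis unfolding bounded_real by simp
qed

lemma C1_gradient_bounded:
  fixes G :: "'a::euclidean_space \<Rightarrow> 'a"
  assumes "bounded \<Omega>" "\<And>b. b \<in> Basis \<Longrightarrow> C_closure k \<Omega> (\<lambda>x. G x \<bullet> b)"
  shows "\<exists>B. \<forall>x\<in>\<Omega>. norm (G x) \<le> B"
proof -
  have "\<exists>B. \<forall>x\<in>closure \<Omega>. \<bar>G x \<bullet> b\<bar> \<le> B" if "b \<in> Basis" for b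
    by (rule C_closure_bounded[OF assms(1) assms(2)[OF that]])
  then obtain B where B: "\<forall>b\<in>Basis. \<forall>x\<in>closure \<Omega>. \<bar>G x \<bullet> b\<bar> \<le> B b" by (metis bchoice)
  have "norm (G x) \<le> (\<Sum>b\<in>Basis. B b)" if "x \<in> \<Omega>" for x
    using B that closure_subset[of \<Omega>] by (intro norm_le_of_components) auto
  then show ?thesis by blast
qed

lemma C1_lipschitz:
  fixes u :: "'a::euclidean_space \<Rightarrow> real"
  assumes "bounded \<Omega>" "convex \<Omega>" "C_closure (Suc k) \<Omega> u"
  shows "\<exists>B\<ge>0. \<forall>x\<in>\<Omega>. \<forall>y\<in>\<Omega>. \<bar>u x - u y\<bar> \<le> B * norm (x - y)"
proof -
  from assms(3) obtain G where G: "\<And>x. x \<in> \<Omega> \<Longrightarrow> GDERIV u x :> G x"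
    and c: "\<And>b. b \<in> Basis \<Longrightarrow> C_closure k \<Omega> (\<lambda>x. G x \<bullet> b)" by auto
  obtain B where B: "\<forall>x\<in>\<Omega>. norm (G x) \<le> B" using C1_gradient_bounded[where G = G, OF assms(1) c] by blast
  have B': "norm (G x) \<le> max B 0" if "x \<in> \<Omega>" for x using B that by (simp add: le_max_iff_disj)
  have "\<bar>u x - u y\<bar> \<le> max B 0 * norm (x - y)" if "x \<in> \<Omega>" "y \<in> \<Omega>" for x y
    by (rule lipschitz_of_gradient_bound[OF assms(2) G B' that])
  moreover have "0 \<le> max B 0" by simp
  ultimately show ?thesis by blast
qed

text \<open>
  The gradient is Lipschitz continuous because its components have bounded gradients. The remainder is the increment of
  $x \mapsto a(x) - G(c) \cdot x$ along the segment from $c$ to $x$, where the gradient of this function is at most $L|x-c|$.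
\<close>

lemma C2_taylor:
  fixes a :: "'a::euclidean_space \<Rightarrow> real"
  assumes bd: "bounded \<Omega>" and conv: "convex \<Omega>" and a: "C_closure 2 \<Omega> a"
  obtains G L B where "0 \<le> L" "0 \<le> B"
    "\<And>x c. x \<in> \<Omega> \<Longrightarrow> c \<in> \<Omega> \<Longrightarrow> \<bar>a x - a c - G c \<bullet> (x - c)\<bar> \<le> L * (norm (x - c))^2"
    "\<And>c. c \<in> \<Omega> \<Longrightarrow> norm (G c) \<le> B"
proof -
  from a have a': "C_closure (Suc (Suc 0)) \<Omega> a" by (simp only: numeral_2_eq_2)
  then obtain G where G: "\<And>x. x \<in> \<Omega> \<Longrightarrow> GDERIV a x :> G x"
    and c: "\<And>b. b \<in> Basis \<Longrightarrow> C_closure (Suc 0) \<Omega> (\<lambda>x. G x \<bullet> b)"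
    unfolding C_closure.simps(2)[of "Suc 0"] by blast
  obtain B where B: "\<forall>x\<in>\<Omega>. norm (G x) \<le> B" using C1_gradient_bounded[where G = G, OF bd c] by blast
  have "\<exists>K\<ge>0. \<forall>x\<in>\<Omega>. \<forall>y\<in>\<Omega>. \<bar>G x \<bullet> b - G y \<bullet> b\<bar> \<le> K * norm (x - y)" if "b \<in> Basis" for b
    by (rule C1_lipschitz[OF bd conv c[OF that]])
  then obtain K where KK: "\<forall>b\<in>Basis. 0 \<le> K b \<and> (\<forall>x\<in>\<Omega>. \<forall>y\<in>\<Omega>. \<bar>G x \<bullet> b - G y \<bullet> b\<bar> \<le> K b * norm (x - y))"
    by (metis bchoice)
  have K0: "0 \<le> K b" if "b \<in> Basis" for b using KK that by blast
  have K: "\<bar>G x \<bullet> b - G y \<bullet> b\<bar> \<le> K b * norm (x - y)" if "b \<in> Basis" "x \<in> \<Omega>" "y \<in> \<Omega>" for b x y using KK that by blast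
  define L where "L = (\<Sum>b\<in>Basis. K b)"
  have L0: "0 \<le> L" unfolding L_def using K0 by (intro sum_nonneg)
  have L: "norm (G x - G y) \<le> L * norm (x - y)" if "x \<in> \<Omega>" "y \<in> \<Omega>" for x y
    unfolding L_def sum_distrib_right using K that by (intro norm_le_of_components) (auto simp: inner_diff_left)
  show thesis
  proof (rule that[of L "max B 0" G])
    fix x c assume xc: "x \<in> \<Omega>" "c \<in> \<Omega>"
    have seg: "closed_segment c x \<subseteq> \<Omega>" using conv xc by (rule_tac closed_segment_subset)
    have "\<bar>(a x - G c \<bullet> x) - (a c - G c \<bullet> c)\<bar> \<le> (L * norm (x - c)) * norm (x - c)"
    proof (rule lipschitz_of_gradient_bound[of "closed_segment c x" "\<lambda>y. a y - G c \<bullet> y" "\<lambda>y. G y - G c"])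
      fix y assume y: "y \<in> closed_segment c x"
      have "(a has_derivative (\<lambda>h. h \<bullet> G y)) (at y)" using G seg y unfolding gderiv_def by blast
      then show "GDERIV (\<lambda>y. a y - G c \<bullet> y) y :> G y - G c"
        unfolding gderiv_def by (auto intro!: derivative_eq_intros simp: inner_diff_right inner_commute)
      have "norm (G y - G c) \<le> L * norm (y - c)" using L seg y xc by blast
      also have "\<dots> \<le> L * norm (x - c)"
        using segment_bound1[OF y] L0 by (intro mult_left_mono) auto
      finally show "norm (G y - G c) \<le> L * norm (x - c)" .
    qed auto
    then show "\<bar>a x - a c - G c \<bullet> (x - c)\<bar> \<le> L * (norm (x - c))^2"
      by (simp add: inner_diff_right power2_eq_square algebra_simps)
  qed (use L0 B in \<open>auto simp: le_max_iff_disj\<close>)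
qed

section \<open>Edge weights\<close>

text \<open>
  The mean of \<open>a\<close> over the parallelogram of an edge, whose area is $1/(m+1)^2$.
\<close>

definition edge_weight :: "(real \<times> real \<Rightarrow> real) \<Rightarrow> nat \<Rightarrow> (real \<times> real \<Rightarrow> real) \<Rightarrow> real" where
  "edge_weight a m e = (real (m + 1))^2 * sq_integral (\<lambda>p. a p * e p)"

text \<open>
  What the sequel needs to know about the indicator of the parallelogram of an edge with midpoint \<open>z\<close>. It allows horizontal and
  vertical edges and both diagonal directions to be treated alike.
\<close>

definition edge_density :: "nat \<Rightarrow> real \<times> real \<Rightarrow> (real \<times> real \<Rightarrow> real) \<Rightarrow> bool" where
  "edge_density m z e \<longleftrightarrow> e \<in> borel_measurable borel \<and> (\<forall>p. 0 \<le> e p \<and> e p \<le> 1) \<and>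
    (\<forall>p. e p \<noteq> 0 \<longrightarrow> p \<in> unit_square \<and> \<bar>fst p - fst z\<bar> \<le> 1 / real (m + 1) \<and> \<bar>snd p - snd z\<bar> \<le> 1 / real (m + 1)) \<and>
    (\<integral>p. e p \<partial>lborel) = 1 / (real (m + 1))^2 \<and> (\<forall>p. e (2 *\<^sub>R z - p) = e p)"

lemma edge_densityD:
  assumes "edge_density m z e"
  shows "e \<in> borel_measurable borel" "0 \<le> e p" "e p \<le> 1" "e p \<noteq> 0 \<Longrightarrow> p \<in> unit_square"
    "e p \<noteq> 0 \<Longrightarrow> \<bar>fst p - fst z\<bar> \<le> 1 / real (m + 1)" "e p \<noteq> 0 \<Longrightarrow> \<bar>snd p - snd z\<bar> \<le> 1 / real (m + 1)"
    "(\<integral>p. e p \<partial>lborel) = 1 / (real (m + 1))^2" "e (2 *\<^sub>R z - p) = e p"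
  using assms unfolding edge_density_def by blast+

lemma edge_density_bounded:
  assumes "edge_density m z e" shows "sq_bounded e"
proof (rule sq_bounded_borel[OF edge_densityD(1)[OF assms]])
  fix p show "\<bar>e p\<bar> \<le> 1" using edge_densityD(2,3)[OF assms, of p] by simp
qed

lemma edge_density_support:
  assumes "edge_density m z e" shows "indicator unit_square p * (f p * e p) = f p * e p"
  using edge_densityD(4)[OF assms, of p] by (cases "e p = 0") (simp_all add: indicator_def)

lemma edge_density_mass:
  assumes "edge_density m z e"
  shows "(real (m + 1))^2 * sq_integral e = 1"
proof -
  have "sq_integral e = (\<integral>p. indicator unit_square p * (1 * e p) \<partial>lborel)"
    using sq_integral_lborel[OF edge_density_bounded[OF assms]] by simp
  also have "\<dots> = 1 / (real (m + 1))^2"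
    unfolding edge_density_support[OF assms, of _ "\<lambda>_. 1"] using edge_densityD(7)[OF assms] by simp
  finally show ?thesis by simp
qed

text \<open>
  The reflection at the midpoint preserves the parallelogram and changes the sign of the integrand.
\<close>

lemma edge_density_first_moment:
  assumes e: "edge_density m z e"
  shows "sq_integral (\<lambda>p. (g \<bullet> (p - z)) * e p) = 0"
proof -
  have [measurable]: "e \<in> borel_measurable borel" using e by (rule edge_densityD)
  have b: "sq_bounded (\<lambda>p. (g \<bullet> (p - z)) * e p)"
    by (intro sq_bounded_mult edge_density_bounded[OF e] sq_bounded_continuous continuous_intros)
  have "sq_integral (\<lambda>p. (g \<bullet> (p - z)) * e p) = (\<integral>p. (g \<bullet> (p - z)) * e p \<partial>lborel)"
    using sq_integral_lborel[OF b] by (simp only: edge_density_support[OF e, of _ "\<lambda>p. g \<bullet> (p - z)"])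
  also have "\<dots> = (\<integral>p. (g \<bullet> ((2 *\<^sub>R z - p) - z)) * e (2 *\<^sub>R z - p) \<partial>lborel)"
    by (rule lborel_reflect[symmetric]) measurable
  also have "\<dots> = (\<integral>p. - ((g \<bullet> (p - z)) * e p) \<partial>lborel)"
    by (intro Bochner_Integration.integral_cong refl)
      (simp add: edge_densityD(8)[OF e] inner_diff_right inner_scaleR_right algebra_simps)
  finally have "sq_integral (\<lambda>p. (g \<bullet> (p - z)) * e p) = - (\<integral>p. (g \<bullet> (p - z)) * e p \<partial>lborel)"
    by simp
  with \<open>sq_integral (\<lambda>p. (g \<bullet> (p - z)) * e p) = (\<integral>p. (g \<bullet> (p - z)) * e p \<partial>lborel)\<close>
  show ?thesis by linarith
qed

text \<open>
  The midpoint rule: the mean over the parallelogram is exact for affine functions, so it inherits the error of an affine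
  approximation. Here \<open>\<alpha>\<close> is the value at the midpoint of the approximating function.
\<close>

lemma edge_weight_approx:
  assumes e: "edge_density m z e" and a: "sq_bounded a"
    and bd: "\<And>p. e p \<noteq> 0 \<Longrightarrow> \<bar>a p - \<alpha> - g \<bullet> (p - z)\<bar> \<le> \<epsilon>"
  shows "\<bar>edge_weight a m e - \<alpha>\<bar> \<le> \<epsilon>"
proof -
  let ?H2 = "(real (m + 1))^2"
  have b: "sq_bounded e" "sq_bounded (\<lambda>p. a p * e p)" "sq_bounded (\<lambda>p. (g \<bullet> (p - z)) * e p)"
    by (intro sq_bounded_mult a edge_density_bounded[OF e] sq_bounded_continuous continuous_intros)+
  have "sq_integral (\<lambda>p. (a p - \<alpha> - g \<bullet> (p - z)) * e p) =
      sq_integral (\<lambda>p. (a p * e p - \<alpha> * e p) - (g \<bullet> (p - z)) * e p)"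
    by (simp add: left_diff_distrib)
  also have "\<dots> = sq_integral (\<lambda>p. a p * e p) - \<alpha> * sq_integral e"
    using b edge_density_first_moment[OF e]
    by (simp add: sq_integral_diff sq_integral_cmult sq_bounded_diff sq_bounded_cmult)
  finally have "?H2 * sq_integral (\<lambda>p. (a p - \<alpha> - g \<bullet> (p - z)) * e p) =
      ?H2 * sq_integral (\<lambda>p. a p * e p) - \<alpha> * (?H2 * sq_integral e)"
    by (simp only: right_diff_distrib mult.left_commute)
  then have "edge_weight a m e - \<alpha> = ?H2 * sq_integral (\<lambda>p. (a p - \<alpha> - g \<bullet> (p - z)) * e p)"
    unfolding edge_density_mass[OF e] edge_weight_def by simp
  moreover have "\<bar>sq_integral (\<lambda>p. (a p - \<alpha> - g \<bullet> (p - z)) * e p)\<bar> \<le> sq_integral (\<lambda>p. \<epsilon> * e p)"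
  proof (rule sq_integral_abs_bound)
    show "sq_bounded (\<lambda>p. (a p - \<alpha> - g \<bullet> (p - z)) * e p)"
      by (intro sq_bounded_mult sq_bounded_diff a b sq_bounded_continuous continuous_intros)
    show "sq_bounded (\<lambda>p. \<epsilon> * e p)" using b by (intro sq_bounded_cmult)
    fix p
    show "\<bar>(a p - \<alpha> - g \<bullet> (p - z)) * e p\<bar> \<le> \<epsilon> * e p"
    proof (cases "e p = 0")
      case False
      have "0 \<le> e p" by (rule edge_densityD[OF e])
      then show ?thesis using mult_right_mono[OF bd[OF False]] by (simp add: abs_mult)
    qed simp
  qed
  then have "?H2 * \<bar>sq_integral (\<lambda>p. (a p - \<alpha> - g \<bullet> (p - z)) * e p)\<bar> \<le> ?H2 * (\<epsilon> * sq_integral e)"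
    unfolding sq_integral_cmult by (intro mult_left_mono) auto
  moreover have "?H2 * (\<epsilon> * sq_integral e) = \<epsilon>"
    using arg_cong[OF edge_density_mass[OF e], of "\<lambda>x. \<epsilon> * x"] by (simp only: mult.left_commute mult_1_right)
  ultimately show ?thesis by (simp only: abs_mult abs_power2)
qed

lemma div_in_unit_interval:
  assumes "0 < x" "x < real (m + 1)" shows "0 < x / real (m + 1)" "x / real (m + 1) < 1"
  using assms by (auto simp: divide_less_eq)

lemma edge_h_density:
  assumes "i \<le> m" "1 \<le> j" "j \<le> m"
  shows "edge_density m ((real i + 1 / 2) / real (m + 1), real j / real (m + 1)) (edge_h dg m i j)" (is "edge_density m ?z ?e")
proof -
  let ?H = "real (m + 1)"
  have H: "0 < ?H" by simp
  have supp: "p \<in> unit_square \<and> \<bar>fst p - fst ?z\<bar> \<le> 1 / ?H \<and> \<bar>snd p - snd ?z\<bar> \<le> 1 / ?H" if "?e p \<noteq> 0" for p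
  proof -
    define s t where "s = ?H * fst p - real i" and "t = ?H * snd p - real j"
    have "edge_step (orient dg) s t \<noteq> 0" using that by (simp add: edge_h_def s_def t_def)
    then have st: "0 < s" "s < 1" "s - 1 < orient dg * t" "orient dg * t < s"
      by (auto simp: edge_step_def split: if_splits)
    then have t: "-1 < t" "t < 1" using orient_cases[of dg] by auto
    have p: "fst p = (real i + s) / ?H" "snd p = (real j + t) / ?H"
      using H by (simp_all add: s_def t_def)
    have "0 < real i + s" "real i + s < ?H" "0 < real j + t" "real j + t < ?H"
      using st t assms by (simp_all add: add_nonneg_pos)
    then have "p \<in> unit_square" unfolding unit_square_def mem_Times_iff p by (auto intro: div_in_unit_interval)
    moreover have "fst p - fst ?z = (s - 1 / 2) / ?H" "snd p - snd ?z = t / ?H"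
      using H by (simp_all add: p diff_divide_distrib add_divide_distrib)
    then have "\<bar>fst p - fst ?z\<bar> \<le> 1 / ?H" "\<bar>snd p - snd ?z\<bar> \<le> 1 / ?H"
      using st t H by (auto simp: abs_divide intro!: divide_right_mono)
    ultimately show ?thesis by blast
  qed
  have refl: "?e (2 *\<^sub>R ?z - p) = ?e p" for p
  proof -
    have "?H * fst (2 *\<^sub>R ?z - p) - real i = 1 - (?H * fst p - real i)"
      "?H * snd (2 *\<^sub>R ?z - p) - real j = - (?H * snd p - real j)"
      using H by (simp_all add: right_diff_distrib)
    then show ?thesis unfolding edge_h_def by (simp only: edge_step_reflect)
  qed
  have val: "0 \<le> ?e p" "?e p \<le> 1" for p by (simp_all add: edge_h_def edge_step_def)
  show ?thesis unfolding edge_density_def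
    using edge_h_borel[of dg m i j] edge_h_mass[of dg m i j] supp refl val by blast
qed

lemma edge_density_swap:
  assumes e: "edge_density m (x, y) e" and e': "\<And>p. e' p = e (snd p, fst p)"
    and mass: "(\<integral>p. e' p \<partial>lborel) = 1 / (real (m + 1))^2" and borel: "e' \<in> borel_measurable borel"
  shows "edge_density m (y, x) e'"
proof -
  have sq: "(snd p, fst p) \<in> unit_square \<longleftrightarrow> p \<in> unit_square" for p by (auto simp: unit_square_def mem_Times_iff)
  have "e' (2 *\<^sub>R (y, x) - p) = e' p" for p
    using edge_densityD(8)[OF e, of "(snd p, fst p)"] unfolding e' by simp
  moreover have "e' p \<noteq> 0 \<longrightarrow> p \<in> unit_square \<and> \<bar>fst p - fst (y, x)\<bar> \<le> 1 / real (m + 1)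
      \<and> \<bar>snd p - snd (y, x)\<bar> \<le> 1 / real (m + 1)" for p
    using edge_densityD(4-6)[OF e, of "(snd p, fst p)"] unfolding e' sq by simp
  moreover have "0 \<le> e' p \<and> e' p \<le> 1" for p
    using edge_densityD(2,3)[OF e] unfolding e' by blast
  ultimately show ?thesis unfolding edge_density_def using mass borel by blast
qed

lemma edge_v_density:
  assumes "j \<le> m" "1 \<le> i" "i \<le> m"
  shows "edge_density m (real i / real (m + 1), (real j + 1 / 2) / real (m + 1)) (edge_v dg m i j)"
proof (rule edge_density_swap[OF edge_h_density[OF assms, of dg] _ edge_v_mass edge_v_borel])
  fix p show "edge_v dg m i j p = edge_h dg m j i (snd p, fst p)"
    by (simp add: edge_v_def edge_h_def)
qed

lemma edge_weight_bounds:
  assumes e: "edge_density m z e" and a: "sq_bounded a"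
    and bd: "\<And>p. p \<in> unit_square \<Longrightarrow> lo \<le> a p \<and> a p \<le> hi"
  shows "lo \<le> edge_weight a m e" "edge_weight a m e \<le> hi"
proof -
  have p: "p \<in> unit_square" if "e p \<noteq> 0" for p using edge_densityD(4)[OF e that] .
  \<comment> \<open>The constant $(lo+hi)/2$ approximates $a$ with error $(hi-lo)/2$.\<close>
  have "\<bar>edge_weight a m e - (lo + hi) / 2\<bar> \<le> (hi - lo) / 2"
  proof (rule edge_weight_approx[OF e a, where g = 0])
    fix q assume "e q \<noteq> 0"
    then have "lo \<le> a q \<and> a q \<le> hi" using p bd by blast
    then have "lo \<le> a q" "a q \<le> hi" by simp_all
    then have "\<bar>a q - (lo + hi) / 2\<bar> \<le> (hi - lo) / 2" by (simp add: abs_le_iff field_simps)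
    then show "\<bar>a q - (lo + hi) / 2 - 0 \<bullet> (q - z)\<bar> \<le> (hi - lo) / 2" by simp
  qed
  then show "lo \<le> edge_weight a m e" "edge_weight a m e \<le> hi" by (simp_all add: abs_le_iff field_simps)
qed

section \<open>The stiffness matrix\<close>

lemma nodal_gradient_AE:
  assumes "k < m^2"
  shows "AE p in lebesgue. gradient (nodal_basis dg m k) p = (grad_x dg m k p, grad_y dg m k p)"
  using AE_off_mesh[of dg m] by eventually_elim
    (simp add: nodal_basis_eq[OF assms] gradient_eqI[OF hat_fn_GDERIV])

lemma edge_h_bounded: "sq_bounded (edge_h dg m i j)"
  by (rule sq_bounded_borel[OF edge_h_borel, where B = 1]) (simp add: edge_h_def edge_step_def)

lemma edge_v_bounded: "sq_bounded (edge_v dg m i j)"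
  by (rule sq_bounded_borel[OF edge_v_borel, where B = 1]) (simp add: edge_v_def edge_step_def)

lemma grad_bounded: "sq_bounded (grad_x dg m k)" "sq_bounded (grad_y dg m k)"
  unfolding grad_x_def[abs_def] grad_y_def[abs_def]
  by (intro sq_bounded_cmult sq_bounded_diff edge_h_bounded edge_v_bounded)+

lemma Theta_entry_integral:
  assumes "k < m^2" "l < m^2" "sq_bounded a"
  shows "Theta_mat dg m a $$ (k, l) =
    sq_integral (\<lambda>p. a p * (grad_x dg m k p * grad_x dg m l p) + a p * (grad_y dg m k p * grad_y dg m l p))"
proof -
  have "Theta_mat dg m a $$ (k, l) =
      sq_integral (\<lambda>p. a p * (gradient (nodal_basis dg m k) p \<bullet> gradient (nodal_basis dg m l) p))"
    using assms by (simp add: Theta_mat_def)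
  also have "\<dots> = sq_integral (\<lambda>p. a p * (grad_x dg m k p * grad_x dg m l p) + a p * (grad_y dg m k p * grad_y dg m l p))"
  proof (rule sq_integral_cong_AE)
    show "sq_bounded (\<lambda>p. a p * (grad_x dg m k p * grad_x dg m l p) + a p * (grad_y dg m k p * grad_y dg m l p))"
      by (intro sq_bounded_add sq_bounded_mult assms grad_bounded)
    show "AE p in lebesgue. p \<in> unit_square \<longrightarrow> a p * (gradient (nodal_basis dg m k) p \<bullet> gradient (nodal_basis dg m l) p) =
        a p * (grad_x dg m k p * grad_x dg m l p) + a p * (grad_y dg m k p * grad_y dg m l p)"
      using nodal_gradient_AE[OF assms(1), of dg] nodal_gradient_AE[OF assms(2), of dg]
      by eventually_elim (simp add: distrib_left)
  qed
  finally show ?thesis .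
qed

text \<open>
  The common computation behind the contributions of the two partial derivatives: expand the product of the differences
  and use that the product of two edge indicators is zero or one of them.
\<close>

lemma edge_product_integral:
  assumes a: "sq_bounded a" and e: "sq_bounded e1" "sq_bounded e2" "sq_bounded f1" "sq_bounded f2"
    and c: "\<And>p. e1 p * f1 p = (if c11 then e1 p else 0)" "\<And>p. e1 p * f2 p = (if c12 then e1 p else 0)"
      "\<And>p. e2 p * f1 p = (if c21 then e2 p else 0)" "\<And>p. e2 p * f2 p = (if c22 then e2 p else 0)"
  shows "sq_integral (\<lambda>p. a p * (real (m + 1) * (e1 p - e2 p) * (real (m + 1) * (f1 p - f2 p)))) =
    (if c11 then edge_weight a m e1 else 0) - (if c12 then edge_weight a m e1 else 0)
    - (if c21 then edge_weight a m e2 else 0) + (if c22 then edge_weight a m e2 else 0)"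
proof -
  let ?H2 = "(real (m + 1))^2"
  have prod: "?H2 * sq_integral (\<lambda>p. a p * (e p * f p)) = (if c then edge_weight a m e else 0)"
    if "\<And>p. e p * f p = (if c then e p else 0)" for e f :: "real \<times> real \<Rightarrow> real" and c
    unfolding that edge_weight_def by (cases c) (simp_all add: set_lebesgue_integral_def)
  have "sq_integral (\<lambda>p. a p * (real (m + 1) * (e1 p - e2 p) * (real (m + 1) * (f1 p - f2 p)))) =
      sq_integral (\<lambda>p. ?H2 * (((a p * (e1 p * f1 p) - a p * (e1 p * f2 p)) - a p * (e2 p * f1 p)) + a p * (e2 p * f2 p)))"
    by (simp add: power2_eq_square algebra_simps)
  also have "\<dots> = ?H2 * sq_integral (\<lambda>p. ((a p * (e1 p * f1 p) - a p * (e1 p * f2 p)) - a p * (e2 p * f1 p)) + a p * (e2 p * f2 p))"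
    by (rule sq_integral_cmult)
  also have "sq_integral (\<lambda>p. ((a p * (e1 p * f1 p) - a p * (e1 p * f2 p)) - a p * (e2 p * f1 p)) + a p * (e2 p * f2 p))
     = ((sq_integral (\<lambda>p. a p * (e1 p * f1 p)) - sq_integral (\<lambda>p. a p * (e1 p * f2 p)))
        - sq_integral (\<lambda>p. a p * (e2 p * f1 p))) + sq_integral (\<lambda>p. a p * (e2 p * f2 p))"
    by (subst sq_integral_add sq_integral_diff, (intro sq_bounded_add sq_bounded_diff sq_bounded_mult a e)+)+ simp
  finally show ?thesis
    unfolding prod[OF c(1), symmetric] prod[OF c(2), symmetric] prod[OF c(3), symmetric] prod[OF c(4), symmetric]
    by (simp only: right_diff_distrib distrib_left)
qed

text \<open>
  The partial derivatives of the nodal function of \<open>k\<close> involve the edges to the left, right, below and above the node. A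
  weight contributes to the entry for \<open>k\<close> and \<open>l\<close> exactly if its edge belongs to both nodes.
\<close>

lemma Theta_entry:
  fixes dg :: diagonal
  assumes k: "k < m^2" and l: "l < m^2" and a: "sq_bounded a"
  defines "wh \<equiv> \<lambda>i j. edge_weight a m (edge_h dg m i j)" and "wv \<equiv> \<lambda>i j. edge_weight a m (edge_v dg m i j)"
  shows "Theta_mat dg m a $$ (k, l) =
    (if k mod m = l mod m \<and> iy m k = iy m l then wh (k mod m) (iy m k) else 0)
    - (if k mod m = ix m l \<and> iy m k = iy m l then wh (k mod m) (iy m k) else 0)
    - (if ix m k = l mod m \<and> iy m k = iy m l then wh (ix m k) (iy m k) else 0)
    + (if ix m k = ix m l \<and> iy m k = iy m l then wh (ix m k) (iy m k) else 0)
    + ((if ix m k = ix m l \<and> k div m = l div m then wv (ix m k) (k div m) else 0)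
    - (if ix m k = ix m l \<and> k div m = iy m l then wv (ix m k) (k div m) else 0)
    - (if ix m k = ix m l \<and> iy m k = l div m then wv (ix m k) (iy m k) else 0)
    + (if ix m k = ix m l \<and> iy m k = iy m l then wv (ix m k) (iy m k) else 0))"
proof -
  have "Theta_mat dg m a $$ (k, l) = sq_integral (\<lambda>p. a p * (grad_x dg m k p * grad_x dg m l p)) +
      sq_integral (\<lambda>p. a p * (grad_y dg m k p * grad_y dg m l p))"
    unfolding Theta_entry_integral[OF k l a]
    by (intro sq_integral_add sq_bounded_mult a grad_bounded)
  then show ?thesis unfolding wh_def wv_def grad_x_def grad_y_def
    by (simp only: edge_product_integral[OF a edge_h_bounded edge_h_bounded edge_h_bounded edge_h_bounded
         edge_h_mult edge_h_mult edge_h_mult edge_h_mult]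
       edge_product_integral[OF a edge_v_bounded edge_v_bounded edge_v_bounded edge_v_bounded
         edge_v_mult edge_v_mult edge_v_mult edge_v_mult])
qed

lemma internal_node_simps: "fst (internal_node m k) = real (ix m k) / real (m + 1)"
  "snd (internal_node m k) = real (iy m k) / real (m + 1)"
  by (simp_all add: internal_node_def node_def)

definition near :: "nat \<Rightarrow> real \<Rightarrow> real \<times> real \<Rightarrow> real \<times> real \<Rightarrow> bool" where
  "near m r p q \<longleftrightarrow> \<bar>fst p - fst q\<bar> \<le> r / real (m + 1) \<and> \<bar>snd p - snd q\<bar> \<le> r / real (m + 1)"

text \<open>
  The midpoints of the four edges at a node have the node as their mean; this is the reason why the mean of the four weights is
  second order accurate at the node.
\<close>

lemma Theta_diag:
  assumes k: "k < m^2" and a: "sq_bounded a"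
  obtains e1 e2 e3 e4 z1 z2 z3 z4 where
    "edge_density m z1 e1" "edge_density m z2 e2" "edge_density m z3 e3" "edge_density m z4 e4"
    "near m (1/2) z1 (internal_node m k)" "near m (1/2) z2 (internal_node m k)"
    "near m (1/2) z3 (internal_node m k)" "near m (1/2) z4 (internal_node m k)"
    "z1 + z2 + z3 + z4 = 4 *\<^sub>R internal_node m k"
    "Theta_mat dg m a $$ (k, k) = edge_weight a m e1 + edge_weight a m e2 + edge_weight a m e3 + edge_weight a m e4"
proof -
  let ?H = "real (m + 1)"
  note idx = grid_index_less[OF k]
  have i: "k mod m \<le> m" "k div m \<le> m" "1 \<le> ix m k" "ix m k \<le> m" "1 \<le> iy m k" "iy m k \<le> m"
    using idx by linarith+
  have H: "0 < ?H" by simp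
  define z where "z = internal_node m k"
  have z: "fst z = (real (k mod m) + 1) / ?H" "snd z = (real (k div m) + 1) / ?H"
    by (simp_all add: z_def internal_node_simps add.commute)
  show thesis
  proof (rule that[OF edge_h_density[OF i(1) i(5,6), of dg] edge_h_density[OF i(4) i(5,6), of dg]
      edge_v_density[OF i(2) i(3,4), of dg] edge_v_density[OF i(6) i(3,4), of dg]])
    show "near m (1/2) ((real (k mod m) + 1 / 2) / ?H, real (iy m k) / ?H) (internal_node m k)"
      "near m (1/2) ((real (ix m k) + 1 / 2) / ?H, real (iy m k) / ?H) (internal_node m k)"
      "near m (1/2) (real (ix m k) / ?H, (real (k div m) + 1 / 2) / ?H) (internal_node m k)"
      "near m (1/2) (real (ix m k) / ?H, (real (iy m k) + 1 / 2) / ?H) (internal_node m k)"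
      unfolding near_def z_def[symmetric] fst_conv snd_conv z
      using H by (simp_all add: diff_divide_distrib[symmetric] abs_divide)
    show "((real (k mod m) + 1 / 2) / ?H, real (iy m k) / ?H) + ((real (ix m k) + 1 / 2) / ?H, real (iy m k) / ?H)
      + (real (ix m k) / ?H, (real (k div m) + 1 / 2) / ?H) + (real (ix m k) / ?H, (real (iy m k) + 1 / 2) / ?H)
      = 4 *\<^sub>R internal_node m k"
      unfolding z_def[symmetric] using H
      by (simp add: prod_eq_iff z add_divide_distrib[symmetric])
  qed (simp add: Theta_entry[OF k k a])
qed

lemma Theta_symmetric: "k < m^2 \<Longrightarrow> l < m^2 \<Longrightarrow> Theta_mat dg m a $$ (k, l) = Theta_mat dg m a $$ (l, k)"
  by (simp add: Theta_mat_def inner_commute)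

lemma Theta_successor:
  assumes k: "k < m^2" and l: "l < m^2" and a: "sq_bounded a"
    and nb: "ix m l = Suc (ix m k) \<and> iy m k = iy m l \<or> ix m k = ix m l \<and> iy m l = Suc (iy m k)"
  obtains e z where "edge_density m z e" "near m (1/2) (internal_node m k) z" "near m (1/2) (internal_node m l) z"
    "internal_node m k + internal_node m l = 2 *\<^sub>R z" "Theta_mat dg m a $$ (k, l) = - edge_weight a m e"
    "z \<in> unit_square"
proof -
  let ?H = "real (m + 1)"
  have i: "1 \<le> ix m k" "ix m k \<le> m" "1 \<le> iy m k" "iy m k \<le> m"
    using grid_index_less[OF k] by linarith+
  have H: "0 < ?H" by simp
  define zk zl where "zk = internal_node m k" and "zl = internal_node m l"
  have z: "fst zk = (real (k mod m) + 1) / ?H" "snd zk = (real (k div m) + 1) / ?H"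
    "fst zl = (real (l mod m) + 1) / ?H" "snd zl = (real (l div m) + 1) / ?H"
    by (simp_all add: zk_def zl_def internal_node_simps add.commute)
  have inside: "((real i + 1 / 2) / ?H, real j / ?H) \<in> unit_square" "(real j / ?H, (real i + 1 / 2) / ?H) \<in> unit_square"
    if "i \<le> m" "1 \<le> j" "j \<le> m" for i j
    using that by (auto simp: unit_square_def intro!: div_in_unit_interval divide_pos_pos)
  consider "ix m l = Suc (ix m k)" "iy m k = iy m l" | "ix m k = ix m l" "iy m l = Suc (iy m k)"
    using nb by blast
  then show thesis
  proof cases
    case 1
    show thesis
    proof (rule that[OF edge_h_density[OF i(2) i(3,4), of dg]])
      show "near m (1/2) (internal_node m k) ((real (ix m k) + 1 / 2) / ?H, real (iy m k) / ?H)"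
        "near m (1/2) (internal_node m l) ((real (ix m k) + 1 / 2) / ?H, real (iy m k) / ?H)"
        unfolding near_def zk_def[symmetric] zl_def[symmetric] fst_conv snd_conv z
        using H 1 by (simp_all add: diff_divide_distrib[symmetric] abs_divide)
      show "internal_node m k + internal_node m l = 2 *\<^sub>R ((real (ix m k) + 1 / 2) / ?H, real (iy m k) / ?H)"
        unfolding zk_def[symmetric] zl_def[symmetric] using H 1
        by (simp add: prod_eq_iff z add_divide_distrib[symmetric])
      show "Theta_mat dg m a $$ (k, l) = - edge_weight a m (edge_h dg m (ix m k) (iy m k))"
        unfolding Theta_entry[OF k l a] using 1 by simp
    qed (rule inside(1)[OF i(2) i(3,4)])
  next
    case 2
    show thesis
    proof (rule that[OF edge_v_density[OF i(4) i(1,2), of dg]])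
      show "near m (1/2) (internal_node m k) (real (ix m k) / ?H, (real (iy m k) + 1 / 2) / ?H)"
        "near m (1/2) (internal_node m l) (real (ix m k) / ?H, (real (iy m k) + 1 / 2) / ?H)"
        unfolding near_def zk_def[symmetric] zl_def[symmetric] fst_conv snd_conv z
        using H 2 by (simp_all add: diff_divide_distrib[symmetric] abs_divide)
      show "internal_node m k + internal_node m l = 2 *\<^sub>R (real (ix m k) / ?H, (real (iy m k) + 1 / 2) / ?H)"
        unfolding zk_def[symmetric] zl_def[symmetric] using H 2
        by (simp add: prod_eq_iff z add_divide_distrib[symmetric])
      show "Theta_mat dg m a $$ (k, l) = - edge_weight a m (edge_v dg m (ix m k) (iy m k))"
        unfolding Theta_entry[OF k l a] using 2 by simp
    qed (rule inside(2)[OF i(4) i(1,2)])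
  qed
qed

lemma Theta_neighbour:
  assumes k: "k < m^2" and l: "l < m^2" and a: "sq_bounded a" and nb: "five_point m k l = -1"
  obtains e z where "edge_density m z e" "near m (1/2) (internal_node m k) z" "near m (1/2) (internal_node m l) z"
    "internal_node m k + internal_node m l = 2 *\<^sub>R z" "Theta_mat dg m a $$ (k, l) = - edge_weight a m e"
    "z \<in> unit_square"
proof -
  have "ix m l = Suc (ix m k) \<and> iy m k = iy m l \<or> ix m k = ix m l \<and> iy m l = Suc (iy m k)
      \<or> (ix m k = Suc (ix m l) \<and> iy m l = iy m k \<or> ix m l = ix m k \<and> iy m k = Suc (iy m l))"
    using nb by (auto simp: five_point_def split: if_splits)
  then consider "ix m l = Suc (ix m k) \<and> iy m k = iy m l \<or> ix m k = ix m l \<and> iy m l = Suc (iy m k)"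
    | "ix m k = Suc (ix m l) \<and> iy m l = iy m k \<or> ix m l = ix m k \<and> iy m k = Suc (iy m l)"
    by argo
  then show thesis
  proof cases
    case 1
    show thesis by (rule Theta_successor[OF k l a 1, of dg]) (rule that)
  next
    case 2
    obtain e z where "edge_density m z e" "near m (1/2) (internal_node m l) z" "near m (1/2) (internal_node m k) z"
      "internal_node m l + internal_node m k = 2 *\<^sub>R z" "Theta_mat dg m a $$ (l, k) = - edge_weight a m e"
      "z \<in> unit_square"
      by (rule Theta_successor[OF l k a 2, of dg])
    then show thesis using Theta_symmetric[OF k l, of dg a] by (intro that[of z e]) (simp_all add: add.commute)
  qed
qed

lemma Theta_zero:
  assumes k: "k < m^2" and l: "l < m^2" and a: "sq_bounded a" and "five_point m k l = 0"
  shows "Theta_mat dg m a $$ (k, l) = 0"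
proof -
  have "k \<noteq> l" using assms(4) by (auto simp: five_point_def)
  then have "\<not> (k mod m = l mod m \<and> k div m = l div m)" using grid_index_eq[OF k l] by blast
  moreover have "\<not> (k div m = l div m \<and> (l mod m = Suc (k mod m) \<or> k mod m = Suc (l mod m)))"
     "\<not> (k mod m = l mod m \<and> (l div m = Suc (k div m) \<or> k div m = Suc (l div m)))"
    using assms(4) \<open>k \<noteq> l\<close> by (auto simp: five_point_def split: if_splits)
  ultimately show ?thesis unfolding Theta_entry[OF k l a] by auto
qed

lemma five_point_values: "five_point m k l = (if k = l then 4 else five_point m k l) \<and> (k \<noteq> l \<longrightarrow> five_point m k l \<in> {-1, 0})"
  by (simp add: five_point_def)

text \<open>
  For $a = 1$ all weights are $1$.
\<close>

lemma Theta_one: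
  assumes k: "k < m^2" and l: "l < m^2"
  shows "Theta_mat dg m (\<lambda>p. 1) $$ (k, l) = five_point m k l"
proof -
  have w: "edge_weight (\<lambda>p. 1) m e = 1" if "edge_density m z e" for e z
    using edge_weight_bounds[OF that sq_bounded_const[of 1], of 1 1] by simp
  consider "k = l" | "k \<noteq> l" "five_point m k l = 0" | "k \<noteq> l" "five_point m k l = -1"
    using five_point_values[of m k l] by blast
  then show ?thesis
  proof cases
    case 1
    obtain e1 e2 e3 e4 z1 z2 z3 z4 where e: "edge_density m z1 e1" "edge_density m z2 e2" "edge_density m z3 e3" "edge_density m z4 e4"
      and t: "Theta_mat dg m (\<lambda>p. 1) $$ (k, k) = edge_weight (\<lambda>p. 1) m e1 + edge_weight (\<lambda>p. 1) m e2
        + edge_weight (\<lambda>p. 1) m e3 + edge_weight (\<lambda>p. 1) m e4"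
      by (rule Theta_diag[OF k sq_bounded_const[of 1], of dg])
    show ?thesis using t 1 by (simp add: w[OF e(1)] w[OF e(2)] w[OF e(3)] w[OF e(4)] five_point_def)
  next
    case 2 then show ?thesis using Theta_zero[OF k l sq_bounded_const] by simp
  next
    case 3
    obtain e z where e: "edge_density m z e" and t: "Theta_mat dg m (\<lambda>p. 1) $$ (k, l) = - edge_weight (\<lambda>p. 1) m e"
      by (rule Theta_neighbour[OF k l sq_bounded_const[of 1] 3(2), of dg])
    show ?thesis using t 3 w[OF e] by simp
  qed
qed

section \<open>Integration by parts on the square\<close>

text \<open>
  Fubini's theorem and the fundamental theorem of calculus on almost every horizontal line. Finitely many exceptional points are
  allowed on each line, since nodal functions are not differentiable where the line meets the edges of the mesh.
\<close>

lemma partial_integral_zero: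
  fixes f F :: "real \<times> real \<Rightarrow> real"
  assumes f: "sq_bounded f"
    and cont: "\<And>y. y \<in> {0<..<1} \<Longrightarrow> continuous_on {0..1} (\<lambda>x. F (x, y))"
    and zero: "\<And>y. y \<in> {0<..<1} \<Longrightarrow> F (0, y) = F (1, y)"
    and deriv: "AE y in lborel. y \<in> {0<..<1} \<longrightarrow> (\<exists>Z. finite Z \<and>
      (\<forall>x\<in>{0<..<1} - Z. ((\<lambda>x. F (x, y)) has_real_derivative f (x, y)) (at x)))"
  shows "sq_integral f = 0"
proof -
  define g where "g x y = indicator unit_square (x, y) * f (x, y)" for x y
  have int: "integrable (lborel \<Otimes>\<^sub>M lborel) (\<lambda>(x, y). g x y)"
    using sq_bounded_integrable(1)[OF f] unfolding lborel_prod set_integrable_def g_def by (simp add: case_prod_beta')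
  have "sq_integral f = integral\<^sup>L (lborel \<Otimes>\<^sub>M lborel) (\<lambda>(x, y). g x y)"
    unfolding lborel_prod sq_integral_lborel[OF f] g_def by (simp add: case_prod_beta')
  also have "\<dots> = (\<integral>y. \<integral>x. g x y \<partial>lborel \<partial>lborel)"
    using lborel_pair.integral_snd[OF int] by simp
  also have "\<dots> = 0"
  proof (rule integral_eq_zero_AE)
    show "AE y in lborel. (\<integral>x. g x y \<partial>lborel) = 0"
      using lborel_pair.AE_integrable_snd[OF int] deriv
    proof eventually_elim
      case (elim y)
      show "(\<integral>x. g x y \<partial>lborel) = 0"
      proof (cases "y \<in> {0<..<1}")
        case False
        then have "g x y = 0" for x by (auto simp: g_def unit_square_def)
        then show ?thesis by simp
      next
        case True
        then obtain Z where Z: "finite Z" "\<And>x. x \<in> {0<..<1} - Z \<Longrightarrow> ((\<lambda>x. F (x, y)) has_real_derivative f (x, y)) (at x)"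
          using elim(2) by blast
        have "((\<lambda>x. f (x, y)) has_integral (F (1, y) - F (0, y))) {0..1}"
        proof (rule fundamental_theorem_of_calculus_interior_strong[OF Z(1)])
          fix x :: real assume "x \<in> {0<..<1} - Z"
          then show "((\<lambda>x. F (x, y)) has_vector_derivative f (x, y)) (at x)"
            using Z(2) has_real_derivative_iff_has_vector_derivative by blast
        qed (use cont[OF True] in auto)
        then have "((\<lambda>x. f (x, y)) has_integral 0) {0..1}" using zero[OF True] by simp
        then have "((\<lambda>x. if x \<in> {0..1} then f (x, y) else 0) has_integral 0) UNIV"
          unfolding has_integral_restrict_UNIV .
        then have "((\<lambda>x. g x y) has_integral 0) UNIV"
          by (rule has_integral_spike_finite[of "{0, 1}", rotated 2]) (use True in \<open>auto simp: g_def unit_square_def\<close>)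
        moreover have "((\<lambda>x. g x y) has_integral (\<integral>x. g x y \<partial>lborel)) UNIV"
          using elim(1) by (rule has_integral_integral_lborel)
        ultimately show ?thesis by (rule has_integral_unique[symmetric])
      qed
    qed
  qed
  finally show ?thesis .
qed

lemma sq_integral_swap:
  assumes f: "sq_bounded f"
  shows "sq_bounded (\<lambda>p. f (snd p, fst p))" "sq_integral (\<lambda>p. f (snd p, fst p)) = sq_integral f"
proof -
  let ?g = "\<lambda>p. indicator unit_square p * f p"
  have swap: "indicator unit_square (snd p, fst p) = (indicator unit_square p :: real)" for p
    by (auto simp: indicator_def unit_square_def mem_Times_iff)
  have g: "?g \<in> borel_measurable borel" using f unfolding sq_bounded_def by blast
  have m: "(\<lambda>p::real \<times> real. (snd p, fst p)) \<in> borel_measurable borel"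
    by (intro borel_measurable_continuous_onI continuous_intros)
  have "(\<lambda>p. ?g (snd p, fst p)) \<in> borel_measurable borel" using measurable_compose[OF m g] .
  then have meas: "(\<lambda>p. indicator unit_square p * f (snd p, fst p)) \<in> borel_measurable borel" by (simp only: swap)
  obtain B where "\<And>p. p \<in> unit_square \<Longrightarrow> \<bar>f p\<bar> \<le> B" using f unfolding sq_bounded_def by blast
  then have "\<bar>f (snd p, fst p)\<bar> \<le> B" if "p \<in> unit_square" for p
    using that by (auto simp: unit_square_def mem_Times_iff)
  then show b: "sq_bounded (\<lambda>p. f (snd p, fst p))" by (rule sq_boundedI[OF meas])
  have "(\<integral>(x, y). ?g (y, x) \<partial>(lborel \<Otimes>\<^sub>M lborel)) = integral\<^sup>L (lborel \<Otimes>\<^sub>M lborel) ?g"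
    by (rule lborel_pair.integral_product_swap) (use g in \<open>simp add: lborel_prod\<close>)
  moreover have "(\<lambda>(x, y). ?g (y, x)) = (\<lambda>p. indicator unit_square p * f (snd p, fst p))"
    by (auto simp: fun_eq_iff indicator_def unit_square_def)
  ultimately show "sq_integral (\<lambda>p. f (snd p, fst p)) = sq_integral f"
    unfolding sq_integral_lborel[OF f] sq_integral_lborel[OF b] lborel_prod by simp
qed

lemma finite_lattice_points:
  fixes H c :: real
  assumes "0 < H"
  shows "finite {x. 0 < x \<and> x < 1 \<and> H * x - c \<in> \<int>}"
proof (rule finite_subset)
  show "{x. 0 < x \<and> x < 1 \<and> H * x - c \<in> \<int>} \<subseteq> (\<lambda>z::int. (of_int z + c) / H) ` {\<lfloor>-c\<rfloor>..\<lceil>H - c\<rceil>}"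
  proof
    fix x assume "x \<in> {x. 0 < x \<and> x < 1 \<and> H * x - c \<in> \<int>}"
    then obtain z :: int where x: "0 < x" "x < 1" and z: "H * x - c = of_int z" by (auto elim: Ints_cases)
    have "0 < H * x" "H * x < H" using x assms by auto
    then have "- c < of_int z" "of_int z < H - c" using z by linarith+
    then have "z \<in> {\<lfloor>-c\<rfloor>..\<lceil>H - c\<rceil>}" by (simp add: floor_le_iff le_ceiling_iff)
    moreover have "x = (of_int z + c) / H" using z assms by (simp add: field_simps)
    ultimately show "x \<in> (\<lambda>z::int. (of_int z + c) / H) ` {\<lfloor>-c\<rfloor>..\<lceil>H - c\<rceil>}" by blast
  qed
qed simp

lemma AE_not_lattice:
  fixes H :: real
  assumes "0 < H"
  shows "AE y in lborel. H * y \<notin> \<int>"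
proof -
  have "{y. H * y \<in> \<int>} \<subseteq> range (\<lambda>z::int. of_int z / H)"
    using assms by (auto elim!: Ints_cases simp: field_simps)
  then have "countable {y. H * y \<in> \<int>}" by (rule countable_subset) simp
  then have "{y. H * y \<in> \<int>} \<in> null_sets lborel" by (rule countable_imp_null_set_lborel)
  from AE_not_in[OF this] show ?thesis by simp
qed

lemma GDERIV_partial:
  fixes F :: "real \<times> real \<Rightarrow> real"
  assumes "GDERIV F (x, y) :> D"
  shows "((\<lambda>x. F (x, y)) has_real_derivative fst D) (at x)" "((\<lambda>y. F (x, y)) has_real_derivative snd D) (at y)"
proof -
  have F: "(F has_derivative (\<lambda>h. h \<bullet> D)) (at (x, y))" using assms unfolding gderiv_def .
  have "((\<lambda>x. (x, y)) has_derivative (\<lambda>h. (h, 0))) (at x)" by (auto intro!: derivative_eq_intros)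
  from has_derivative_compose[OF this F] show "((\<lambda>x. F (x, y)) has_real_derivative fst D) (at x)"
    unfolding has_field_derivative_def by (simp add: inner_prod_def mult_commute_abs)
  have "((\<lambda>y. (x, y)) has_derivative (\<lambda>h. (0, h))) (at y)" by (auto intro!: derivative_eq_intros)
  from has_derivative_compose[OF this F] show "((\<lambda>y. F (x, y)) has_real_derivative snd D) (at y)"
    unfolding has_field_derivative_def by (simp add: inner_prod_def mult_commute_abs)
qed

text \<open>
  A line parallel to an axis that is not a mesh line meets the mesh in finitely many points. The second partial derivative is
  reduced to the first one by swapping the coordinates.
\<close>

lemma gradient_integral_zero:
  fixes F :: "real \<times> real \<Rightarrow> real"
  assumes cont: "continuous_on (closure unit_square) F"
    and zero: "\<And>p. p \<notin> unit_square \<Longrightarrow> F p = 0"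
    and D: "\<And>p. p \<in> unit_square \<Longrightarrow> off_mesh dg m p \<Longrightarrow> GDERIV F p :> D p"
    and b: "sq_bounded (\<lambda>p. fst (D p))" "sq_bounded (\<lambda>p. snd (D p))"
  shows "sq_integral (\<lambda>p. fst (D p)) = 0" "sq_integral (\<lambda>p. snd (D p)) = 0"
proof -
  let ?H = "real (m + 1)" and ?\<sigma> = "orient dg"
  have H: "0 < ?H" by simp
  have \<sigma>: "?\<sigma> = 1 \<or> ?\<sigma> = -1" by (rule orient_cases)
  have neg: "- x \<in> \<int> \<longleftrightarrow> x \<in> \<int>" for x :: real by (metis Ints_minus minus_minus)
  show "sq_integral (\<lambda>p. fst (D p)) = 0"
  proof (rule partial_integral_zero[OF b(1), of F])
    fix y :: real assume y: "y \<in> {0<..<1}"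
    have "(\<lambda>x. (x, y)) ` {0..1} \<subseteq> closure unit_square" using y by (auto simp: closure_unit_square)
    then show "continuous_on {0..1} (\<lambda>x. F (x, y))"
      by (intro continuous_on_compose2[OF cont] continuous_intros) auto
    show "F (0, y) = F (1, y)" using zero by (simp add: unit_square_def)
  next
    show "AE y in lborel. y \<in> {0<..<1} \<longrightarrow> (\<exists>Z. finite Z \<and>
      (\<forall>x\<in>{0<..<1} - Z. ((\<lambda>x. F (x, y)) has_real_derivative fst (D (x, y))) (at x)))"
      using AE_not_lattice[OF H]
    proof (eventually_elim, intro impI)
      fix y assume y: "?H * y \<notin> \<int>" "y \<in> {0<..<1}"
      let ?Z = "{x. 0 < x \<and> x < 1 \<and> ?H * x - 0 \<in> \<int>} \<union> {x. 0 < x \<and> x < 1 \<and> ?H * x - ?\<sigma> * (?H * y) \<in> \<int>}"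
      have "finite ?Z" using finite_lattice_points[OF H] by blast
      moreover have "((\<lambda>x. F (x, y)) has_real_derivative fst (D (x, y))) (at x)" if "x \<in> {0<..<1} - ?Z" for x
        using that y by (intro GDERIV_partial(1) D) (auto simp: unit_square_def off_mesh_def)
      ultimately show "\<exists>Z. finite Z \<and> (\<forall>x\<in>{0<..<1} - Z. ((\<lambda>x. F (x, y)) has_real_derivative fst (D (x, y))) (at x))"
        by blast
    qed
  qed
  have "sq_integral (\<lambda>p. snd (D (snd p, fst p))) = 0"
  proof (rule partial_integral_zero[OF sq_integral_swap(1)[OF b(2)], of "\<lambda>p. F (snd p, fst p)"])
    fix y :: real assume y: "y \<in> {0<..<1}"
    have "(\<lambda>x. (y, x)) ` {0..1} \<subseteq> closure unit_square" using y by (auto simp: closure_unit_square)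
    then show "continuous_on {0..1} (\<lambda>x. F (snd (x, y), fst (x, y)))"
      unfolding fst_conv snd_conv by (intro continuous_on_compose2[OF cont] continuous_intros) auto
    show "F (snd (0, y), fst (0, y)) = F (snd (1, y), fst (1, y))" using zero by (simp add: unit_square_def)
  next
    show "AE y in lborel. y \<in> {0<..<1} \<longrightarrow> (\<exists>Z. finite Z \<and>
      (\<forall>x\<in>{0<..<1} - Z. ((\<lambda>x. F (snd (x, y), fst (x, y))) has_real_derivative snd (D (snd (x, y), fst (x, y)))) (at x)))"
      using AE_not_lattice[OF H]
    proof (eventually_elim, intro impI)
      fix y assume y: "?H * y \<notin> \<int>" "y \<in> {0<..<1}"
      let ?Z = "{x. 0 < x \<and> x < 1 \<and> ?H * x - 0 \<in> \<int>} \<union> {x. 0 < x \<and> x < 1 \<and> ?H * x - ?\<sigma> * (?H * y) \<in> \<int>}"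
      have fin: "finite ?Z" using finite_lattice_points[OF H] by blast
      have deriv: "((\<lambda>x. F (y, x)) has_real_derivative snd (D (y, x))) (at x)" if x: "x \<in> {0<..<1} - ?Z" for x
      proof (intro GDERIV_partial(2) D)
        show "(y, x) \<in> unit_square" using x y by (simp add: unit_square_def)
        have "?H * y - ?\<sigma> * (?H * x) \<notin> \<int>"
          using \<sigma>
        proof
          assume s: "?\<sigma> = 1"
          then have "- (?H * y - ?\<sigma> * (?H * x)) = ?H * x - ?\<sigma> * (?H * y)" by simp
          then show ?thesis using x neg by (metis (no_types, lifting) DiffE UnI2 greaterThanLessThan_iff mem_Collect_eq)
        next
          assume s: "?\<sigma> = -1"
          then have "?H * y - ?\<sigma> * (?H * x) = ?H * x - ?\<sigma> * (?H * y)" by simp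
          then show ?thesis using x by (metis (no_types, lifting) DiffE UnI2 greaterThanLessThan_iff mem_Collect_eq)
        qed
        then show "off_mesh dg m (y, x)" using x y unfolding off_mesh_def by auto
      qed
      show "\<exists>Z. finite Z \<and> (\<forall>x\<in>{0<..<1} - Z. ((\<lambda>x. F (snd (x, y), fst (x, y))) has_real_derivative snd (D (snd (x, y), fst (x, y)))) (at x))"
        unfolding fst_conv snd_conv using fin deriv by blast
    qed
  qed
  then show "sq_integral (\<lambda>p. snd (D p)) = 0" using sq_integral_swap(2)[OF b(2)] by simp
qed

section \<open>The convection matrix\<close>

lemma hat_fn_continuous: "continuous_on A (hat_fn dg m k)"
  unfolding hat_fn_def[abs_def] hat_def by (intro continuous_intros) auto

lemma hat_fn_bounded: "sq_bounded (hat_fn dg m k)"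
  by (intro sq_bounded_continuous hat_fn_continuous)

lemma hat_fn_support:
  assumes "hat_fn dg m k p \<noteq> 0"
  shows "\<bar>real (m + 1) * fst p - real (ix m k)\<bar> < 1" "\<bar>real (m + 1) * snd p - real (iy m k)\<bar> < 1"
  using assms hat_far[OF orient_cases] unfolding hat_fn_def by (meson not_le)+

lemma hat_fn_range: "0 \<le> hat_fn dg m k p" "hat_fn dg m k p \<le> 1"
  unfolding hat_fn_def by (rule hat_nonneg, rule hat_le_1)

lemma hat_fn_outside:
  assumes k: "k < m^2" and p: "p \<notin> unit_square"
  shows "hat_fn dg m k p = 0"
proof (rule ccontr)
  assume nz: "hat_fn dg m k p \<noteq> 0"
  let ?H = "real (m + 1)"
  have "1 \<le> real (ix m k)" "real (ix m k) + 1 \<le> ?H" "1 \<le> real (iy m k)" "real (iy m k) + 1 \<le> ?H"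
    using grid_index_less[OF k] by linarith+
  moreover have strip: "0 < x \<and> x < ?H * 1" if "\<bar>x - c\<bar> < 1" "1 \<le> c" "c + 1 \<le> ?H" for x c :: real
    using that by (simp add: abs_less_iff)
  ultimately have "0 < ?H * fst p" "?H * fst p < ?H * 1" "0 < ?H * snd p" "?H * snd p < ?H * 1"
    using strip[OF hat_fn_support(1)[OF nz]] strip[OF hat_fn_support(2)[OF nz]] by blast+
  moreover have "0 < ?H" by simp
  ultimately have "0 < fst p" "fst p < 1" "0 < snd p" "snd p < 1"
    by (simp_all only: zero_less_mult_pos mult_less_cancel_left_pos)
  then show False using p by (simp add: unit_square_def mem_Times_iff)
qed

text \<open>
  The function is at most $1$ and its support lies in a square of side $2/(m+1)$.
\<close>

lemma hat_fn_integral: "sq_integral (hat_fn dg m k) \<le> 4 / (real (m + 1))^2"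
proof -
  let ?H = "real (m + 1)" and ?z = "internal_node m k"
  define X where "X = cbox (fst ?z - 1 / ?H, snd ?z - 1 / ?H) (fst ?z + 1 / ?H, snd ?z + 1 / ?H)"
  have H: "0 < ?H" by simp
  have in_X: "p \<in> X" if nz: "hat_fn dg m k p \<noteq> 0" for p
  proof -
    have strip: "c / ?H - 1 / ?H \<le> x" "x \<le> c / ?H + 1 / ?H" if "\<bar>?H * x - c\<bar> < 1" for x c
    proof -
      have "c - 1 \<le> x * ?H" "x * ?H \<le> c + 1" using that by (simp_all add: abs_less_iff mult.commute)
      then have "(c - 1) / ?H \<le> x" "x \<le> (c + 1) / ?H" by (simp_all only: divide_le_eq le_divide_eq H if_True)
      then show "c / ?H - 1 / ?H \<le> x" "x \<le> c / ?H + 1 / ?H" by (simp_all only: diff_divide_distrib add_divide_distrib)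
    qed
    show ?thesis
      using strip[OF hat_fn_support(1)[OF nz]] strip[OF hat_fn_support(2)[OF nz]]
      unfolding X_def internal_node_simps by (cases p) (simp add: cbox_Pair_eq)
  qed
  have X: "X \<in> sets lborel" unfolding X_def by simp
  have "sq_integral (hat_fn dg m k) = (\<integral>p. indicator unit_square p * hat_fn dg m k p \<partial>lborel)"
    by (rule sq_integral_lborel[OF hat_fn_bounded])
  also have "\<dots> \<le> (\<integral>p. indicator X p \<partial>lborel)"
  proof (rule integral_mono)
    show "integrable lborel (\<lambda>p. indicator unit_square p * hat_fn dg m k p)"
      using sq_bounded_integrable(1)[OF hat_fn_bounded[of dg m k]] unfolding set_integrable_def by simp
    show "integrable lborel (indicator X :: _ \<Rightarrow> real)"
      using emeasure_bounded_finite[OF bounded_cbox] unfolding X_def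
      by (intro integrable_real_indicator) (simp_all add: infinity_ennreal_def)
    fix p show "indicator unit_square p * hat_fn dg m k p \<le> indicator X p"
      using in_X[of p] hat_fn_range[of dg m k p] by (cases "hat_fn dg m k p = 0") (auto simp: indicator_def)
  qed
  also have "\<dots> = measure lborel X" using X by simp
  also have "\<dots> = (2 / ?H) * (2 / ?H)"
    unfolding X_def using H by (simp add: content_Pair)
  finally show ?thesis by (simp add: power2_eq_square)
qed

lemma divergence_eq:
  fixes \<beta> :: "real \<times> real \<Rightarrow> real \<times> real"
  assumes G: "GDERIV (\<lambda>p. \<beta> p \<bullet> (1, 0)) x :> G1" "GDERIV (\<lambda>p. \<beta> p \<bullet> (0, 1)) x :> G2"
  shows "divergence \<beta> x = fst G1 + snd G2"
proof -
  have Basis: "(Basis :: (real \<times> real) set) = {(1, 0), (0, 1)}" by (auto simp: Basis_prod_def)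
  show ?thesis unfolding divergence_def Basis
    using gradient_eqI[OF G(1)] gradient_eqI[OF G(2)] by (simp add: inner_prod_def)
qed

text \<open>
  The integral over the square of the gradient of the product of the three functions vanishes, because nodal functions are zero
  on the boundary.
\<close>

lemma hat_product_by_parts:
  assumes k: "k < m^2" and l: "l < m^2" and u: "continuous_on (closure unit_square) u"
    and G: "\<And>p. p \<in> unit_square \<Longrightarrow> GDERIV u p :> G p"
    and b: "sq_bounded (\<lambda>p. fst (G p))" "sq_bounded (\<lambda>p. snd (G p))"
  shows "sq_integral (\<lambda>p. u p * (grad_x dg m k p * hat_fn dg m l p)) + sq_integral (\<lambda>p. u p * (grad_x dg m l p * hat_fn dg m k p))
      = - sq_integral (\<lambda>p. fst (G p) * (hat_fn dg m k p * hat_fn dg m l p))"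
    "sq_integral (\<lambda>p. u p * (grad_y dg m k p * hat_fn dg m l p)) + sq_integral (\<lambda>p. u p * (grad_y dg m l p * hat_fn dg m k p))
      = - sq_integral (\<lambda>p. snd (G p) * (hat_fn dg m k p * hat_fn dg m l p))"
proof -
  let ?\<phi> = "hat_fn dg m"
  define F where "F p = u p * (?\<phi> k p * ?\<phi> l p)" for p
  define D where "D p = u p *\<^sub>R (?\<phi> k p *\<^sub>R (grad_x dg m l p, grad_y dg m l p) + ?\<phi> l p *\<^sub>R (grad_x dg m k p, grad_y dg m k p))
    + (?\<phi> k p * ?\<phi> l p) *\<^sub>R G p" for p
  have D: "GDERIV F p :> D p" if "p \<in> unit_square" "off_mesh dg m p" for p
    unfolding F_def D_def by (intro GDERIV_mult hat_fn_GDERIV G that)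
  have fstD: "fst (D p) = (u p * (grad_x dg m k p * ?\<phi> l p) + u p * (grad_x dg m l p * ?\<phi> k p)) + fst (G p) * (?\<phi> k p * ?\<phi> l p)"
    and sndD: "snd (D p) = (u p * (grad_y dg m k p * ?\<phi> l p) + u p * (grad_y dg m l p * ?\<phi> k p)) + snd (G p) * (?\<phi> k p * ?\<phi> l p)" for p
    by (simp_all add: D_def algebra_simps)
  note bs = sq_bounded_add sq_bounded_mult sq_bounded_continuous[OF u] grad_bounded hat_fn_bounded b
  have bD: "sq_bounded (\<lambda>p. fst (D p))" "sq_bounded (\<lambda>p. snd (D p))"
    unfolding fstD sndD by (intro bs)+
  have contF: "continuous_on (closure unit_square) F"
    unfolding F_def[abs_def] by (intro continuous_intros u hat_fn_continuous)
  have zeroF: "F p = 0" if "p \<notin> unit_square" for p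
    using hat_fn_outside[OF k that] by (simp add: F_def)
  have "sq_integral (\<lambda>p. fst (D p)) = 0" "sq_integral (\<lambda>p. snd (D p)) = 0"
    by (rule gradient_integral_zero[OF contF zeroF D bD]; assumption)+
  moreover have "sq_integral (\<lambda>p. fst (D p)) = (sq_integral (\<lambda>p. u p * (grad_x dg m k p * ?\<phi> l p))
      + sq_integral (\<lambda>p. u p * (grad_x dg m l p * ?\<phi> k p))) + sq_integral (\<lambda>p. fst (G p) * (?\<phi> k p * ?\<phi> l p))"
    unfolding fstD by (subst sq_integral_add sq_integral_add, (intro bs)+)+ simp
  moreover have "sq_integral (\<lambda>p. snd (D p)) = (sq_integral (\<lambda>p. u p * (grad_y dg m k p * ?\<phi> l p))
      + sq_integral (\<lambda>p. u p * (grad_y dg m l p * ?\<phi> k p))) + sq_integral (\<lambda>p. snd (G p) * (?\<phi> k p * ?\<phi> l p))"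
    unfolding sndD by (subst sq_integral_add sq_integral_add, (intro bs)+)+ simp
  ultimately show "sq_integral (\<lambda>p. u p * (grad_x dg m k p * ?\<phi> l p)) + sq_integral (\<lambda>p. u p * (grad_x dg m l p * ?\<phi> k p))
      = - sq_integral (\<lambda>p. fst (G p) * (?\<phi> k p * ?\<phi> l p))"
    "sq_integral (\<lambda>p. u p * (grad_y dg m k p * ?\<phi> l p)) + sq_integral (\<lambda>p. u p * (grad_y dg m l p * ?\<phi> k p))
      = - sq_integral (\<lambda>p. snd (G p) * (?\<phi> k p * ?\<phi> l p))" by linarith+
qed

lemma Psi_entry:
  assumes k: "k < m^2" and l: "l < m^2"
    and \<beta>: "sq_bounded (\<lambda>p. fst (\<beta> p))" "sq_bounded (\<lambda>p. snd (\<beta> p))"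
  shows "Psi_mat dg m \<beta> $$ (k, l) = - (sq_integral (\<lambda>p. fst (\<beta> p) * (grad_x dg m k p * hat_fn dg m l p))
    + sq_integral (\<lambda>p. snd (\<beta> p) * (grad_y dg m k p * hat_fn dg m l p)))"
proof -
  note bs = sq_bounded_add sq_bounded_mult \<beta> grad_bounded hat_fn_bounded
  have "Psi_mat dg m \<beta> $$ (k, l) =
      - sq_integral (\<lambda>p. (gradient (nodal_basis dg m k) p \<bullet> \<beta> p) * nodal_basis dg m l p)"
    using k l by (simp add: Psi_mat_def)
  also have "sq_integral (\<lambda>p. (gradient (nodal_basis dg m k) p \<bullet> \<beta> p) * nodal_basis dg m l p) =
      sq_integral (\<lambda>p. fst (\<beta> p) * (grad_x dg m k p * hat_fn dg m l p) + snd (\<beta> p) * (grad_y dg m k p * hat_fn dg m l p))"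
  proof (rule sq_integral_cong_AE)
    show "sq_bounded (\<lambda>p. fst (\<beta> p) * (grad_x dg m k p * hat_fn dg m l p) + snd (\<beta> p) * (grad_y dg m k p * hat_fn dg m l p))"
      by (intro bs)
    show "AE p in lebesgue. p \<in> unit_square \<longrightarrow> gradient (nodal_basis dg m k) p \<bullet> \<beta> p * nodal_basis dg m l p =
        fst (\<beta> p) * (grad_x dg m k p * hat_fn dg m l p) + snd (\<beta> p) * (grad_y dg m k p * hat_fn dg m l p)"
      using nodal_gradient_AE[OF k, of dg] by eventually_elim (simp add: nodal_basis_eq[OF l] inner_prod_def algebra_simps)
  qed
  also have "\<dots> = sq_integral (\<lambda>p. fst (\<beta> p) * (grad_x dg m k p * hat_fn dg m l p))
      + sq_integral (\<lambda>p. snd (\<beta> p) * (grad_y dg m k p * hat_fn dg m l p))"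
    by (rule sq_integral_add) (intro bs)+
  finally show ?thesis .
qed

text \<open>
  The symmetric sum is $-\int \beta \cdot \nabla(\varphi_k \varphi_l)$, and integration by parts moves the derivative to
  $\beta$. The function \<open>q\<close> is the divergence inside the square, in a form that is visibly bounded and measurable.
\<close>

lemma Psi_symmetric_part:
  assumes \<beta>: "\<forall>b\<in>Basis. C_closure 1 unit_square (\<lambda>x. \<beta> x \<bullet> b)"
  shows "\<exists>q. sq_bounded q \<and> (\<forall>p\<in>unit_square. q p = divergence \<beta> p) \<and>
    (\<forall>dg m k l. k < m^2 \<longrightarrow> l < m^2 \<longrightarrow> Psi_mat dg m \<beta> $$ (k, l) + Psi_mat dg m \<beta> $$ (l, k) =
      sq_integral (\<lambda>p. q p * (hat_fn dg m k p * hat_fn dg m l p)))"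
proof -
  have in_Basis: "(1, 0) \<in> (Basis :: (real \<times> real) set)" "(0, 1) \<in> (Basis :: (real \<times> real) set)"
    by (simp_all add: Basis_prod_def)
  have C1: "\<exists>G. (\<forall>x\<in>unit_square. GDERIV u x :> G x) \<and> sq_bounded (\<lambda>p. fst (G p)) \<and> sq_bounded (\<lambda>p. snd (G p))"
    and C0: "continuous_on (closure unit_square) u"
    if "C_closure 1 unit_square u" for u
  proof -
    from that have "C_closure (Suc 0) unit_square u" by simp
    then obtain G where "\<forall>x\<in>unit_square. GDERIV u x :> G x"
      and "\<forall>b\<in>Basis. continuous_on (closure unit_square) (\<lambda>x. G x \<bullet> b)"
      and c: "continuous_on (closure unit_square) u" by auto
    moreover from this(2) in_Basis have "sq_bounded (\<lambda>p. G p \<bullet> (1, 0))" "sq_bounded (\<lambda>p. G p \<bullet> (0, 1))"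
      by (blast intro: sq_bounded_continuous)+
    then have "sq_bounded (\<lambda>p. fst (G p))" "sq_bounded (\<lambda>p. snd (G p))" by (simp_all add: inner_prod_def)
    ultimately show "\<exists>G. (\<forall>x\<in>unit_square. GDERIV u x :> G x) \<and> sq_bounded (\<lambda>p. fst (G p)) \<and> sq_bounded (\<lambda>p. snd (G p))"
      by blast
    show "continuous_on (closure unit_square) u" by (rule c)
  qed
  have c1: "C_closure 1 unit_square (\<lambda>p. \<beta> p \<bullet> (1, 0))" and c2: "C_closure 1 unit_square (\<lambda>p. \<beta> p \<bullet> (0, 1))"
    using \<beta> in_Basis by blast+
  have fs: "(\<lambda>p. \<beta> p \<bullet> (1, 0)) = (\<lambda>p. fst (\<beta> p))" "(\<lambda>p. \<beta> p \<bullet> (0, 1)) = (\<lambda>p. snd (\<beta> p))"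
    by (simp_all add: inner_prod_def)
  obtain G1 where G1: "\<And>x. x \<in> unit_square \<Longrightarrow> GDERIV (\<lambda>p. \<beta> p \<bullet> (1, 0)) x :> G1 x"
    and b1: "sq_bounded (\<lambda>p. fst (G1 p))" "sq_bounded (\<lambda>p. snd (G1 p))" using C1[OF c1] by blast
  obtain G2 where G2: "\<And>x. x \<in> unit_square \<Longrightarrow> GDERIV (\<lambda>p. \<beta> p \<bullet> (0, 1)) x :> G2 x"
    and b2: "sq_bounded (\<lambda>p. fst (G2 p))" "sq_bounded (\<lambda>p. snd (G2 p))" using C1[OF c2] by blast
  have cont: "continuous_on (closure unit_square) (\<lambda>p. fst (\<beta> p))" "continuous_on (closure unit_square) (\<lambda>p. snd (\<beta> p))"
    using C0[OF c1] C0[OF c2] unfolding fs .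
  show ?thesis
  proof (intro exI[of _ "\<lambda>p. fst (G1 p) + snd (G2 p)"] conjI ballI allI impI)
    show "sq_bounded (\<lambda>p. fst (G1 p) + snd (G2 p))" by (intro sq_bounded_add b1 b2)
  next
    fix p assume p: "p \<in> unit_square"
    show "fst (G1 p) + snd (G2 p) = divergence \<beta> p"
      using divergence_eq[OF G1[OF p] G2[OF p]] by simp
  next
    fix dg and m k l :: nat assume k: "k < m^2" and l: "l < m^2"
    let ?\<phi> = "hat_fn dg m"
    have "sq_integral (\<lambda>p. (fst (G1 p) + snd (G2 p)) * (?\<phi> k p * ?\<phi> l p)) =
        sq_integral (\<lambda>p. fst (G1 p) * (?\<phi> k p * ?\<phi> l p)) + sq_integral (\<lambda>p. snd (G2 p) * (?\<phi> k p * ?\<phi> l p))"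
      unfolding distrib_right by (intro sq_integral_add sq_bounded_mult b1 b2 hat_fn_bounded)
    then show "Psi_mat dg m \<beta> $$ (k, l) + Psi_mat dg m \<beta> $$ (l, k) =
        sq_integral (\<lambda>p. (fst (G1 p) + snd (G2 p)) * (?\<phi> k p * ?\<phi> l p))"
      using Psi_entry[OF k l sq_bounded_continuous[OF cont(1)] sq_bounded_continuous[OF cont(2)], of dg]
        Psi_entry[OF l k sq_bounded_continuous[OF cont(1)] sq_bounded_continuous[OF cont(2)], of dg]
        hat_product_by_parts(1)[OF k l cont(1) _ b1, of dg] hat_product_by_parts(2)[OF k l cont(2) _ b2, of dg]
        G1 G2 unfolding fs by simp
  qed
qed

section \<open>The preconditioner and the Hermitian part agree up to order $h^2$\<close>

lemma unit_square_convex_bounded: "convex unit_square" "bounded unit_square"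
proof -
  show "convex unit_square" unfolding unit_square_def by (intro convex_Times) auto
  show "bounded unit_square" unfolding unit_square_def by (intro bounded_Times) auto
qed

lemma near_norm: "near m r p q \<Longrightarrow> norm (p - q) \<le> 2 * r / real (m + 1)"
proof -
  assume "near m r p q"
  then have "\<bar>fst (p - q)\<bar> + \<bar>snd (p - q)\<bar> \<le> r / real (m + 1) + r / real (m + 1)"
    unfolding near_def fst_diff snd_diff by (intro add_mono) auto
  moreover have "norm (p - q) \<le> \<bar>fst (p - q)\<bar> + \<bar>snd (p - q)\<bar>"
    using sqrt_sum_squares_le_sum_abs[of "fst (p - q)" "snd (p - q)"] by (simp add: norm_prod_def)
  ultimately show ?thesis by simp
qed

lemma near_trans: "near m r p q \<Longrightarrow> near m s q w \<Longrightarrow> near m (r + s) p w"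
  unfolding near_def add_divide_distrib by linarith

text \<open>
  In each coordinate a point of the parallelogram is within one mesh width of the midpoint, and the midpoint within one mesh
  width of \<open>c\<close>; hence the point is at distance at most $4h$ from \<open>c\<close>. The constant $16$ is the square of $4$.
\<close>

lemma edge_weight_taylor:
  assumes e: "edge_density m z e" and a: "sq_bounded a" and c: "c \<in> unit_square" and z: "near m 1 z c"
    and L: "0 \<le> L" and T: "\<And>x. x \<in> unit_square \<Longrightarrow> \<bar>a x - a c - g \<bullet> (x - c)\<bar> \<le> L * (norm (x - c))^2"
  shows "\<bar>edge_weight a m e - (a c + g \<bullet> (z - c))\<bar> \<le> 16 * L / (real (m + 1))^2"
proof (rule edge_weight_approx[OF e a])
  fix p assume nz: "e p \<noteq> 0"
  have "near m 1 p z" using edge_densityD(5,6)[OF e nz] unfolding near_def by simp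
  from near_norm[OF near_trans[OF this z]] have "norm (p - c) \<le> 4 / real (m + 1)" by simp
  then have "(norm (p - c))^2 \<le> (4 / real (m + 1))^2" by (rule power_mono) simp
  from mult_left_mono[OF this L] have "L * (norm (p - c))^2 \<le> 16 * L / (real (m + 1))^2"
    unfolding power_divide by (simp add: mult.commute)
  moreover have "a p - (a c + g \<bullet> (z - c)) - g \<bullet> (p - z) = a p - a c - g \<bullet> (p - c)"
    by (simp add: inner_diff_right)
  ultimately show "\<bar>a p - (a c + g \<bullet> (z - c)) - g \<bullet> (p - z)\<bar> \<le> 16 * L / (real (m + 1))^2"
    using T[OF edge_densityD(4)[OF e nz]] by linarith
qed

lemma average4_error:
  fixes E :: real
  assumes "\<bar>w1 - t1\<bar> \<le> E" "\<bar>w2 - t2\<bar> \<le> E" "\<bar>w3 - t3\<bar> \<le> E" "\<bar>w4 - t4\<bar> \<le> E"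
    and "t1 + t2 + t3 + t4 = 4 * t"
  shows "\<bar>(w1 + w2 + w3 + w4) / 4 - t\<bar> \<le> E"
  using assms by (auto simp: abs_le_iff field_simps)

text \<open>
  One quarter of the diagonal entry is the diagonal entry of $D_n(a)$.
\<close>

lemma Theta_diag_taylor:
  assumes k: "k < m^2" and a: "sq_bounded a" and c: "c \<in> unit_square" and z: "near m (1/2) (internal_node m k) c"
    and L: "0 \<le> L" and T: "\<And>x. x \<in> unit_square \<Longrightarrow> \<bar>a x - a c - g \<bullet> (x - c)\<bar> \<le> L * (norm (x - c))^2"
  shows "\<bar>Theta_mat dg m a $$ (k, k) / 4 - (a c + g \<bullet> (internal_node m k - c))\<bar> \<le> 16 * L / (real (m + 1))^2"
proof -
  obtain e1 e2 e3 e4 z1 z2 z3 z4 where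
    e: "edge_density m z1 e1" "edge_density m z2 e2" "edge_density m z3 e3" "edge_density m z4 e4"
    and n: "near m (1/2) z1 (internal_node m k)" "near m (1/2) z2 (internal_node m k)"
    "near m (1/2) z3 (internal_node m k)" "near m (1/2) z4 (internal_node m k)"
    and s: "z1 + z2 + z3 + z4 = 4 *\<^sub>R internal_node m k"
    and t: "Theta_mat dg m a $$ (k, k) = edge_weight a m e1 + edge_weight a m e2 + edge_weight a m e3 + edge_weight a m e4"
    by (rule Theta_diag[OF k a, of dg])
  have n': "near m 1 z1 c" "near m 1 z2 c" "near m 1 z3 c" "near m 1 z4 c"
    using near_trans[OF n(1) z] near_trans[OF n(2) z] near_trans[OF n(3) z] near_trans[OF n(4) z] by simp_all
  have "\<bar>edge_weight a m e - (a c + g \<bullet> (z - c))\<bar> \<le> 16 * L / (real (m + 1))^2"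
    if "edge_density m z e" "near m 1 z c" for e z
    by (rule edge_weight_taylor[OF that(1) a c that(2) L T])
  note w = this[OF e(1) n'(1)] this[OF e(2) n'(2)] this[OF e(3) n'(3)] this[OF e(4) n'(4)]
  have "g \<bullet> z1 + g \<bullet> z2 + g \<bullet> z3 + g \<bullet> z4 = 4 * (g \<bullet> internal_node m k)"
    using arg_cong[OF s, of "\<lambda>v. g \<bullet> v"] by (simp add: inner_add_right)
  then have "g \<bullet> (z1 - c) + g \<bullet> (z2 - c) + g \<bullet> (z3 - c) + g \<bullet> (z4 - c) = 4 * (g \<bullet> (internal_node m k - c))"
    by (simp add: inner_diff_right)
  then show ?thesis using average4_error[OF w, of "a c + g \<bullet> (internal_node m k - c)"] unfolding t by simp
qed

lemma Theta_diag_bounds: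
  assumes k: "k < m^2" and a: "sq_bounded a" and bd: "\<And>p. p \<in> unit_square \<Longrightarrow> lo \<le> a p \<and> a p \<le> hi"
  shows "lo \<le> Theta_mat dg m a $$ (k, k) / 4" "Theta_mat dg m a $$ (k, k) / 4 \<le> hi"
proof -
  obtain e1 e2 e3 e4 z1 z2 z3 z4 where
    e: "edge_density m z1 e1" "edge_density m z2 e2" "edge_density m z3 e3" "edge_density m z4 e4"
    and t: "Theta_mat dg m a $$ (k, k) = edge_weight a m e1 + edge_weight a m e2 + edge_weight a m e3 + edge_weight a m e4"
    by (rule Theta_diag[OF k a, of dg])
  have "lo \<le> edge_weight a m e" "edge_weight a m e \<le> hi" if "edge_density m z e" for e z
    by (rule edge_weight_bounds[OF that a bd]; assumption)+
  note w = this[OF e(1)] this[OF e(2)] this[OF e(3)] this[OF e(4)]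
  show "lo \<le> Theta_mat dg m a $$ (k, k) / 4" unfolding t using w by (simp add: field_simps)
  show "Theta_mat dg m a $$ (k, k) / 4 \<le> hi" unfolding t using w by (simp add: field_simps)
qed

text \<open>
  The identity $d d' - w^2 = (d-w)(d'-w) + w(d+d'-2w)$ shows that first order closeness of $d$ and $d'$ to $w$, together with
  second order closeness of their mean, makes $\sqrt{d d'}$ second order close to $w$.
\<close>

lemma geometric_mean_error:
  fixes w d d' :: real
  assumes "0 < a0" "a0 \<le> w" "w \<le> a1" "a0 \<le> d" "a0 \<le> d'" and h: "0 \<le> h" "h \<le> 1" and B: "0 \<le> B"
    and d: "\<bar>d - w\<bar> \<le> B * h" "\<bar>d' - w\<bar> \<le> B * h" and s: "\<bar>d + d' - 2 * w\<bar> \<le> C * h^2"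
  shows "\<bar>sqrt d * sqrt d' - w\<bar> \<le> (B^2 + a1 * C) / a0 * h^2"
proof -
  have dd: "sqrt d * sqrt d' * (sqrt d * sqrt d') = d * d'"
    using assms by (simp add: algebra_simps)
  have pos: "a0 \<le> sqrt d * sqrt d' + w" using assms by (intro order.trans[OF \<open>a0 \<le> w\<close>]) auto
  have "(sqrt d * sqrt d' - w) * (sqrt d * sqrt d' + w) = d * d' - w^2"
    using dd by (simp add: algebra_simps power2_eq_square)
  also have "\<dots> = (d - w) * (d' - w) + w * (d + d' - 2 * w)"
    by (simp add: algebra_simps power2_eq_square)
  finally have "\<bar>sqrt d * sqrt d' - w\<bar> * \<bar>sqrt d * sqrt d' + w\<bar> = \<bar>(d - w) * (d' - w) + w * (d + d' - 2 * w)\<bar>"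
    by (metis abs_mult)
  also have "\<dots> \<le> \<bar>d - w\<bar> * \<bar>d' - w\<bar> + w * \<bar>d + d' - 2 * w\<bar>"
    using assms abs_triangle_ineq[of "(d - w) * (d' - w)" "w * (d + d' - 2 * w)"] by (simp add: abs_mult)
  also have "\<dots> \<le> (B * h) * (B * h) + a1 * (C * h^2)"
    using assms by (intro add_mono mult_mono) auto
  finally have "\<bar>sqrt d * sqrt d' - w\<bar> * \<bar>sqrt d * sqrt d' + w\<bar> \<le> (B^2 + a1 * C) * h^2"
    by (simp add: power2_eq_square algebra_simps)
  moreover have "\<bar>sqrt d * sqrt d' - w\<bar> * a0 \<le> \<bar>sqrt d * sqrt d' - w\<bar> * \<bar>sqrt d * sqrt d' + w\<bar>"
    using pos by (intro mult_left_mono) auto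
  ultimately have "\<bar>sqrt d * sqrt d' - w\<bar> * a0 \<le> (B^2 + a1 * C) * h^2" by linarith
  then show ?thesis using \<open>0 < a0\<close> by (simp add: field_simps)
qed

text \<open>
  All quantities are expanded about the midpoint of the edge joining the two nodes. The nodes are symmetric about it, so the
  first order terms cancel in the sum of the two diagonal entries.
\<close>

lemma neighbour_error:
  assumes k: "k < m^2" and l: "l < m^2" and nb: "five_point m k l = -1" and a: "sq_bounded a"
    and a0: "0 < a0" and bd: "\<And>p. p \<in> unit_square \<Longrightarrow> a0 \<le> a p \<and> a p \<le> a1"
    and L: "0 \<le> L" and B: "0 \<le> B"
    and T: "\<And>x c. x \<in> unit_square \<Longrightarrow> c \<in> unit_square \<Longrightarrow> \<bar>a x - a c - G c \<bullet> (x - c)\<bar> \<le> L * (norm (x - c))^2"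
    and GB: "\<And>c. c \<in> unit_square \<Longrightarrow> norm (G c) \<le> B"
  shows "\<bar>Theta_mat dg m a $$ (k, l) + sqrt (Theta_mat dg m a $$ (k, k) / 4) * sqrt (Theta_mat dg m a $$ (l, l) / 4)\<bar>
    \<le> ((B + 32 * L)^2 + a1 * (64 * L)) / a0 / (real (m + 1))^2"
proof -
  let ?H = "real (m + 1)"
  obtain e z where e: "edge_density m z e" and nk: "near m (1/2) (internal_node m k) z"
    and nl: "near m (1/2) (internal_node m l) z" and mid: "internal_node m k + internal_node m l = 2 *\<^sub>R z"
    and t: "Theta_mat dg m a $$ (k, l) = - edge_weight a m e" and z: "z \<in> unit_square"
    by (rule Theta_neighbour[OF k l a nb, of dg])
  define d d' w h where "d = Theta_mat dg m a $$ (k, k) / 4" and "d' = Theta_mat dg m a $$ (l, l) / 4"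
    and "w = edge_weight a m e" and "h = 1 / ?H"
  have h: "0 \<le> h" "h \<le> 1" "1 / ?H^2 = h^2" by (auto simp: h_def power_divide)
  have hsq: "h^2 \<le> h" using h(1,2) by (simp add: power2_eq_square mult_left_le)
  have w: "\<bar>w - a z\<bar> \<le> 16 * L * h^2"
  proof -
    have "\<bar>edge_weight a m e - (a z + G z \<bullet> (z - z))\<bar> \<le> 16 * L / ?H^2"
      by (rule edge_weight_taylor[OF e a z _ L T[OF _ z]]) (simp add: near_def)
    then show ?thesis unfolding w_def h(3)[symmetric] by simp
  qed
  have dk: "\<bar>d - (a z + G z \<bullet> (internal_node m k - z))\<bar> \<le> 16 * L * h^2"
  proof -
    have "\<bar>d - (a z + G z \<bullet> (internal_node m k - z))\<bar> \<le> 16 * L / ?H^2"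
      unfolding d_def by (rule Theta_diag_taylor[OF k a z nk L T[OF _ z]])
    then show ?thesis unfolding h(3)[symmetric] by simp
  qed
  have dl: "\<bar>d' - (a z + G z \<bullet> (internal_node m l - z))\<bar> \<le> 16 * L * h^2"
  proof -
    have "\<bar>d' - (a z + G z \<bullet> (internal_node m l - z))\<bar> \<le> 16 * L / ?H^2"
      unfolding d'_def by (rule Theta_diag_taylor[OF l a z nl L T[OF _ z]])
    then show ?thesis unfolding h(3)[symmetric] by simp
  qed
  have slope: "\<bar>G z \<bullet> (p - z)\<bar> \<le> B * h" if "near m (1/2) p z" for p
  proof -
    have "\<bar>G z \<bullet> (p - z)\<bar> \<le> norm (G z) * norm (p - z)" by (rule Cauchy_Schwarz_ineq2)
    also have "\<dots> \<le> B * h" using GB[OF z] near_norm[OF that] B unfolding h_def by (intro mult_mono) auto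
    finally show ?thesis .
  qed
  have "internal_node m k - z = - (internal_node m l - z)"
    using mid by (simp add: algebra_simps scaleR_2)
  then have opp: "G z \<bullet> (internal_node m k - z) = - (G z \<bullet> (internal_node m l - z))"
    by (simp only: inner_minus_right)
  have Lh: "L * h^2 \<le> L * h" using hsq L by (intro mult_left_mono)
  have "\<bar>sqrt d * sqrt d' - w\<bar> \<le> ((B + 32 * L)^2 + a1 * (64 * L)) / a0 * h^2"
  proof (rule geometric_mean_error[OF a0 _ _ _ _ h(1,2)])
    show "a0 \<le> w" "w \<le> a1" unfolding w_def by (rule edge_weight_bounds[OF e a bd]; assumption)+
    show "a0 \<le> d" "a0 \<le> d'" unfolding d_def d'_def
      by (rule Theta_diag_bounds(1)[OF k a bd] Theta_diag_bounds(1)[OF l a bd]; assumption)+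
    show "0 \<le> B + 32 * L" using B L by simp
    have e: "(B + 32 * L) * h = B * h + 32 * (L * h)" by (simp add: algebra_simps)
    have u: "\<bar>w - a z\<bar> \<le> 16 * (L * h^2)" "\<bar>d - (a z + G z \<bullet> (internal_node m k - z))\<bar> \<le> 16 * (L * h^2)"
      "\<bar>d' - (a z + G z \<bullet> (internal_node m l - z))\<bar> \<le> 16 * (L * h^2)" using w dk dl by (simp_all only: mult.assoc)
    show "\<bar>d - w\<bar> \<le> (B + 32 * L) * h" unfolding e using u slope[OF nk] Lh by linarith
    show "\<bar>d' - w\<bar> \<le> (B + 32 * L) * h" unfolding e using u slope[OF nl] Lh by linarith
    have "64 * L * h^2 = 64 * (L * h^2)" by simp
    then show "\<bar>d + d' - 2 * w\<bar> \<le> 64 * L * h^2" using u opp by linarith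
  qed
  then show ?thesis unfolding t d_def d'_def w_def using h(3)
    by (simp only: abs_minus_commute divide_inverse_commute) (simp add: h(3)[symmetric] field_simps abs_minus_commute)
qed

text \<open>
  The three by three block of nodes around a node. A product of two nodal functions vanishes unless one node lies in the
  block of the other.
\<close>

definition block :: "nat \<Rightarrow> nat \<Rightarrow> nat set" where
  "block m k = {l. l < m^2 \<and> k < m^2 \<and> ix m l \<le> Suc (ix m k) \<and> ix m k \<le> Suc (ix m l) \<and>
    iy m l \<le> Suc (iy m k) \<and> iy m k \<le> Suc (iy m l)}"

lemma block_sym: "l \<in> block m k \<longleftrightarrow> k \<in> block m l" by (auto simp: block_def)

lemma block_finite: "finite (block m k)" by (simp add: block_def)

lemma block_card: "card (block m k) \<le> 9"
proof -
  have "inj_on (\<lambda>l. (ix m l, iy m l)) (block m k)"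
    by (rule inj_onI) (auto simp: block_def intro: grid_index_eq)
  moreover have "(\<lambda>l. (ix m l, iy m l)) ` block m k \<subseteq> {ix m k - 1..ix m k + 1} \<times> {iy m k - 1..iy m k + 1}"
    by (auto simp: block_def)
  ultimately have "card (block m k) \<le> card ({ix m k - 1..ix m k + 1} \<times> {iy m k - 1..iy m k + 1})"
    by (intro card_inj_on_le) auto
  also have "\<dots> = 9" by (simp add: card_cartesian_product)
  finally show ?thesis .
qed

lemma five_point_outside_block:
  assumes "k < m^2" "l < m^2" "l \<notin> block m k"
  shows "five_point m k l = 0"
  using assms by (auto simp: block_def five_point_def)

lemma mass_outside_block:
  assumes "k < m^2" "l < m^2" "l \<notin> block m k"
  shows "hat_fn dg m k p * hat_fn dg m l p = 0"
proof (rule ccontr)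
  assume "hat_fn dg m k p * hat_fn dg m l p \<noteq> 0"
  then have "hat_fn dg m k p \<noteq> 0" "hat_fn dg m l p \<noteq> 0" by auto
  from hat_fn_support[OF this(1)] hat_fn_support[OF this(2)]
  have "\<bar>real (ix m k) - real (ix m l)\<bar> < 2" "\<bar>real (iy m k) - real (iy m l)\<bar> < 2" by linarith+
  then have "ix m l \<le> Suc (ix m k)" "ix m k \<le> Suc (ix m l)" "iy m l \<le> Suc (iy m k)" "iy m k \<le> Suc (iy m l)"
    by linarith+
  then show False using assms by (simp add: block_def)
qed

text \<open>
  One of the two nodal functions is estimated by $1$ and the other one is integrated.
\<close>

lemma mass_entry_bound:
  assumes q: "sq_bounded q" and B: "\<And>p. p \<in> unit_square \<Longrightarrow> \<bar>q p\<bar> \<le> B" and B0: "0 \<le> B"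
  shows "\<bar>sq_integral (\<lambda>p. q p * (hat_fn dg m k p * hat_fn dg m l p))\<bar> \<le> 4 * B / (real (m + 1))^2"
proof -
  have "\<bar>sq_integral (\<lambda>p. q p * (hat_fn dg m k p * hat_fn dg m l p))\<bar> \<le> sq_integral (\<lambda>p. B * hat_fn dg m k p)"
  proof (rule sq_integral_abs_bound)
    fix p assume p: "p \<in> unit_square"
    have "hat_fn dg m k p * hat_fn dg m l p \<le> hat_fn dg m k p * 1"
      using hat_fn_range[of dg m k p] hat_fn_range[of dg m l p] by (intro mult_left_mono)
    then show "\<bar>q p * (hat_fn dg m k p * hat_fn dg m l p)\<bar> \<le> B * hat_fn dg m k p"
      unfolding abs_mult using B[OF p] B0 hat_fn_range[of dg m k p] hat_fn_range[of dg m l p]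
      by (intro mult_mono) auto
  qed (intro sq_bounded_mult sq_bounded_cmult q hat_fn_bounded)+
  also have "\<dots> \<le> B * (4 / (real (m + 1))^2)"
    unfolding sq_integral_cmult using hat_fn_integral B0 by (intro mult_left_mono)
  finally show ?thesis by (simp add: mult.commute)
qed

text \<open>
  Expand the square. With a nonnegative weight this makes the form of a weighted Gram matrix nonnegative.
\<close>

lemma bilinear_form_integral:
  fixes x :: "nat \<Rightarrow> real"
  assumes w: "sq_bounded w" and f: "\<And>k. sq_bounded (f k)"
  shows "(\<Sum>k<n. \<Sum>l<n. x k * sq_integral (\<lambda>p. w p * (f k p * f l p)) * x l) =
    sq_integral (\<lambda>p. w p * (\<Sum>k<n. x k * f k p)^2)"
proof -
  have "(\<Sum>k<n. \<Sum>l<n. x k * sq_integral (\<lambda>p. w p * (f k p * f l p)) * x l) =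
      (\<Sum>k<n. \<Sum>l<n. sq_integral (\<lambda>p. (x k * x l) * (w p * (f k p * f l p))))"
    unfolding sq_integral_cmult by (simp only: mult.commute mult.left_commute mult.assoc)
  also have "\<dots> = (\<Sum>k<n. sq_integral (\<lambda>p. \<Sum>l<n. (x k * x l) * (w p * (f k p * f l p))))"
    by (intro sum.cong refl sq_integral_sum[symmetric] sq_bounded_cmult sq_bounded_mult w f) simp_all
  also have "\<dots> = sq_integral (\<lambda>p. \<Sum>k<n. \<Sum>l<n. (x k * x l) * (w p * (f k p * f l p)))"
    by (intro sq_integral_sum[symmetric] sq_bounded_sum sq_bounded_cmult sq_bounded_mult w f) simp_all
  also have "\<dots> = sq_integral (\<lambda>p. w p * (\<Sum>k<n. x k * f k p)^2)"
    by (simp add: power2_eq_square sum_product sum_distrib_left mult.commute mult.left_commute)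
  finally show ?thesis .
qed

lemma sq_integral_nonneg: "sq_bounded f \<Longrightarrow> (\<And>p. p \<in> unit_square \<Longrightarrow> 0 \<le> f p) \<Longrightarrow> 0 \<le> sq_integral f"
  using sq_integral_mono[of "\<lambda>p. 0" f] sq_bounded_const[of 0] by (simp add: set_lebesgue_integral_def)

lemma mass_form_nonneg:
  assumes "sq_bounded q" "\<And>p. p \<in> unit_square \<Longrightarrow> 0 \<le> q p"
  shows "0 \<le> (\<Sum>k<n. \<Sum>l<n. x k * sq_integral (\<lambda>p. q p * (hat_fn dg m k p * hat_fn dg m l p)) * x l)"
  unfolding bilinear_form_integral[OF assms(1) hat_fn_bounded] power2_eq_square
  by (intro sq_integral_nonneg sq_bounded_mult sq_bounded_sum sq_bounded_cmult assms(1) hat_fn_bounded)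
    (simp_all add: assms(2))

text \<open>
  By linearity $\Theta_n(a) - a_0 \Theta_n(1)$ is the stiffness matrix of the nonnegative coefficient $a - a_0$.
\<close>

lemma stiffness_form_lower:
  assumes a: "sq_bounded a" and a0: "\<And>p. p \<in> unit_square \<Longrightarrow> a0 \<le> a p"
  shows "a0 * (\<Sum>k<m^2. \<Sum>l<m^2. x k * five_point m k l * x l)
    \<le> (\<Sum>k<m^2. \<Sum>l<m^2. x k * Theta_mat dg m a $$ (k, l) * x l)"
proof -
  let ?w = "\<lambda>p. a p - a0"
  note b = sq_bounded_diff[OF a sq_bounded_const[of a0]]
  note bs = sq_bounded_mult grad_bounded a sq_bounded_const b
  have split: "Theta_mat dg m a $$ (k, l) - a0 * five_point m k l =
      sq_integral (\<lambda>p. ?w p * (grad_x dg m k p * grad_x dg m l p)) + sq_integral (\<lambda>p. ?w p * (grad_y dg m k p * grad_y dg m l p))"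
    if "k < m^2" "l < m^2" for k l
  proof -
    have "a0 * five_point m k l = a0 * Theta_mat dg m (\<lambda>p. 1) $$ (k, l)" using Theta_one[OF that] by simp
    also have "\<dots> = sq_integral (\<lambda>p. a0 * (1 * (grad_x dg m k p * grad_x dg m l p) + 1 * (grad_y dg m k p * grad_y dg m l p)))"
      unfolding Theta_entry_integral[OF that sq_bounded_const] sq_integral_cmult ..
    finally have "Theta_mat dg m a $$ (k, l) - a0 * five_point m k l =
       sq_integral (\<lambda>p. (a p * (grad_x dg m k p * grad_x dg m l p) + a p * (grad_y dg m k p * grad_y dg m l p))
        - a0 * (1 * (grad_x dg m k p * grad_x dg m l p) + 1 * (grad_y dg m k p * grad_y dg m l p)))"
      unfolding Theta_entry_integral[OF that a]
      by (subst sq_integral_diff) (intro sq_bounded_add bs | simp)+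
    also have "\<dots> = sq_integral (\<lambda>p. ?w p * (grad_x dg m k p * grad_x dg m l p) + ?w p * (grad_y dg m k p * grad_y dg m l p))"
      by (simp add: algebra_simps)
    also have "\<dots> = sq_integral (\<lambda>p. ?w p * (grad_x dg m k p * grad_x dg m l p)) + sq_integral (\<lambda>p. ?w p * (grad_y dg m k p * grad_y dg m l p))"
      by (intro sq_integral_add bs)
    finally show ?thesis .
  qed
  have "(\<Sum>k<m^2. \<Sum>l<m^2. x k * Theta_mat dg m a $$ (k, l) * x l) - a0 * (\<Sum>k<m^2. \<Sum>l<m^2. x k * five_point m k l * x l)
      = (\<Sum>k<m^2. \<Sum>l<m^2. x k * (Theta_mat dg m a $$ (k, l) - a0 * five_point m k l) * x l)"
    by (simp add: sum_subtractf sum_distrib_left algebra_simps)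
  also have "\<dots> = (\<Sum>k<m^2. \<Sum>l<m^2. x k * sq_integral (\<lambda>p. ?w p * (grad_x dg m k p * grad_x dg m l p)) * x l) +
      (\<Sum>k<m^2. \<Sum>l<m^2. x k * sq_integral (\<lambda>p. ?w p * (grad_y dg m k p * grad_y dg m l p)) * x l)"
    by (simp add: split distrib_left distrib_right sum.distrib)
  also have "0 \<le> \<dots>"
    unfolding bilinear_form_integral[OF b grad_bounded(1)] bilinear_form_integral[OF b grad_bounded(2)] power2_eq_square
    by (intro add_nonneg_nonneg sq_integral_nonneg sq_bounded_mult sq_bounded_sum sq_bounded_cmult b grad_bounded)
      (simp_all add: a0)
  finally show ?thesis by simp
qed

section \<open>Clustering and spectral bounds\<close>

lemma A_mat_zero: "A_mat dg m a (\<lambda>x. 0) = Theta_mat dg m a"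
proof -
  have "Psi_mat dg m (\<lambda>x. 0) = 0\<^sub>m (m^2) (m^2)"
    by (rule eq_matI) (simp_all add: Psi_mat_def set_lebesgue_integral_def)
  then show ?thesis unfolding A_mat_def by (simp add: Theta_mat_def)
qed

lemma inv_mat_unique:
  fixes B C :: "real mat"
  assumes B: "B \<in> carrier_mat n n" and C: "C \<in> carrier_mat n n" and CB: "C * B = 1\<^sub>m n" and BC: "B * C = 1\<^sub>m n"
  shows "inv_mat B = C"
proof -
  have "v = 0\<^sub>v n" if v: "v \<in> carrier_vec n" and 0: "B *\<^sub>v v = 0\<^sub>v n" for v
  proof -
    have "v = (C * B) *\<^sub>v v" using v CB by simp
    also have "\<dots> = C *\<^sub>v (B *\<^sub>v v)" by (rule assoc_mult_mat_vec[OF C B v])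
    also have "\<dots> = 0\<^sub>v n" unfolding 0 using C by auto
    finally show ?thesis .
  qed
  note inv = inv_mat_inverts[OF B this]
  have "inv_mat B = inv_mat B * (B * C)" using inv BC by simp
  also have "\<dots> = (inv_mat B * B) * C" by (rule assoc_mult_mat[OF inv(1) B C, symmetric])
  also have "\<dots> = C" using inv C by simp
  finally show ?thesis .
qed

lemma Theta_dim: "dim_row (Theta_mat dg m a) = m^2"
  by (simp add: Theta_mat_def)

text \<open>
  The diagonal of $\Theta_n(1)$ is constant with value $4$.
\<close>

lemma D_mat_eq: "D_mat dg m a = mat_diag (m^2) (\<lambda>k. Theta_mat dg m a $$ (k, k) / 4)"
proof -
  let ?n = "m^2"
  have "diag_part (Theta_mat dg m (\<lambda>x. 1)) = mat_diag ?n (\<lambda>k. 4)"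
    unfolding diag_part_def mat_diag_def Theta_dim
    by (rule eq_matI) (simp_all add: Theta_one five_point_def)
  moreover have "inv_mat (mat_diag ?n (\<lambda>k. 4 :: real)) = mat_diag ?n (\<lambda>k. 1 / 4)"
    by (rule inv_mat_unique[of _ ?n]) (simp_all add: mat_diag_diag mat_diag_one mat_diag_dim)
  moreover have "diag_part (Theta_mat dg m a) = mat_diag ?n (\<lambda>k. Theta_mat dg m a $$ (k, k))"
    by (simp add: diag_part_def Theta_mat_def)
  ultimately show ?thesis unfolding D_mat_def A_mat_zero by (simp add: mat_diag_diag)
qed

lemma P_mat_entry:
  assumes "k < m^2" "l < m^2"
  shows "P_mat dg m a $$ (k, l) = sqrt (Theta_mat dg m a $$ (k, k) / 4) * five_point m k l * sqrt (Theta_mat dg m a $$ (l, l) / 4)"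
proof -
  let ?n = "m^2" and ?s = "\<lambda>k. sqrt (Theta_mat dg m a $$ (k, k) / 4)"
  have S: "diag_sqrt (D_mat dg m a) = mat_diag ?n ?s"
    unfolding D_mat_eq diag_sqrt_def mat_diag_def by (rule eq_matI) simp_all
  have T: "Theta_mat dg m (\<lambda>x. 1) \<in> carrier_mat ?n ?n" by (simp add: Theta_mat_def)
  have P: "P_mat dg m a = Matrix.mat ?n ?n (\<lambda>(i, j). ?s i * Theta_mat dg m (\<lambda>x. 1) $$ (i, j)) * mat_diag ?n ?s"
    unfolding P_mat_def A_mat_zero S mat_diag_mult_left[OF T] ..
  show ?thesis
    unfolding P using assms by (simp_all add: mat_diag_mult_right[of _ ?n ?n] Theta_one mult_ac)
qed

lemma P_mat_carrier: "P_mat dg m a \<in> carrier_mat (m^2) (m^2)"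
proof -
  have "diag_sqrt (D_mat dg m a) \<in> carrier_mat (m^2) (m^2)" unfolding D_mat_eq diag_sqrt_def by (simp add: mat_diag_def)
  then show ?thesis unfolding P_mat_def A_mat_zero by (auto simp: Theta_mat_def intro!: mult_carrier_mat)
qed

lemma Re_A_entry:
  assumes k: "k < m^2" and l: "l < m^2"
  shows "Re_mat (A_mat dg m a \<beta>) $$ (k, l) = Theta_mat dg m a $$ (k, l) + (Psi_mat dg m \<beta> $$ (k, l) + Psi_mat dg m \<beta> $$ (l, k)) / 2"
proof -
  have c: "Theta_mat dg m a \<in> carrier_mat (m^2) (m^2)" "Psi_mat dg m \<beta> \<in> carrier_mat (m^2) (m^2)"
    by (simp_all add: Theta_mat_def Psi_mat_def)
  show ?thesis using c k l Theta_symmetric[OF l k, of dg a]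
    by (simp add: Re_mat_def A_mat_def field_simps)
qed

lemma Re_A_carrier: "Re_mat (A_mat dg m a \<beta>) \<in> carrier_mat (m^2) (m^2)"
  by (simp add: Re_mat_def A_mat_def Theta_mat_def Psi_mat_def)

abbreviation (input) precond :: "diagonal \<Rightarrow> nat \<Rightarrow> (real \<times> real \<Rightarrow> real) \<Rightarrow> (real \<times> real \<Rightarrow> real \<times> real) \<Rightarrow> complex mat" where
  "precond dg m a \<beta> \<equiv> map_mat complex_of_real (inv_mat (P_mat dg m a) * Re_mat (A_mat dg m a \<beta>))"

text \<open>
  The matrix estimates are applied with $c = a_0 h^2$, $e = C h^2$ and $K = h^{-2}/(4 a_0^2)$. Since $n = m^2 \le h^{-2}$, the powers
  of $h$ cancel.
\<close>

lemma uniform_spectral_bounds: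
  fixes \<beta> :: "real \<times> real \<Rightarrow> real \<times> real"
  assumes a_C2: "C_closure 2 unit_square a" and a0: "0 < a0" and a_ge: "\<forall>x\<in>closure unit_square. a0 \<le> a x"
    and beta_C1: "\<forall>b\<in>Basis. C_closure 1 unit_square (\<lambda>x. \<beta> x \<bullet> b)"
    and div_beta: "\<forall>x\<in>unit_square. 0 \<le> divergence \<beta> x"
  shows "\<exists>C\<ge>0. \<forall>m.
    spectrum (precond dg m a \<beta>)
      \<subseteq> complex_of_real ` {1 / (1 + 9 * C / a0)..1 + 9 * C / a0} \<and>
    (\<forall>\<epsilon>>0. \<epsilon>^2 * real (size {#z \<in># proots (char_poly (precond dg m a \<beta>)). z \<notin> complex_of_real ` {1 - \<epsilon><..<1 + \<epsilon>}#})
      \<le> 81 * C^2 / (4 * a0^2))"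
proof -
  have a: "sq_bounded a" by (rule sq_bounded_continuous[OF C_closure_mono_continuous[OF a_C2]])
  obtain a1 where a1: "\<forall>x\<in>closure unit_square. \<bar>a x\<bar> \<le> a1"
    using C_closure_bounded[OF unit_square_convex_bounded(2) a_C2] by blast
  have bd: "a0 \<le> a p \<and> a p \<le> a1" if "p \<in> unit_square" for p
    using a1 a_ge that closure_subset[of unit_square] by fastforce
  \<comment> \<open>Some point of the square is needed to see that upper bounds over the square are nonnegative.\<close>
  have "(1/2, 1/2) \<in> unit_square" by (simp add: unit_square_def)
  then have a1_pos: "0 \<le> a1" using bd a0 by fastforce
  have "\<exists>G L B. 0 \<le> L \<and> 0 \<le> B \<and> (\<forall>x\<in>unit_square. \<forall>c\<in>unit_square. \<bar>a x - a c - G c \<bullet> (x - c)\<bar> \<le> L * (norm (x - c))^2)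
      \<and> (\<forall>c\<in>unit_square. norm (G c) \<le> B)"
  proof (rule C2_taylor[OF unit_square_convex_bounded(2,1) a_C2])
    fix G :: "real \<times> real \<Rightarrow> real \<times> real" and L B :: real
    assume "0 \<le> L" "0 \<le> B" and T: "\<And>x c. x \<in> unit_square \<Longrightarrow> c \<in> unit_square \<Longrightarrow> \<bar>a x - a c - G c \<bullet> (x - c)\<bar> \<le> L * (norm (x - c))^2"
      and GB: "\<And>c. c \<in> unit_square \<Longrightarrow> norm (G c) \<le> B"
    then show ?thesis by (intro exI[of _ G] exI[of _ L] exI[of _ B]) simp
  qed
  then obtain G L B where L: "0 \<le> L" and B: "0 \<le> B"
    and T: "\<And>x c. x \<in> unit_square \<Longrightarrow> c \<in> unit_square \<Longrightarrow> \<bar>a x - a c - G c \<bullet> (x - c)\<bar> \<le> L * (norm (x - c))^2"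
    and GB: "\<And>c. c \<in> unit_square \<Longrightarrow> norm (G c) \<le> B"
    by blast
  obtain q where q: "sq_bounded q" and q_div: "\<forall>p\<in>unit_square. q p = divergence \<beta> p"
    and Psi: "\<forall>dg m k l. k < m^2 \<longrightarrow> l < m^2 \<longrightarrow> Psi_mat dg m \<beta> $$ (k, l) + Psi_mat dg m \<beta> $$ (l, k) =
      sq_integral (\<lambda>p. q p * (hat_fn dg m k p * hat_fn dg m l p))"
    using Psi_symmetric_part[OF beta_C1] by blast
  have q0: "0 \<le> q p" if "p \<in> unit_square" for p using div_beta q_div that by simp
  obtain b where b: "\<forall>p\<in>unit_square. \<bar>q p\<bar> \<le> b" using q unfolding sq_bounded_def by blast
  then have b0: "0 \<le> b" using \<open>(1/2, 1/2) \<in> unit_square\<close> abs_ge_zero order_trans by blast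
  \<comment> \<open>The first summand bounds the error of the geometric means, the second one half of the mass matrix.\<close>
  define C where "C = ((B + 32 * L)^2 + a1 * (64 * L)) / a0 + 2 * b"
  have C1: "0 \<le> ((B + 32 * L)^2 + a1 * (64 * L)) / a0" using a0 L B a1_pos by simp
  then have C: "0 \<le> C" using b0 unfolding C_def by simp
  have main: "spectrum (precond dg m a \<beta>)
      \<subseteq> complex_of_real ` {1 / (1 + 9 * C / a0)..1 + 9 * C / a0}"
    "\<epsilon>^2 * real (size {#z \<in># proots (char_poly (precond dg m a \<beta>)). z \<notin> complex_of_real ` {1 - \<epsilon><..<1 + \<epsilon>}#})
      \<le> 81 * C^2 / (4 * a0^2)" if "0 < \<epsilon>" for m \<epsilon>
  proof -
    let ?n = "m^2" and ?H = "real (m + 1)"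
    let ?P = "P_mat dg m a" and ?R = "Re_mat (A_mat dg m a \<beta>)" and ?T = "\<lambda>k l. Theta_mat dg m a $$ (k, l)"
    let ?M = "\<lambda>k l. sq_integral (\<lambda>p. q p * (hat_fn dg m k p * hat_fn dg m l p))"
    let ?s = "\<lambda>k. sqrt (?T k k / 4)"
    have H: "0 < ?H" by simp
    have R: "?R $$ (k, l) = ?T k l + ?M k l / 2" if "k < ?n" "l < ?n" for k l
      using Re_A_entry[OF that, of dg a \<beta>] Psi that by simp
    have P: "?P $$ (k, l) = ?s k * five_point m k l * ?s l" if "k < ?n" "l < ?n" for k l
      by (rule P_mat_entry[OF that])
    have T_lower: "a0 \<le> ?T k k / 4" if "k < ?n" for k
      by (rule Theta_diag_bounds(1)[OF that a bd])
    have s: "a0 \<le> (?s k)^2" if "k < ?n" for k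
      using T_lower[OF that] a0 by simp
    have fp_sym: "five_point m k l = five_point m l k" for k l by (auto simp: five_point_def)
    have M_sym: "?M k l = ?M l k" for k l by (simp add: mult.commute)
    have symP: "?P $$ (k, l) = ?P $$ (l, k)" if "k < ?n" "l < ?n" for k l
      using that fp_sym[of k l] by (simp add: P)
    have symR: "?R $$ (k, l) = ?R $$ (l, k)" if "k < ?n" "l < ?n" for k l
      using that M_sym[of k l] Theta_symmetric[OF that, of dg a] by (simp only: R)
    have poinc: "(\<Sum>k<?n. (x k)^2) / ?H^2 \<le> (\<Sum>k<?n. \<Sum>l<?n. x k * five_point m k l * x l)" for x
      using five_point_poincare[where x = x and m = m] H by (simp add: divide_le_eq mult.commute)
    have posP: "a0 / ?H^2 * (\<Sum>k<?n. (x k)^2) \<le> quad_form ?P x" for x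
    proof -
      have "a0 * (\<Sum>k<?n. (x k)^2) \<le> (\<Sum>k<?n. (?s k * x k)^2)"
        unfolding sum_distrib_left power_mult_distrib using s by (intro sum_mono mult_right_mono) auto
      then have "a0 / ?H^2 * (\<Sum>k<?n. (x k)^2) \<le> (\<Sum>k<?n. (?s k * x k)^2) / ?H^2"
        using H by (simp add: divide_right_mono)
      also have "\<dots> \<le> (\<Sum>k<?n. \<Sum>l<?n. (?s k * x k) * five_point m k l * (?s l * x l))"
        by (rule poinc)
      also have "\<dots> = quad_form ?P x"
        using P_mat_carrier[of dg m a] by (simp add: quad_form_def P mult_ac)
      finally show ?thesis .
    qed
    have posR: "a0 / ?H^2 * (\<Sum>k<?n. (x k)^2) \<le> quad_form ?R x" for x
    proof -
      have "a0 / ?H^2 * (\<Sum>k<?n. (x k)^2) \<le> a0 * (\<Sum>k<?n. \<Sum>l<?n. x k * five_point m k l * x l)"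
        using mult_left_mono[OF poinc[of x], of a0] a0 by simp
      also have "\<dots> \<le> (\<Sum>k<?n. \<Sum>l<?n. x k * ?T k l * x l)"
        using bd by (intro stiffness_form_lower a) blast
      also have "\<dots> \<le> (\<Sum>k<?n. \<Sum>l<?n. x k * ?T k l * x l) + (\<Sum>k<?n. \<Sum>l<?n. x k * ?M k l * x l) / 2"
        using mass_form_nonneg[where x = x and n = ?n and dg = dg and m = m, OF q q0] by simp
      also have "\<dots> = (\<Sum>k<?n. \<Sum>l<?n. x k * ?T k l * x l + x k * ?M k l * x l / 2)"
        by (simp only: sum.distrib sum_divide_distrib)
      also have "\<dots> = (\<Sum>k<?n. \<Sum>l<?n. x k * ?R $$ (k, l) * x l)"
        by (intro sum.cong refl) (simp add: R distrib_left distrib_right)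
      also have "\<dots> = quad_form ?R x"
        using Re_A_carrier[of dg m a \<beta>] by (simp add: quad_form_def)
      finally show ?thesis .
    qed
    have M_bound: "\<bar>?M k l / 2\<bar> \<le> 2 * b / ?H^2" for k l
      using mass_entry_bound[where dg = dg and m = m and k = k and l = l, OF q _ b0] b by simp
    have zero: "?R $$ (k, l) = ?P $$ (k, l)" if "k < ?n" "l < ?n" "l \<notin> block m k" for k l
    proof -
      have "?M k l = 0" by (simp only: mass_outside_block[OF that] mult_zero_right) (simp add: set_lebesgue_integral_def)
      moreover have "five_point m k l = 0" by (rule five_point_outside_block[OF that])
      moreover from this have "?T k l = 0" by (rule Theta_zero[OF that(1,2) a])
      ultimately show ?thesis by (simp only: R[OF that(1,2)] P[OF that(1,2)] mult_zero_right mult_zero_left div_0 add_0_right)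
    qed
    have err: "\<bar>?R $$ (k, l) - ?P $$ (k, l)\<bar> \<le> C / ?H^2" if kl: "k < ?n" "l < ?n" for k l
    proof -
      have main: "\<bar>?T k l - ?s k * five_point m k l * ?s l\<bar> \<le> ((B + 32 * L)^2 + a1 * (64 * L)) / a0 / ?H^2"
      proof -
        have nonneg: "0 \<le> ((B + 32 * L)^2 + a1 * (64 * L)) / a0 / ?H^2"
          by (rule divide_nonneg_nonneg[OF C1]) simp
        consider "k = l" | "five_point m k l = 0" | "five_point m k l = -1"
          using five_point_values[of m k l] by blast
        then show ?thesis
        proof cases
          case 1
          have fp: "five_point m l l = 4" by (simp add: five_point_def)
          have "?s l * five_point m l l * ?s l = 4 * (?s l)^2"
            unfolding fp by (simp only: power2_eq_square mult.commute mult.left_commute)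
          also have "(?s l)^2 = ?T l l / 4" using T_lower[OF kl(2)] a0 by (intro real_sqrt_pow2) linarith
          finally have "?T k l - ?s k * five_point m k l * ?s l = 0" using 1 by simp
          then show ?thesis using nonneg by simp
        next
          case 2
          then show ?thesis using Theta_zero[OF kl a 2, of dg] nonneg by simp
        next
          case 3
          have "\<bar>?T k l + ?s k * ?s l\<bar> \<le> ((B + 32 * L)^2 + a1 * (64 * L)) / a0 / ?H^2"
            by (rule neighbour_error[OF kl 3 a a0 bd L B T GB])
          then show ?thesis using 3 by simp
        qed
      qed
      have "C / ?H^2 = ((B + 32 * L)^2 + a1 * (64 * L)) / a0 / ?H^2 + 2 * b / ?H^2"
        unfolding C_def by (rule add_divide_distrib)
      then show ?thesis using main M_bound[of k l] unfolding R[OF kl] P[OF kl] by linarith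
    qed
    have sup: "(u k)^2 \<le> ?H^2 / (4 * a0^2) * (\<Sum>j<?n. (\<Sum>l<?n. ?P $$ (j, l) * u l)^2)" if k: "k < ?n" for u k
    proof -
      have "a0 * (u k)^2 \<le> (?s k * u k)^2"
        unfolding power_mult_distrib using s[OF k] by (intro mult_right_mono) auto
      also have "\<dots> \<le> ?H^2 / 4 * (\<Sum>j<?n. (\<Sum>l<?n. five_point m j l * (?s l * u l))^2)"
        using five_point_sup_bound[OF k, of "\<lambda>l. ?s l * u l"] by simp
      finally have 1: "a0 * (u k)^2 \<le> ?H^2 / 4 * (\<Sum>j<?n. (\<Sum>l<?n. five_point m j l * (?s l * u l))^2)" .
      have "a0 * (\<Sum>j<?n. (\<Sum>l<?n. five_point m j l * (?s l * u l))^2) \<le> (\<Sum>j<?n. (?s j)^2 * (\<Sum>l<?n. five_point m j l * (?s l * u l))^2)"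
        unfolding sum_distrib_left using s by (intro sum_mono mult_right_mono) auto
      also have "\<dots> = (\<Sum>j<?n. (\<Sum>l<?n. ?P $$ (j, l) * u l)^2)"
        unfolding power_mult_distrib[symmetric] sum_distrib_left
        by (intro sum.cong refl arg_cong[where f = "\<lambda>x. x^2"]) (simp add: P mult_ac)
      finally have 2: "?H^2 / 4 * (a0 * (\<Sum>j<?n. (\<Sum>l<?n. five_point m j l * (?s l * u l))^2)) \<le> ?H^2 / 4 * (\<Sum>j<?n. (\<Sum>l<?n. ?P $$ (j, l) * u l)^2)"
        by (intro mult_left_mono) auto
      have "a0 * (a0 * (u k)^2) \<le> a0 * (?H^2 / 4 * (\<Sum>j<?n. (\<Sum>l<?n. five_point m j l * (?s l * u l))^2))"
        using 1 a0 by (intro mult_left_mono) auto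
      also have "\<dots> \<le> ?H^2 / 4 * (\<Sum>j<?n. (\<Sum>l<?n. ?P $$ (j, l) * u l)^2)"
        using 2 by (simp only: mult.left_commute)
      finally have "a0^2 * (u k)^2 \<le> ?H^2 / 4 * (\<Sum>j<?n. (\<Sum>l<?n. ?P $$ (j, l) * u l)^2)"
        by (simp only: power2_eq_square mult.assoc)
      then have "(u k)^2 \<le> ?H^2 / 4 * (\<Sum>j<?n. (\<Sum>l<?n. ?P $$ (j, l) * u l)^2) / a0^2"
        using a0 by (subst pos_le_divide_eq) (simp_all only: zero_less_power mult.commute)
      then show ?thesis by (simp add: field_simps)
    qed
    have c: "0 < a0 / ?H^2" using a0 H by simp
    have e: "0 \<le> C / ?H^2" using C by simp
    have K: "0 \<le> ?H^2 / (4 * a0^2)" by simp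
    note eig = preconditioned_eigenvalues[where n = "?n" and P = ?P and R = ?R and c = "a0 / ?H^2" and N = "block m"
        and e = "C / ?H^2" and K = "?H^2 / (4 * a0^2)", OF P_mat_carrier Re_A_carrier symP symR c posP posR
        block_finite block_card block_sym zero err e sup K]
    have eig1: "spectrum (precond dg m a \<beta>)
        \<subseteq> complex_of_real ` {1 / (1 + 9 * (C / ?H^2) / (a0 / ?H^2))..1 + 9 * (C / ?H^2) / (a0 / ?H^2)}"
      by (rule eig(1))
    have "9 * (C / ?H^2) / (a0 / ?H^2) = 9 * C / a0" using H by (simp add: field_simps)
    with eig1 show "spectrum (precond dg m a \<beta>) \<subseteq> complex_of_real ` {1 / (1 + 9 * C / a0)..1 + 9 * C / a0}"
      by simp
    have "\<epsilon>^2 * real (size {#z \<in># proots (char_poly (precond dg m a \<beta>)).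
        z \<notin> complex_of_real ` {1 - \<epsilon><..<1 + \<epsilon>}#}) \<le> 81 * (C / ?H^2)^2 * (real ?n * (?H^2 / (4 * a0^2)))"
      by (rule eig(2)) (use that in simp_all)
    also have "\<dots> = 81 * C^2 / (4 * a0^2) * (real ?n / ?H^2)"
    proof -
      have "81 * (C / h)^2 * (N * (h / (4 * d))) = 81 * C^2 / (4 * d) * (N / h)" if "0 < h" "0 < d" for h d N
        using that by (simp add: field_simps power2_eq_square)
      then show ?thesis using H a0 by (metis zero_less_power)
    qed
    also have "\<dots> \<le> 81 * C^2 / (4 * a0^2) * 1"
    proof (rule mult_left_mono)
      have "(real m)^2 \<le> ?H^2" by (intro power_mono) auto
      then show "real ?n / ?H^2 \<le> 1" using H by (simp add: divide_le_eq)
    qed simp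
    finally show "\<epsilon>^2 * real (size {#z \<in># proots (char_poly (precond dg m a \<beta>)).
        z \<notin> complex_of_real ` {1 - \<epsilon><..<1 + \<epsilon>}#}) \<le> 81 * C^2 / (4 * a0^2)" by simp
  qed
  show ?thesis
  proof (intro exI[of _ C] conjI allI impI C)
    fix m
    have "0 < (1 :: real)" by simp
    then show "spectrum (precond dg m a \<beta>)
      \<subseteq> complex_of_real ` {1 / (1 + 9 * C / a0)..1 + 9 * C / a0}" by (rule main(1))
  qed (rule main(2))
qed

theorem theorem5p3:
  fixes dg :: diagonal
    and a :: "real \<times> real \<Rightarrow> real"
    and a0 :: real
    and \<beta> :: "real \<times> real \<Rightarrow> real \<times> real"
    and f :: "real \<times> real \<Rightarrow> real"
  assumes a_C2: "C_closure 2 unit_square a"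
    and a0_pos: "0 < a0"
    and a_ge: "\<forall>x\<in>closure unit_square. a0 \<le> a x"
    and beta_C1: "\<forall>b\<in>Basis. C_closure 1 unit_square (\<lambda>x. \<beta> x \<bullet> b)"
    and div_beta: "\<forall>x\<in>unit_square. 0 \<le> divergence \<beta> x"
    and f_measurable: "f \<in> borel_measurable (lebesgue_on unit_square)"
    and f_L2: "integrable (lebesgue_on unit_square) (\<lambda>x. (f x)\<^sup>2)"
  shows "properly_clustered
      (\<lambda>m. map_mat complex_of_real (inv_mat (P_mat dg m a) * Re_mat (A_mat dg m a \<beta>))) 1 \<and>
    (\<exists>d D. 0 < d \<and> d \<le> D \<and> (\<forall>m\<ge>1.
      spectrum (map_mat complex_of_real (inv_mat (P_mat dg m a) * Re_mat (A_mat dg m a \<beta>)))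
        \<subseteq> complex_of_real ` {d..D}))"
proof -
  obtain C where C: "0 \<le> C" and
    all: "\<forall>m. spectrum (precond dg m a \<beta>)
      \<subseteq> complex_of_real ` {1 / (1 + 9 * C / a0)..1 + 9 * C / a0} \<and>
    (\<forall>\<epsilon>>0. \<epsilon>^2 * real (size {#z \<in># proots (char_poly (precond dg m a \<beta>)). z \<notin> complex_of_real ` {1 - \<epsilon><..<1 + \<epsilon>}#})
      \<le> 81 * C^2 / (4 * a0^2))"
    using uniform_spectral_bounds[OF a_C2 a0_pos a_ge beta_C1 div_beta, of dg] by blast
  have spec: "spectrum (precond dg m a \<beta>)
      \<subseteq> complex_of_real ` {1 / (1 + 9 * C / a0)..1 + 9 * C / a0}" for m
    using all by simp
  have count: "\<epsilon>^2 * real (size {#z \<in># proots (char_poly (precond dg m a \<beta>)). z \<notin> complex_of_real ` {1 - \<epsilon><..<1 + \<epsilon>}#})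
      \<le> 81 * C^2 / (4 * a0^2)" if "0 < \<epsilon>" for m \<epsilon>
    using all that by simp
  have t: "0 \<le> 9 * C / a0" using C a0_pos by simp
  show ?thesis
  proof (intro conjI)
    show "properly_clustered (\<lambda>m. precond dg m a \<beta>) 1"
      unfolding properly_clustered_def
    proof (intro allI impI)
      fix \<epsilon> :: real assume eps: "0 < \<epsilon>"
      let ?N = "\<lambda>m. size {#z \<in># proots (char_poly (precond dg m a \<beta>)). z \<notin> complex_of_real ` {1 - \<epsilon><..<1 + \<epsilon>}#}"
      have "?N m \<le> nat \<lceil>81 * C^2 / (4 * a0^2) / \<epsilon>^2\<rceil>" for m
      proof -
        have "real (?N m) \<le> 81 * C^2 / (4 * a0^2) / \<epsilon>^2"
          using count[OF eps] eps by (subst pos_le_divide_eq) (simp_all only: zero_less_power mult.commute)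
        also have "\<dots> \<le> real (nat \<lceil>81 * C^2 / (4 * a0^2) / \<epsilon>^2\<rceil>)" by (rule real_nat_ceiling_ge)
        finally show ?thesis by simp
      qed
      then show "\<exists>C. \<forall>m\<ge>1. ?N m \<le> C" by blast
    qed
    have "1 / (1 + 9 * C / a0) \<le> 1" using t by (subst divide_le_eq_1_pos) auto
    moreover have "1 \<le> 1 + 9 * C / a0" "0 < 1 / (1 + 9 * C / a0)" using t by auto
    ultimately have "0 < 1 / (1 + 9 * C / a0)" "1 / (1 + 9 * C / a0) \<le> 1 + 9 * C / a0"
      by (blast intro: order.trans)+
    then show "\<exists>d D. 0 < d \<and> d \<le> D \<and> (\<forall>m\<ge>1.
      spectrum (precond dg m a \<beta>) \<subseteq> complex_of_real ` {d..D})"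
      using spec by blast
  qed
qed

end
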